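(* For every $\varepsilon>0$ and $N\ge 0$ there are constants $A,B$ depending only on $\varepsilon$ and $N$, and for every $p\in(0,1)$ constants $A_p,B_p$ depending only on $\varepsilon$, $N$ and $p$, with the following property. Let $\mu$ be a positive Borel measure on $\mathbb{C}$ with $\mu(B(x,r))\le r$ for all $x\in\mathbb{C}$, $r>0$, let $K$ be a Calderón–Zygmund kernel with exponent $\varepsilon$, and assume that the operator $T\varphi(x)=\int_{\mathbb{C}}K(x,y)\varphi(y)\,d\mu(y)$ is bounded on $L^2(\mu)$ with $\|T\|_{L^2(\mu)\to L^2(\mu)}\le N$. Then for every $\varphi\in L^q(\mu)$, $1\le q<\infty$, and every $x\in\mathbb{C}$, $$T^\sharp\varphi(x)\le A_p\,\bigl\{M(|T\varphi|^p)(x)\bigr\}^{1/p}+B_p\,M\varphi(x)\qquad\text{for every } p\in(0,1),$$ and also $$T^\sharp\varphi(x)\le A\,M(T\varphi)(x)+B\,M\varphi(x).$$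
   Context: $B(x,r)=\{y\in\mathbb{C}:|x-y|<r\}$. A Calderón–Zygmund kernel with exponent $\varepsilon>0$ is a function $K:\{(x,y)\in\mathbb{C}^2:x\ne y\}\to\mathbb{C}$ such that $|K(x,y)|\le \frac{1}{|x-y|}$ for $x\neq y$, and $$|K(x,y)-K(x',y)|\le\frac{|x-x'|^{\varepsilon}}{|x-y|^{1+\varepsilon}},\qquad |K(y,x)-K(y,x')|\le\frac{|x-x'|^{\varepsilon}}{|x-y|^{1+\varepsilon}}\qquad\text{whenever } |x-x'|\le\tfrac12|x-y|,\ x\ne y.$$ That $T\varphi(x)=\int K(x,y)\varphi(y)\,d\mu(y)$ is a bounded operator on $L^2(\mu)$ means: $T$ is a bounded linear operator on $L^2(\mu)$ such that for every $\varphi\in L^2(\mu)$ this formula holds for $\mu$-a.e. $x$ outside the closed support of $\varphi$ (where the integral converges absolutely). Under these hypotheses $T$ extends by continuity from $L^2(\mu)\cap L^q(\mu)$ to a bounded operator on $L^q(\mu)$ for $1<q<\infty$ and to a bounded operator from $L^1(\mu)$ to $L^{1,\infty}(\mu)$ (weak $L^1$); the extensions are still denoted $T$. Truncations and maximal singular operator: $T_r\varphi(x)=\int_{\mathbb{C}\setminus B(x,r)}K(x,y)\varphi(y)\,d\mu(y)$ and $T^\sharp\varphi(x)=\sup_{r>0}|T_r\varphi(x)|$. Maximal function (with values in $[0,\infty]$): $M\varphi(x)=\sup\bigl\{\mu(B(x,r))^{-1}\int_{B(x,r)}|\varphi|\,d\mu:\ r>0,\ \mu(B(x,r))>0\bigr\}$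 (supremum over the empty set equal to $0$). *)

theory Defs
  imports "HOL-Analysis.Analysis"
begin

definition cz_kernel :: "real \<Rightarrow> (complex \<Rightarrow> complex \<Rightarrow> complex) \<Rightarrow> bool" where
  \<comment> \<open>The values of \<open>K\<close> on the diagonal are unconstrained.\<close>
  "cz_kernel \<epsilon> K \<longleftrightarrow>
     (\<forall>x y. x \<noteq> y \<longrightarrow> cmod (K x y) \<le> 1 / cmod (x - y)) \<and>
     (\<forall>x x' y. x \<noteq> y \<and> cmod (x - x') \<le> cmod (x - y) / 2 \<longrightarrow>
        cmod (K x y - K x' y) \<le> cmod (x - x') powr \<epsilon> / cmod (x - y) powr (1 + \<epsilon>) \<and>
        cmod (K y x - K y x') \<le> cmod (x - x') powr \<epsilon> / cmod (x - y) powr (1 + \<epsilon>))"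

definition linear_growth :: "complex measure \<Rightarrow> bool" where
  "linear_growth \<mu> \<longleftrightarrow> (\<forall>x r. r > 0 \<longrightarrow> emeasure \<mu> (ball x r) \<le> ennreal r)"

text \<open>
  Elements of \<open>L\<^sup>q(\<mu>)\<close> are represented by functions defined everywhere; an operator acts on
  representatives, and identities between its values are required only almost everywhere.
\<close>

definition Lq :: "complex measure \<Rightarrow> real \<Rightarrow> (complex \<Rightarrow> complex) set" where
  "Lq \<mu> q = {f \<in> borel_measurable \<mu>. integrable \<mu> (\<lambda>x. cmod (f x) powr q)}"

definition Lq_norm :: "complex measure \<Rightarrow> real \<Rightarrow> (complex \<Rightarrow> complex) \<Rightarrow> real" where
  "Lq_norm \<mu> q f = (LINT x|\<mu>. cmod (f x) powr q) powr (1 / q)"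

type_synonym operator = "(complex \<Rightarrow> complex) \<Rightarrow> (complex \<Rightarrow> complex)"

definition linear_on_Lq :: "complex measure \<Rightarrow> real \<Rightarrow> operator \<Rightarrow> bool" where
  "linear_on_Lq \<mu> q T \<longleftrightarrow>
     (\<forall>f \<in> Lq \<mu> q. \<forall>g \<in> Lq \<mu> q. AE x in \<mu>. T (\<lambda>y. f y + g y) x = T f x + T g x) \<and>
     (\<forall>f \<in> Lq \<mu> q. \<forall>c. AE x in \<mu>. T (\<lambda>y. c * f y) x = c * T f x)"

definition strong_type :: "complex measure \<Rightarrow> real \<Rightarrow> real \<Rightarrow> operator \<Rightarrow> bool" where
  "strong_type \<mu> q C T \<longleftrightarrow> linear_on_Lq \<mu> q T \<and>
     (\<forall>f \<in> Lq \<mu> q. T f \<in> Lq \<mu> q \<and> Lq_norm \<mu> q (T f) \<le> C * Lq_norm \<mu> q f)"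

definition weak_type_1_1 :: "complex measure \<Rightarrow> real \<Rightarrow> operator \<Rightarrow> bool" where
  "weak_type_1_1 \<mu> C T \<longleftrightarrow> linear_on_Lq \<mu> 1 T \<and>
     (\<forall>f \<in> Lq \<mu> 1. T f \<in> borel_measurable \<mu> \<and>
        (\<forall>t>0. emeasure \<mu> {x \<in> space \<mu>. cmod (T f x) > t} \<le> ennreal (C * Lq_norm \<mu> 1 f / t)))"

text \<open>
  The closed support of an element of \<open>L\<^sup>2(\<mu>)\<close> has to be independent of the representative:
  it is the complement of the largest open set on which the function vanishes almost everywhere.
\<close>

definition closed_support :: "complex measure \<Rightarrow> (complex \<Rightarrow> complex) \<Rightarrow> complex set" where
  "closed_support \<mu> f = {x. \<forall>r>0. emeasure \<mu> {y \<in> ball x r. f y \<noteq> 0} > 0}"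

definition cz_operator ::
  "complex measure \<Rightarrow> (complex \<Rightarrow> complex \<Rightarrow> complex) \<Rightarrow> real \<Rightarrow> operator \<Rightarrow> bool" where
  "cz_operator \<mu> K N T \<longleftrightarrow> strong_type \<mu> 2 N T \<and>
     (\<forall>f \<in> Lq \<mu> 2. AE x in \<mu>. x \<notin> closed_support \<mu> f \<longrightarrow>
        integrable \<mu> (\<lambda>y. K x y * f y) \<and> T f x = (LINT y|\<mu>. K x y * f y))"

text \<open>
  \<open>S\<close> is the extension by continuity of \<open>T\<close> to \<open>L\<^sup>q(\<mu>)\<close>, with values in \<open>L\<^sup>q(\<mu>)\<close> for
  \<open>q > 1\<close> and in weak \<open>L\<^sup>1(\<mu>)\<close> for \<open>q = 1\<close>. Since \<open>L\<^sup>2(\<mu>) \<inter> L\<^sup>q(\<mu>)\<close> is dense in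
  \<open>L\<^sup>q(\<mu>)\<close>, \<open>S f\<close> is determined almost everywhere for every \<open>f\<close> in \<open>L\<^sup>q(\<mu>)\<close>.
\<close>

definition is_extension :: "complex measure \<Rightarrow> operator \<Rightarrow> real \<Rightarrow> operator \<Rightarrow> bool" where
  "is_extension \<mu> T q S \<longleftrightarrow>
     (\<exists>C. if q = 1 then weak_type_1_1 \<mu> C S else strong_type \<mu> q C S) \<and>
     (\<forall>f \<in> Lq \<mu> 2 \<inter> Lq \<mu> q. AE x in \<mu>. S f x = T f x)"

definition truncated ::
  "complex measure \<Rightarrow> (complex \<Rightarrow> complex \<Rightarrow> complex) \<Rightarrow> real \<Rightarrow> operator" where
  "truncated \<mu> K r f x = (LINT y : - ball x r | \<mu>. K x y * f y)"

definition maximal_singular ::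
  "complex measure \<Rightarrow> (complex \<Rightarrow> complex \<Rightarrow> complex) \<Rightarrow> (complex \<Rightarrow> complex) \<Rightarrow> complex \<Rightarrow> ennreal" where
  "maximal_singular \<mu> K f x = (SUP r \<in> {0<..}. ennreal (cmod (truncated \<mu> K r f x)))"

text \<open>Stated for a general codomain: it is applied to complex functions and to \<open>\<bar>T \<phi>\<bar> powr p\<close>.\<close>

definition maximal_function ::
  "complex measure \<Rightarrow> (complex \<Rightarrow> 'a::real_normed_vector) \<Rightarrow> complex \<Rightarrow> ennreal" where
  "maximal_function \<mu> f x =
     (SUP r \<in> {r. r > 0 \<and> emeasure \<mu> (ball x r) > 0}.
        (\<integral>\<^sup>+ y \<in> ball x r. ennreal (norm (f y)) \<partial>\<mu>) / emeasure \<mu> (ball x r))"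

text \<open>Powers of extended nonnegative reals; meant for exponents \<open>a > 0\<close>.\<close>

definition epowr :: "ennreal \<Rightarrow> real \<Rightarrow> ennreal" where
  "epowr t a = (if t = \<infinity> then \<infinity> else ennreal (enn2real t powr a))"

end

theory Submission
  imports Defs
begin

text \<open>
  Fix \<open>x\<close> and \<open>r\<close>, and let \<open>R\<close> be the first radius \<open>3\<^sup>k r\<close> at which \<open>\<mu>\<close> is doubling around \<open>x\<close>. Passing from
  \<open>T\<^sub>r\<close> to \<open>T\<^sub>3\<^sub>R\<close> costs \<open>O(M \<phi>(x))\<close>, because the measures of the balls in between grow geometrically
  faster than their radii. For \<open>z\<close> in \<open>B(x, R)\<close> the value \<open>T\<^sub>3\<^sub>R \<phi>(x)\<close> is within \<open>O(M \<phi>(x))\<close> of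
  \<open>T \<phi>(z) - T (\<phi> 1\<^bsub>B(x, 3R)\<^esub>)(z)\<close>, and by the weak type \<open>(1,1)\<close> estimate the last term is \<open>O(M \<phi>(x))\<close> on
  half of \<open>B(x, R)\<close>. Averaging \<open>|T \<phi>|\<^sup>p\<close> over that half gives the inequality for every \<open>p > 0\<close>, with
  \<open>p = 1\<close> for the second assertion.

  The weak type estimate at level \<open>t\<close>, with constants depending on \<open>\<epsilon>\<close> and \<open>N\<close> only, is proved for \<open>\<phi>\<close> supported on
  a compact set where \<open>|\<phi>| > t\<close>. Cut \<open>\<phi>\<close> into tiny pieces \<open>\<phi>\<^sub>i\<close> near \<open>x\<^sub>i\<close>. Choose greedily weights \<open>w\<^sub>i\<close> of
  mass \<open>\<parallel>\<phi>\<^sub>i\<parallel>\<^sub>1 / t\<close>, supported in discs \<open>B(x\<^sub>i, \<rho>\<^sub>i)\<close>, with \<open>\<Sum> w\<^sub>i \<le> 1\<close> and equality on these discs, and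
  subtract from \<open>\<phi>\<^sub>i\<close> the multiple \<open>g\<^sub>i\<close> of the indicator of a doubling disc \<open>B(x\<^sub>i, R\<^sub>i)\<close>, \<open>R\<^sub>i \<ge> \<rho>\<^sub>i\<close>, with the same
  integral. Cancellation bounds \<open>\<integral>|T (\<phi>\<^sub>i - g\<^sub>i)|\<close> off \<open>B(x\<^sub>i, \<rho>\<^sub>i)\<close> by \<open>O(\<parallel>\<phi>\<^sub>i\<parallel>\<^sub>1)\<close>; the set where \<open>\<Sum> w\<^sub>i = 1\<close> has
  measure at most \<open>\<parallel>\<phi>\<parallel>\<^sub>1 / t\<close>; and \<open>\<parallel>\<Sum> g\<^sub>i\<parallel>\<^sub>2\<^sup>2 = O(t \<parallel>\<phi>\<parallel>\<^sub>1)\<close>, since a disc that meets a larger doubling disc has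
  its weight inside the triple of the latter.
\<close>

section \<open>Constants depending on \<epsilon> and N\<close>

definition tail_const :: "real \<Rightarrow> real" where
  "tail_const \<epsilon> = 3 / (1 - 3 powr - \<epsilon>)"

text \<open>The summands are the contributions of three regions in
  \<open>exists_cancelling_ball\<close>: outside the triple of the doubling disc, the shell between
  the small disc and that triple (twice the 8 of \<open>exists_doubling_radius\<close>), and the
  term with the indicator of the doubling disc inside its triple.\<close>

definition cancel_const :: "real \<Rightarrow> real \<Rightarrow> real" where
  "cancel_const \<epsilon> N = 2 * tail_const \<epsilon> + 16 + (9 + N\<^sup>2) / 2"

text \<open>The 3 pays for the exceptional sets and 18 N^2 for the good function in
  \<open>T_weak_1_1_compact_support\<close>; the further 2 N^2 pays for the bounded part and the
  small remainder in \<open>T_weak_1_1\<close>.\<close>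

definition weak_const :: "real \<Rightarrow> real \<Rightarrow> real" where
  "weak_const \<epsilon> N = 3 + 20 * N\<^sup>2 + cancel_const \<epsilon> N"

text \<open>The terms come from changing the truncation radius, from moving the first argument of
  the kernel, and from the level above which S applied to the local part is discarded.\<close>

definition cotlar_const :: "real \<Rightarrow> real \<Rightarrow> real" where
  "cotlar_const \<epsilon> N = 8 + tail_const \<epsilon> + 90 * weak_const \<epsilon> N"

lemma tail_const_nonneg: "\<epsilon> > 0 \<Longrightarrow> tail_const \<epsilon> \<ge> 0"
  using powr_less_one[of 3 "-\<epsilon>"] by (simp add: tail_const_def)

lemma cancel_const_nonneg: "\<epsilon> > 0 \<Longrightarrow> cancel_const \<epsilon> N \<ge> 0"
  using tail_const_nonneg[of \<epsilon>] by (simp add: cancel_const_def)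

lemma weak_const_pos: "\<epsilon> > 0 \<Longrightarrow> weak_const \<epsilon> N > 0"
  using cancel_const_nonneg[of \<epsilon> N] by (simp add: weak_const_def add_pos_nonneg)

lemma cotlar_const_pos: "\<epsilon> > 0 \<Longrightarrow> cotlar_const \<epsilon> N > 0"
  using weak_const_pos[of \<epsilon> N] tail_const_nonneg[of \<epsilon>] by (simp add: cotlar_const_def)

subsection \<open>Measures of linear growth\<close>

locale linear_growth_measure =
  fixes \<mu> :: "complex measure"
  assumes sets_eq [simp, measurable_cong]: "sets \<mu> = sets borel"
    and growth: "linear_growth \<mu>"
begin

lemma space_eq [simp]: "space \<mu> = UNIV"
  using sets_eq_imp_space_eq[OF sets_eq] by simp

lemma ball_in_sets [measurable]: "ball x r \<in> sets \<mu>" "cball x r \<in> sets \<mu>"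
  by (simp_all add: borel_open borel_closed)

lemma emeasure_ball_le: "r > 0 \<Longrightarrow> emeasure \<mu> (ball x r) \<le> ennreal r"
  using growth by (simp add: linear_growth_def)

lemma emeasure_bounded_finite: "bounded A \<Longrightarrow> emeasure \<mu> A < \<infinity>"
proof -
  assume "bounded A"
  then obtain r where r: "r > 0" "A \<subseteq> ball 0 r"
    using bounded_subset_ballD by blast
  have "emeasure \<mu> A \<le> emeasure \<mu> (ball 0 r)"
    using r by (intro emeasure_mono) auto
  also have "\<dots> \<le> ennreal r" using r emeasure_ball_le by blast
  finally show ?thesis by (simp add: order_le_less_trans)
qed

lemma fmeasurable_bounded: "bounded A \<Longrightarrow> A \<in> sets borel \<Longrightarrow> A \<in> fmeasurable \<mu>"
  using emeasure_bounded_finite by (simp add: fmeasurable_def)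

lemma fmeasurable_ball: "ball x r \<in> fmeasurable \<mu>"
  by (intro fmeasurable_bounded) auto

lemma emeasure_ball_eq: "emeasure \<mu> (ball x r) = ennreal (measure \<mu> (ball x r))"
  using fmeasurable_ball emeasure_eq_measure2 by blast

lemma measure_ball_le: "r > 0 \<Longrightarrow> measure \<mu> (ball x r) \<le> r"
  using emeasure_ball_le[of r x] by (simp add: emeasure_ball_eq)

lemma measure_ball_mono: "r \<le> s \<Longrightarrow> measure \<mu> (ball x r) \<le> measure \<mu> (ball x s)"
  using fmeasurable_ball by (intro measure_mono_fmeasurable) auto

text \<open>If no radius were doubling, then from the first ball of positive measure on the measure
  would grow like 9^j while the radius grows like 3^j, against linear growth.\<close>

lemma exists_doubling_index:
  assumes "emeasure \<mu> UNIV \<noteq> 0" "r > 0"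
  obtains k where "measure \<mu> (ball x (3 ^ k * r)) > 0"
    "measure \<mu> (ball x (3 ^ Suc k * r)) \<le> 9 * measure \<mu> (ball x (3 ^ k * r))"
    "\<And>j. j < k \<Longrightarrow> 9 * measure \<mu> (ball x (3 ^ j * r)) \<le> measure \<mu> (ball x (3 ^ Suc j * r))"
proof -
  define m where "m j = measure \<mu> (ball x (3 ^ j * r))" for j :: nat
  define P where "P k \<longleftrightarrow> m k > 0 \<and> m (Suc k) \<le> 9 * m k" for k
  have mono: "m i \<le> m j" if "i \<le> j" for i j
    unfolding m_def using that assms by (intro measure_ball_mono mult_right_mono power_increasing) auto
  have le: "m j \<le> 3 ^ j * r" for j
    unfolding m_def using assms by (intro measure_ball_le) auto
  have "\<exists>k. P k"
  proof (rule ccontr)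
    assume neg: "\<not> (\<exists>k. P k)"
    \<comment> \<open>The balls exhaust the plane, so they cannot all be null.\<close>
    have "\<exists>k0. m k0 > 0"
    proof (rule ccontr)
      assume "\<not> (\<exists>k0. m k0 > 0)"
      then have "m k = 0" for k
        using measure_nonneg[of \<mu> "ball x (3 ^ k * r)"] unfolding m_def by (metis less_le)
      then have z: "emeasure \<mu> (ball x (3 ^ k * r)) = 0" for k
        by (simp add: emeasure_ball_eq m_def)
      have "(\<Union>k. ball x (3 ^ k * r)) = UNIV"
      proof -
        have "\<exists>k. y \<in> ball x (3 ^ k * r)" for y
        proof -
          obtain k where "dist x y / r < 3 ^ k" using real_arch_pow[of 3 "dist x y / r"] by auto
          then show ?thesis using assms by (intro exI[of _ k]) (simp add: field_simps)
        qed
        then show ?thesis by blast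
      qed
      then have "emeasure \<mu> UNIV = 0"
        using emeasure_UN_eq_0[of \<mu> "\<lambda>k. ball x (3 ^ k * r)"] z
        by (simp add: image_subset_iff borel_open)
      then show False using assms by simp
    qed
    then obtain k0 where k0: "m k0 > 0" by blast
    have grow: "m (k0 + j) \<ge> 9 ^ j * m k0" for j
    proof (induction j)
      case (Suc j)
      have "m (k0 + j) > 0" using mono[of k0 "k0 + j"] k0 by simp
      then have "m (Suc (k0 + j)) > 9 * m (k0 + j)" using neg unfolding P_def by force
      then show ?case using Suc by simp
    qed simp
    \<comment> \<open>Dividing 9^j \<open>m k0\<close> \<le> 3^(\<open>k0\<close> + j) r by 3^j
      leaves 3^j \<open>m k0\<close> \<le> 3^\<open>k0\<close> r, which this j violates.\<close>
    obtain j where j: "3 ^ k0 * r / m k0 < 3 ^ j" using real_arch_pow[of 3 "3 ^ k0 * r / m k0"] by auto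
    have "9 ^ j * m k0 \<le> 3 ^ (k0 + j) * r" using grow[of j] le[of "k0 + j"] by linarith
    moreover have "(9::real) ^ j = 3 ^ j * 3 ^ j" by (simp flip: power_mult_distrib)
    ultimately have "3 ^ j * (3 ^ j * m k0) \<le> 3 ^ j * (3 ^ k0 * r)"
      by (simp add: power_add mult_ac)
    then have "3 ^ j * m k0 \<le> 3 ^ k0 * r" by simp
    then show False using j k0 by (simp add: field_simps)
  qed
  define k where "k = (LEAST k. P k)"
  have "P k" unfolding k_def using \<open>\<exists>k. P k\<close> by (rule LeastI_ex)
  \<comment> \<open>Below the least good index a ball is either not doubling or null, and for a null
    ball the inequality is trivial.\<close>
  moreover have "9 * m j \<le> m (Suc j)" if "j < k" for j
  proof (cases "m j > 0")
    case True then show ?thesis using not_less_Least[of j P] that unfolding k_def P_def by force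
  next
    case False
    then have "m j = 0" by (simp add: m_def less_le)
    then show ?thesis by (simp add: m_def)
  qed
  ultimately show ?thesis using that unfolding P_def m_def by blast
qed

text \<open>The bound M f(x) \<le> A on the centred maximal function, multiplied out so that no
  division occurs; on a null ball both sides vanish.\<close>

definition averages_le :: "(complex \<Rightarrow> ennreal) \<Rightarrow> complex \<Rightarrow> real \<Rightarrow> bool" where
  "averages_le f x A \<longleftrightarrow>
     (\<forall>s>0. (\<integral>\<^sup>+y\<in>ball x s. f y \<partial>\<mu>) \<le> ennreal (A * measure \<mu> (ball x s)))"

lemma averages_leD:
  "averages_le f x A \<Longrightarrow> s > 0 \<Longrightarrow> (\<integral>\<^sup>+y\<in>ball x s. f y \<partial>\<mu>) \<le> ennreal (A * measure \<mu> (ball x s))"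
  by (simp add: averages_le_def)

lemma averages_le_one: "averages_le (\<lambda>_. 1) x 1"
  by (simp add: averages_le_def emeasure_ball_eq)

text \<open>\<open>R\<close> is the first doubling radius of the form \<open>3 ^ k * r\<close>. Below it the measure grows at least by
  a factor \<open>9\<close> per step and the distance only by \<open>3\<close>, so that the contributions of the annuli decay
  geometrically towards \<open>x\<close>.\<close>

lemma exists_doubling_radius:
  assumes "emeasure \<mu> UNIV \<noteq> 0" "r > 0"
  obtains R where "R \<ge> r" "measure \<mu> (ball x R) > 0"
    "measure \<mu> (ball x (3 * R)) \<le> 9 * measure \<mu> (ball x R)"
    "\<forall>f\<in>borel_measurable \<mu>. \<forall>A\<ge>0. averages_le f x A \<longrightarrow>
      (\<integral>\<^sup>+y\<in>ball x (3 * R) - ball x r. f y * ennreal (1 / cmod (x - y)) \<partial>\<mu>) \<le> ennreal (8 * A)"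
proof -
  obtain k where k: "measure \<mu> (ball x (3 ^ k * r)) > 0"
    "measure \<mu> (ball x (3 ^ Suc k * r)) \<le> 9 * measure \<mu> (ball x (3 ^ k * r))"
    "\<And>j. j < k \<Longrightarrow> 9 * measure \<mu> (ball x (3 ^ j * r)) \<le> measure \<mu> (ball x (3 ^ Suc j * r))"
    using exists_doubling_index[OF assms] by blast
  define m where "m j = measure \<mu> (ball x (3 ^ j * r))" for j :: nat
  have m0: "m j \<ge> 0" for j by (simp add: m_def)
  have le: "m j \<le> 3 ^ j * r" for j
    unfolding m_def using assms by (intro measure_ball_le) auto
  show thesis
  proof (rule that[of "3 ^ k * r"])
    show "r \<le> 3 ^ k * r" using assms by simp
    show "measure \<mu> (ball x (3 ^ k * r)) > 0" by (rule k(1))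
    show "measure \<mu> (ball x (3 * (3 ^ k * r))) \<le> 9 * measure \<mu> (ball x (3 ^ k * r))"
      using k(2) by (simp add: mult.assoc)
    show "\<forall>f\<in>borel_measurable \<mu>. \<forall>A\<ge>0. averages_le f x A \<longrightarrow>
      (\<integral>\<^sup>+y\<in>ball x (3 * (3 ^ k * r)) - ball x r. f y * ennreal (1 / cmod (x - y)) \<partial>\<mu>) \<le> ennreal (8 * A)"
    proof (intro ballI allI impI)
      fix f :: "complex \<Rightarrow> ennreal" and A :: real
      assume [measurable]: "f \<in> borel_measurable \<mu>" and A: "A \<ge> 0" and avg: "averages_le f x A"
      define I where "I n = (\<integral>\<^sup>+y\<in>ball x (3 ^ n * r) - ball x r. f y * ennreal (1 / cmod (x - y)) \<partial>\<mu>)"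
        for n :: nat
      \<comment> \<open>On the added annulus 1 / |x - y| is at most the inverse of the inner radius,
        and the integral of f over it is at most the one over the whole larger ball.\<close>
      have step: "I (Suc n) \<le> I n + ennreal (A * m (Suc n) / (3 ^ n * r))" for n
      proof -
        have pos: "3 ^ n * r > 0" using assms by simp
        have "I (Suc n) \<le> (\<integral>\<^sup>+y. f y * ennreal (1 / cmod (x - y)) * indicator (ball x (3 ^ n * r) - ball x r) y
            + ennreal (1 / (3 ^ n * r)) * (f y * indicator (ball x (3 ^ Suc n * r)) y) \<partial>\<mu>)"
          unfolding I_def
        proof (intro nn_integral_mono)
          fix y
          have "ennreal (1 / cmod (x - y)) \<le> ennreal (1 / (3 ^ n * r))" if "y \<notin> ball x (3 ^ n * r)"
            using that pos by (intro ennreal_leI le_imp_inverse_le[unfolded inverse_eq_divide]) (auto simp: dist_norm)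
          then have "f y * ennreal (1 / cmod (x - y)) \<le> ennreal (1 / (3 ^ n * r)) * f y"
            if "y \<notin> ball x (3 ^ n * r)"
            using that by (subst mult.commute) (rule mult_right_mono, auto)
          then show "f y * ennreal (1 / cmod (x - y)) * indicator (ball x (3 ^ Suc n * r) - ball x r) y
            \<le> f y * ennreal (1 / cmod (x - y)) * indicator (ball x (3 ^ n * r) - ball x r) y
            + ennreal (1 / (3 ^ n * r)) * (f y * indicator (ball x (3 ^ Suc n * r)) y)"
            by (auto simp: indicator_def)
        qed
        also have "\<dots> = I n + ennreal (1 / (3 ^ n * r)) * (\<integral>\<^sup>+y\<in>ball x (3 ^ Suc n * r). f y \<partial>\<mu>)"
          unfolding I_def by (subst nn_integral_add, measurable) (subst nn_integral_cmult, measurable)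
        also have "\<dots> \<le> I n + ennreal (1 / (3 ^ n * r)) * ennreal (A * m (Suc n))"
          unfolding m_def using assms by (intro add_left_mono mult_left_mono averages_leD[OF avg]) auto
        also have "ennreal (1 / (3 ^ n * r)) * ennreal (A * m (Suc n)) = ennreal (A * m (Suc n) / (3 ^ n * r))"
          using A m0[of "Suc n"] pos by (subst ennreal_mult[symmetric]) auto
        finally show ?thesis .
      qed
      \<comment> \<open>The factor 9/2 reproduces itself: 9 \<open>m n\<close> \<le>
        \<open>m (Suc n)\<close> turns 9/2 \<open>m n\<close> + \<open>m (Suc n)\<close> into 3/2
        \<open>m (Suc n)\<close>, and passing to the radius 3^(n+1) r multiplies 3/2 by 3.\<close>
      have ind: "I n \<le> ennreal (A * (9 / 2 * m n / (3 ^ n * r)))" if "n \<le> k" for n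
        using that
      proof (induction n)
        case 0 show ?case by (simp add: I_def)
      next
        case (Suc n)
        have "I (Suc n) \<le> ennreal (A * (9 / 2 * m n / (3 ^ n * r))) + ennreal (A * m (Suc n) / (3 ^ n * r))"
          using Suc step[of n] by (intro order_trans[OF step[of n]] add_right_mono) simp
        also have "\<dots> = ennreal (A * (9 / 2 * m n + m (Suc n)) / (3 ^ n * r))"
          using A m0 assms by (subst ennreal_plus[symmetric]) (auto simp: field_simps)
        also have "\<dots> \<le> ennreal (A * (9 / 2 * m (Suc n) / (3 ^ Suc n * r)))"
        proof (rule ennreal_leI)
          have "9 * m n \<le> m (Suc n)" using k(3)[of n] Suc unfolding m_def by simp
          then have "9 / 2 * m n + m (Suc n) \<le> 3 / 2 * m (Suc n)" by simp
          then have "A * (9 / 2 * m n + m (Suc n)) / (3 ^ n * r) \<le> A * (3 / 2 * m (Suc n)) / (3 ^ n * r)"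
            using A assms by (intro divide_right_mono mult_left_mono) auto
          also have "\<dots> = A * (9 / 2 * m (Suc n) / (3 ^ Suc n * r))" using assms by (simp add: field_simps)
          finally show "A * (9 / 2 * m n + m (Suc n)) / (3 ^ n * r) \<le> A * (9 / 2 * m (Suc n) / (3 ^ Suc n * r))" .
        qed
        finally show ?case .
      qed
      have "I (Suc k) \<le> ennreal (A * (9 / 2 * m k / (3 ^ k * r))) + ennreal (A * m (Suc k) / (3 ^ k * r))"
        by (intro order_trans[OF step[of k]] add_right_mono ind) simp
      also have "\<dots> = ennreal (A * ((9 / 2 * m k + m (Suc k)) / (3 ^ k * r)))"
        using A m0 assms by (subst ennreal_plus[symmetric]) (auto simp: field_simps)
      \<comment> \<open>By linear growth \<open>m k\<close> and \<open>m (Suc k)\<close> are at most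
        one and three times 3^k r, and 9/2 + 3 \<le> 8.\<close>
      also have "\<dots> \<le> ennreal (A * 8)"
      proof (intro ennreal_leI mult_left_mono A)
        have "3 ^ k * r > 0" using assms by simp
        then have "9 / 2 * m k + m (Suc k) \<le> 8 * (3 ^ k * r)"
          using le[of k] le[of "Suc k"] by (simp add: mult.assoc)
        then show "(9 / 2 * m k + m (Suc k)) / (3 ^ k * r) \<le> 8"
          using assms by (simp add: pos_divide_le_eq)
      qed
      finally show "(\<integral>\<^sup>+y\<in>ball x (3 * (3 ^ k * r)) - ball x r. f y * ennreal (1 / cmod (x - y)) \<partial>\<mu>) \<le> ennreal (8 * A)"
        by (simp add: I_def mult_ac)
    qed
  qed
qed

text \<open>The exterior of the ball is cut into annuli of ratio 3. By linear growth the
  contribution of the j-th annulus is at most A times its outer radius over the power 1 + \<epsilon>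
  of its inner radius, a geometric sequence with ratio 3^(-\<epsilon>).\<close>

lemma nn_integral_tail_le:
  assumes "r > 0" "\<epsilon> > 0" "A \<ge> 0" and [measurable]: "f \<in> borel_measurable \<mu>"
    and avg: "averages_le f x A"
  shows "(\<integral>\<^sup>+y\<in>- ball x r. f y * ennreal (1 / cmod (x - y) powr (1 + \<epsilon>)) \<partial>\<mu>)
    \<le> ennreal (A * (tail_const \<epsilon>) * r powr - \<epsilon>)"
proof -
  define c where "c j = (3 ^ j * r) powr - (1 + \<epsilon>)" for j :: nat
  define q where "q = 3 powr - \<epsilon>"
  have q: "0 < q" "q < 1" using assms by (auto simp: q_def powr_less_one)
  have c_q: "c j * (3 ^ Suc j * r) = 3 * r powr - \<epsilon> * q ^ j" for j
  proof -
    have "c j * (3 ^ Suc j * r) = 3 * (c j * (3 ^ j * r) powr 1)" using assms by simp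
    also have "c j * (3 ^ j * r) powr 1 = (3 ^ j * r) powr - \<epsilon>"
      unfolding c_def by (subst powr_add[symmetric]) simp
    also have "\<dots> = q ^ j * r powr - \<epsilon>"
      using assms unfolding q_def by (simp add: powr_mult powr_powr powr_realpow[symmetric] mult.commute)
    finally show ?thesis by simp
  qed
  have "(\<integral>\<^sup>+y\<in>- ball x r. f y * ennreal (1 / cmod (x - y) powr (1 + \<epsilon>)) \<partial>\<mu>)
    \<le> (\<integral>\<^sup>+y. (\<Sum>j. ennreal (c j) * (f y * indicator (ball x (3 ^ Suc j * r)) y)) \<partial>\<mu>)"
  proof (intro nn_integral_mono)
    fix y
    show "f y * ennreal (1 / cmod (x - y) powr (1 + \<epsilon>)) * indicator (- ball x r) y
      \<le> (\<Sum>j. ennreal (c j) * (f y * indicator (ball x (3 ^ Suc j * r)) y))"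
    proof (cases "y \<in> ball x r")
      case False
      then have d: "cmod (x - y) \<ge> r" by (simp add: dist_norm)
      define P where "P j \<longleftrightarrow> cmod (x - y) < 3 ^ Suc j * r" for j :: nat
      \<comment> \<open>The annulus containing y. Its single term dominates the integrand, so the
        sum may run over full balls and no disjointness is required.\<close>
      define j where "j = (LEAST j. P j)"
      have "\<exists>j. P j"
      proof -
        obtain k where "cmod (x - y) / r < 3 ^ k" using real_arch_pow[of 3 "cmod (x - y) / r"] by auto
        then have "cmod (x - y) < 3 ^ k * r" using assms by (simp add: field_simps)
        also have "\<dots> \<le> 3 ^ Suc k * r" using assms by simp
        finally show ?thesis unfolding P_def by blast
      qed
      then have Pj: "P j" unfolding j_def by (rule LeastI_ex)
      have lower: "3 ^ j * r \<le> cmod (x - y)"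
      proof (cases j)
        case (Suc i)
        then have "\<not> P i" using not_less_Least[of i P] unfolding j_def by simp
        then show ?thesis using Suc unfolding P_def by simp
      qed (use d in simp)
      have "3 ^ j * r > 0" using assms by simp
      then have "1 / cmod (x - y) powr (1 + \<epsilon>) \<le> c j"
        unfolding c_def powr_minus_divide using lower assms
        by (intro le_imp_inverse_le[unfolded inverse_eq_divide] powr_mono2) simp_all
      then have "f y * ennreal (1 / cmod (x - y) powr (1 + \<epsilon>)) * indicator (- ball x r) y
        \<le> ennreal (c j) * (f y * indicator (ball x (3 ^ Suc j * r)) y)"
        using Pj False unfolding P_def
        by (auto simp: dist_norm mult.commute[of "ennreal (c j)"] mult_ac intro!: mult_left_mono ennreal_leI)
      also have "\<dots> \<le> (\<Sum>j. ennreal (c j) * (f y * indicator (ball x (3 ^ Suc j * r)) y))"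
        using sum_le_suminf[of "\<lambda>j. ennreal (c j) * (f y * indicator (ball x (3 ^ Suc j * r)) y)" "{j}"] by simp
      finally show ?thesis .
    qed simp
  qed
  also have "\<dots> = (\<Sum>j. ennreal (c j) * (\<integral>\<^sup>+y\<in>ball x (3 ^ Suc j * r). f y \<partial>\<mu>))"
    by (subst nn_integral_suminf) (auto simp: nn_integral_cmult)
  also have "\<dots> \<le> (\<Sum>j. ennreal (A * (3 * r powr - \<epsilon> * q ^ j)))"
  proof (intro suminf_le summableI)
    fix j :: nat
    have pos: "3 ^ Suc j * r > 0" using assms by simp
    have "(\<integral>\<^sup>+y\<in>ball x (3 ^ Suc j * r). f y \<partial>\<mu>) \<le> ennreal (A * measure \<mu> (ball x (3 ^ Suc j * r)))"
      by (rule averages_leD[OF avg pos])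
    also have "\<dots> \<le> ennreal (A * (3 ^ Suc j * r))"
      using assms measure_ball_le[OF pos] by (intro ennreal_leI mult_left_mono) auto
    finally have "ennreal (c j) * (\<integral>\<^sup>+y\<in>ball x (3 ^ Suc j * r). f y \<partial>\<mu>) \<le> ennreal (c j) * ennreal (A * (3 ^ Suc j * r))"
      by (rule mult_left_mono) simp
    also have "\<dots> = ennreal (A * (c j * (3 ^ Suc j * r)))"
      using assms by (subst ennreal_mult[symmetric]) (auto simp: c_def mult_ac)
    finally show "ennreal (c j) * (\<integral>\<^sup>+y\<in>ball x (3 ^ Suc j * r). f y \<partial>\<mu>) \<le> ennreal (A * (3 * r powr - \<epsilon> * q ^ j))"
      unfolding c_q .
  qed
  also have "\<dots> = ennreal (\<Sum>j. A * (3 * r powr - \<epsilon> * q ^ j))"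
    using q assms by (intro suminf_ennreal2 summable_mult summable_geometric) auto
  \<comment> \<open>This sum of the geometric series is the origin of
    \<open>tail_const\<close>.\<close>
  also have "(\<Sum>j. A * (3 * r powr - \<epsilon> * q ^ j)) = A * (3 / (1 - q)) * r powr - \<epsilon>"
    using q by (simp add: suminf_mult suminf_geometric summable_geometric summable_mult)
  finally show ?thesis unfolding q_def tail_const_def .
qed


text \<open>The weights are chosen greedily: \<open>w n\<close> takes what the previous weights left of \<open>\<mu>\<close> near \<open>x n\<close>,
  with a fraction of the bounding circle, as circles may have positive measure.\<close>

lemma exists_greedy_weights:
  fixes x :: "nat \<Rightarrow> complex" and m :: "nat \<Rightarrow> real"
  assumes m: "\<And>i. m i \<ge> 0" and "ennreal (\<Sum>i<n. m i) < emeasure \<mu> UNIV"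
  shows "\<exists>w \<rho>. (\<forall>i. w i \<in> borel_measurable borel) \<and> (\<forall>i y. w i y \<ge> (0::real)) \<and>
    (\<forall>y. (\<Sum>i<n. w i y) \<le> 1) \<and>
    (\<forall>i<n. (\<integral>\<^sup>+y. ennreal (w i y) \<partial>\<mu>) = ennreal (m i) \<and>
       (\<forall>y. y \<notin> cball (x i) (\<rho> i) \<longrightarrow> w i y = 0) \<and>
       (\<forall>y\<in>ball (x i) (\<rho> i). (\<Sum>j<n. w j y) = 1))"
  using assms(2)
proof (induction n)
  case 0
  show ?case by (intro exI[of _ "\<lambda>_ _. 0"]) simp
next
  case (Suc n)
  have m_sum: "(\<Sum>i<n. m i) \<ge> 0" using m by (intro sum_nonneg) auto
  have "ennreal (\<Sum>i<n. m i) \<le> ennreal (\<Sum>i<Suc n. m i)"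
    using m by (intro ennreal_leI) auto
  also have "\<dots> < emeasure \<mu> UNIV" by (rule Suc.prems)
  finally have "ennreal (\<Sum>i<n. m i) < emeasure \<mu> UNIV" .
  from Suc.IH[OF this] obtain w \<rho> where w: "\<forall>i. w i \<in> borel_measurable borel" "\<forall>i y. w i y \<ge> (0::real)"
    "\<forall>y. (\<Sum>i<n. w i y) \<le> 1"
    "\<forall>i<n. (\<integral>\<^sup>+y. ennreal (w i y) \<partial>\<mu>) = ennreal (m i) \<and>
       (\<forall>y. y \<notin> cball (x i) (\<rho> i) \<longrightarrow> w i y = 0) \<and>
       (\<forall>y\<in>ball (x i) (\<rho> i). (\<Sum>j<n. w j y) = 1)"
    by (elim exE conjE)
  have w_meas [measurable]: "w i \<in> borel_measurable borel" for i using w(1) by blast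
  have w_nonneg: "w i y \<ge> 0" and w_sum: "(\<Sum>i<n. w i y) \<le> 1" for i y using w(2,3) by auto
  have w_int: "(\<integral>\<^sup>+y. ennreal (w i y) \<partial>\<mu>) = ennreal (m i)" if "i < n" for i
    using w(4) that by blast
  have w_supp: "w i y = 0" if "i < n" "y \<notin> cball (x i) (\<rho> i)" for i y
    using w(4) that by blast
  have w_one: "(\<Sum>j<n. w j y) = 1" if "i < n" "y \<in> ball (x i) (\<rho> i)" for i y
    using w(4) that by blast
  define W where "W y = (\<Sum>i<n. w i y)" for y
  have [measurable]: "W \<in> borel_measurable \<mu>" unfolding W_def by measurable
  have W: "0 \<le> W y" "W y \<le> 1" for y using w_nonneg w_sum by (auto simp: W_def intro: sum_nonneg)
  \<comment> \<open>What the first n weights leave of \<mu>.\<close>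
  define \<nu> where "\<nu> = density \<mu> (\<lambda>y. ennreal (1 - W y))"
  have \<nu>_sets [simp, measurable_cong]: "sets \<nu> = sets borel" by (simp add: \<nu>_def)
  have \<nu>: "emeasure \<nu> A = (\<integral>\<^sup>+y. ennreal (1 - W y) * indicator A y \<partial>\<mu>)" if "A \<in> sets borel" for A
    unfolding \<nu>_def using that by (subst emeasure_density) auto
  have \<nu>_finite: "emeasure \<nu> (ball (x n) s) < \<infinity>" for s
  proof -
    have "emeasure \<nu> (ball (x n) s) \<le> (\<integral>\<^sup>+y. indicator (ball (x n) s) y \<partial>\<mu>)"
      using W by (subst \<nu>, simp add: borel_open)
        (rule nn_integral_mono, simp split: split_indicator)
    also have "\<dots> < \<infinity>" using emeasure_bounded_finite[of "ball (x n) s"] by simp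
    finally show ?thesis .
  qed
  \<comment> \<open>The total mass of \<mu> exceeds the sum of all prescribed masses, so more than
    \<open>m n\<close> is left over.\<close>
  have \<nu>_total: "ennreal (m n) < emeasure \<nu> UNIV"
  proof (rule ccontr)
    assume "\<not> ennreal (m n) < emeasure \<nu> UNIV"
    then have "(\<integral>\<^sup>+y. ennreal (1 - W y) \<partial>\<mu>) \<le> ennreal (m n)" by (subst (asm) \<nu>) auto
    moreover have "(\<integral>\<^sup>+y. ennreal (W y) \<partial>\<mu>) = ennreal (\<Sum>i<n. m i)"
    proof -
      have "(\<integral>\<^sup>+y. ennreal (W y) \<partial>\<mu>) = (\<integral>\<^sup>+y. (\<Sum>i<n. ennreal (w i y)) \<partial>\<mu>)"
        using w_nonneg by (simp add: W_def)
      also have "\<dots> = (\<Sum>i<n. \<integral>\<^sup>+y. ennreal (w i y) \<partial>\<mu>)" by (rule nn_integral_sum) measurable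
      also have "\<dots> = (\<Sum>i<n. ennreal (m i))" using w_int by simp
      also have "\<dots> = ennreal (\<Sum>i<n. m i)" using m by (intro sum_ennreal) auto
      finally show ?thesis .
    qed
    moreover have "emeasure \<mu> UNIV = (\<integral>\<^sup>+y. ennreal (W y) + ennreal (1 - W y) \<partial>\<mu>)"
      using W by (simp flip: ennreal_plus)
    ultimately have "emeasure \<mu> UNIV \<le> ennreal (\<Sum>i<n. m i) + ennreal (m n)"
      by (subst (asm) nn_integral_add) (auto intro: add_left_mono)
    also have "\<dots> = ennreal (\<Sum>i<Suc n. m i)" using m m_sum by simp
    finally show False using Suc.prems by simp
  qed
  \<comment> \<open>For the supremum r of these radii, continuity from below gives \<nu> of the open
    disc at most \<open>m n\<close>, and continuity from above, on sets of finite measure, gives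
    \<nu> of the closed disc at least \<open>m n\<close>.\<close>
  define S where "S = {s. 0 \<le> s \<and> emeasure \<nu> (ball (x n) s) \<le> ennreal (m n)}"
  have "0 \<in> S" by (simp add: S_def)
  obtain s0 where s0: "ennreal (m n) < emeasure \<nu> (ball (x n) s0)"
  proof -
    have "(\<Union>k::nat. ball (x n) (real k)) = UNIV" by (auto simp: reals_Archimedean2)
    then have "emeasure \<nu> UNIV = (SUP k::nat. emeasure \<nu> (ball (x n) (real k)))"
      by (subst SUP_emeasure_incseq) (auto simp: borel_open incseq_def)
    then show ?thesis using \<nu>_total that by (auto simp: less_SUP_iff)
  qed
  have S_le: "s \<le> s0" if "s \<in> S" for s
  proof (rule ccontr)
    assume "\<not> s \<le> s0"
    then have "emeasure \<nu> (ball (x n) s0) \<le> emeasure \<nu> (ball (x n) s)"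
      by (intro emeasure_mono) (auto simp: borel_open)
    then show False using that s0 by (auto simp: S_def)
  qed
  then have bdd: "bdd_above S" by (auto simp: bdd_above_def)
  define r where "r = Sup S"
  have "r \<ge> 0" unfolding r_def using \<open>0 \<in> S\<close> bdd by (rule cSup_upper)
  have ball_le: "emeasure \<nu> (ball (x n) r) \<le> ennreal (m n)"
  proof -
    have "ball (x n) r = (\<Union>k::nat. ball (x n) (r - 1 / Suc k))"
    proof (intro set_eqI iffI)
      fix y assume "y \<in> ball (x n) r"
      then obtain k :: nat where "1 / Suc k < r - dist (x n) y"
        using nat_approx_posE[of "r - dist (x n) y"] by auto
      then show "y \<in> (\<Union>k::nat. ball (x n) (r - 1 / Suc k))" by (intro UN_I[of k]) auto
    next
      fix y assume "y \<in> (\<Union>k::nat. ball (x n) (r - 1 / Suc k))"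
      then obtain k :: nat where "dist (x n) y < r - 1 / Suc k" by auto
      moreover have "1 / Suc k > (0::real)" by simp
      ultimately show "y \<in> ball (x n) r" unfolding mem_ball by linarith
    qed
    moreover have "incseq (\<lambda>k::nat. ball (x n) (r - 1 / Suc k))"
      unfolding incseq_def by (intro allI impI subset_ball) (simp add: frac_le)
    ultimately have "emeasure \<nu> (ball (x n) r) = (SUP k::nat. emeasure \<nu> (ball (x n) (r - 1 / Suc k)))"
      by (subst SUP_emeasure_incseq) (auto simp: borel_open)
    also have "\<dots> \<le> ennreal (m n)"
    proof (intro SUP_least)
      fix k :: nat
      have "r - 1 / Suc k < Sup S" by (simp add: r_def)
      then obtain s where s: "s \<in> S" "r - 1 / Suc k < s"
        using less_cSupD[of S] \<open>0 \<in> S\<close> by blast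
      then have "emeasure \<nu> (ball (x n) (r - 1 / Suc k)) \<le> emeasure \<nu> (ball (x n) s)"
        by (intro emeasure_mono) (auto simp: borel_open)
      then show "emeasure \<nu> (ball (x n) (r - 1 / Suc k)) \<le> ennreal (m n)"
        using s by (auto simp: S_def)
    qed
    finally show ?thesis .
  qed
  have le_cball: "ennreal (m n) \<le> emeasure \<nu> (cball (x n) r)"
  proof -
    have "cball (x n) r = (\<Inter>k::nat. ball (x n) (r + 1 / Suc k))"
    proof (intro set_eqI iffI)
      fix y assume y: "y \<in> (\<Inter>k::nat. ball (x n) (r + 1 / Suc k))"
      show "y \<in> cball (x n) r"
      proof (rule ccontr)
        assume "y \<notin> cball (x n) r"
        then obtain k :: nat where "1 / Suc k < dist (x n) y - r"
          using nat_approx_posE[of "dist (x n) y - r"] by auto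
        moreover have "y \<in> ball (x n) (r + 1 / Suc k)" using y by blast
        ultimately show False by auto
      qed
    next
      fix y assume "y \<in> cball (x n) r"
      then show "y \<in> (\<Inter>k::nat. ball (x n) (r + 1 / Suc k))"
        by (auto intro: le_less_trans[of _ r])
    qed
    moreover have "decseq (\<lambda>k::nat. ball (x n) (r + 1 / Suc k))"
      unfolding decseq_def by (intro allI impI subset_ball) (simp add: frac_le)
    ultimately have "emeasure \<nu> (cball (x n) r) = (INF k::nat. emeasure \<nu> (ball (x n) (r + 1 / Suc k)))"
      using \<nu>_finite by (subst INF_emeasure_decseq) (auto simp: borel_open less_top)
    also have "ennreal (m n) \<le> \<dots>"
    proof (intro INF_greatest)
      fix k :: nat
      have "r < r + 1 / Suc k" by simp
      then have "r + 1 / Suc k \<notin> S" using cSup_upper[OF _ bdd] unfolding r_def by (meson not_le)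
      then show "ennreal (m n) \<le> emeasure \<nu> (ball (x n) (r + 1 / Suc k))"
        using \<open>r \<ge> 0\<close> by (auto simp: S_def)
    qed
    finally show ?thesis .
  qed
  have cball_finite: "emeasure \<nu> (cball (x n) r) < \<infinity>"
    using emeasure_mono[of "cball (x n) r" "ball (x n) (r + 1)" \<nu>] \<nu>_finite[of "r + 1"]
    by (auto simp: borel_open subset_iff intro: le_less_trans)
  define a where "a = measure \<nu> (ball (x n) r)"
  define b where "b = measure \<nu> (cball (x n) r)"
  have a: "emeasure \<nu> (ball (x n) r) = ennreal a"
    unfolding a_def using \<nu>_finite[of r] by (simp add: emeasure_eq_ennreal_measure less_top)
  have b: "emeasure \<nu> (cball (x n) r) = ennreal b"
    unfolding b_def using cball_finite by (simp add: emeasure_eq_ennreal_measure less_top)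
  have ab: "0 \<le> a" "a \<le> m n" "m n \<le> b"
    using ball_le le_cball m[of n] unfolding a b by (auto simp: a_def b_def)
  have sphere: "emeasure \<nu> (cball (x n) r - ball (x n) r) = ennreal (b - a)"
    using ab by (subst emeasure_Diff) (auto simp: a b ennreal_minus borel_open borel_closed)
  \<comment> \<open>If the circle is \<nu>-null then a = b = \<open>m n\<close>; the quotient is 0
    by the convention for division by zero, and the identity for \<open>m n\<close> still
    holds.\<close>
  define \<theta> where "\<theta> = (m n - a) / (b - a)"
  have \<theta>: "0 \<le> \<theta>" "\<theta> \<le> 1" "a + \<theta> * (b - a) = m n"
    using ab by (auto simp: \<theta>_def divide_le_eq)
  \<comment> \<open>Inside the open disc the new weight takes everything that is left, so the sum
    reaches 1 there; on the circle it takes the fraction \<theta>.\<close>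
  define v where "v y = (1 - W y) * (indicator (ball (x n) r) y + \<theta> * indicator (cball (x n) r - ball (x n) r) y)" for y
  have v_meas [measurable]: "v \<in> borel_measurable borel"
    unfolding v_def W_def by measurable
  have v_int: "(\<integral>\<^sup>+y. ennreal (v y) \<partial>\<mu>) = ennreal (m n)"
  proof -
    have "(\<integral>\<^sup>+y. ennreal (v y) \<partial>\<mu>) = (\<integral>\<^sup>+y. ennreal (1 - W y) * indicator (ball (x n) r) y
      + ennreal \<theta> * (ennreal (1 - W y) * indicator (cball (x n) r - ball (x n) r) y) \<partial>\<mu>)"
      using W \<theta> by (intro nn_integral_cong) (auto simp: v_def indicator_def ennreal_mult' mult.commute)
    also have "\<dots> = emeasure \<nu> (ball (x n) r) + ennreal \<theta> * emeasure \<nu> (cball (x n) r - ball (x n) r)"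
      by (subst nn_integral_add, measurable, subst nn_integral_cmult, measurable)
        (simp add: \<nu> borel_open borel_closed sets.Diff)
    also have "\<dots> = ennreal (m n)"
      unfolding a sphere using ab \<theta> by (simp flip: ennreal_mult ennreal_plus)
    finally show ?thesis .
  qed
  have v: "0 \<le> v y" "W y + v y \<le> 1" for y
    using W[of y] \<theta> mult_left_mono[of \<theta> 1 "1 - W y"] by (auto simp: v_def indicator_def)
  define w' where "w' = w(n := v)"
  define \<rho>' where "\<rho>' = \<rho>(n := r)"
  have sum': "(\<Sum>j<Suc n. w' j y) = W y + v y" for y
    by (simp add: w'_def W_def)
  show ?case
  proof (intro exI[of _ w'] exI[of _ \<rho>'] conjI allI impI ballI)
    show "w' i \<in> borel_measurable borel" for i by (simp add: w'_def)
    show "w' i y \<ge> 0" for i y using w_nonneg v by (simp add: w'_def)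
    show "(\<Sum>i<Suc n. w' i y) \<le> 1" for y unfolding sum' by (rule v)
    fix i assume i: "i < Suc n"
    show "(\<integral>\<^sup>+y. ennreal (w' i y) \<partial>\<mu>) = ennreal (m i)"
      using i w_int v_int by (auto simp: w'_def less_Suc_eq)
    show "w' i y = 0" if "y \<notin> cball (x i) (\<rho>' i)" for y
      using i w_supp that by (cases "i = n") (auto simp: w'_def \<rho>'_def v_def indicator_def)
    show "(\<Sum>j<Suc n. w' j y) = 1" if y: "y \<in> ball (x i) (\<rho>' i)" for y
    proof (cases "i = n")
      case True
      then show ?thesis using y unfolding sum' by (auto simp: \<rho>'_def v_def indicator_def)
    next
      case False
      \<comment> \<open>Where the earlier weights already add up to 1, the new weight vanishes and
        saturation persists.\<close>
      then have "W y = 1" using w_one[of i y] i y by (simp add: W_def \<rho>'_def)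
      then show ?thesis unfolding sum' by (simp add: v_def)
    qed
  qed
qed

text \<open>In the double sum each pair of intersecting balls is charged to the larger one, whose triple
  contains the supports of all the weights involved.\<close>

lemma integral_ball_sum_square_le:
  fixes x :: "'i \<Rightarrow> complex" and R a m :: "'i \<Rightarrow> real" and w :: "'i \<Rightarrow> complex \<Rightarrow> real"
  assumes fin: "finite I" and meas [measurable]: "\<And>i. w i \<in> borel_measurable borel"
    and nonneg: "\<And>i y. w i y \<ge> 0" and sum_le: "\<And>y. (\<Sum>i\<in>I. w i y) \<le> 1"
    and supp: "\<And>i y. i \<in> I \<Longrightarrow> y \<notin> cball (x i) (R i) \<Longrightarrow> w i y = 0"
    and int: "\<And>i. i \<in> I \<Longrightarrow> (\<integral>\<^sup>+y. ennreal (w i y) \<partial>\<mu>) = ennreal (m i)"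
    and a: "\<And>i. i \<in> I \<Longrightarrow> a i \<ge> 0" "\<And>i. i \<in> I \<Longrightarrow> a i * measure \<mu> (ball (x i) (R i)) = m i"
    and doubling: "\<And>i. i \<in> I \<Longrightarrow> measure \<mu> (ball (x i) (3 * R i)) \<le> 9 * measure \<mu> (ball (x i) (R i))"
  shows "(LINT y|\<mu>. (\<Sum>i\<in>I. a i * indicator (ball (x i) (R i)) y)\<^sup>2) \<le> 18 * (\<Sum>i\<in>I. m i)"
proof -
  define B where "B i = ball (x i) (R i)" for i
  define X where "X i j = a i * a j * measure \<mu> (B i \<inter> B j)" for i j
  have B_meas: "B i \<inter> B j \<in> fmeasurable \<mu>" for i j
    unfolding B_def by (intro fmeasurable_bounded) (auto simp: bounded_Int borel_open)
  have m: "m i \<ge> 0" if "i \<in> I" for i using a(1)[OF that] by (simp flip: a(2)[OF that])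
  have "(\<lambda>y. (\<Sum>i\<in>I. a i * indicator (B i) y)\<^sup>2)
    = (\<lambda>y. \<Sum>i\<in>I. \<Sum>j\<in>I. (a i * a j) * indicator (B i \<inter> B j) y)"
    by (auto simp: power2_eq_square sum_product fun_eq_iff indicator_inter_arith mult_ac intro!: sum.cong)
  then have "(LINT y|\<mu>. (\<Sum>i\<in>I. a i * indicator (B i) y)\<^sup>2)
    = (LINT y|\<mu>. (\<Sum>i\<in>I. \<Sum>j\<in>I. (a i * a j) * indicator (B i \<inter> B j) y))" by simp
  also have "\<dots> = (\<Sum>i\<in>I. \<Sum>j\<in>I. X i j)"
    using B_meas by (simp add: X_def integral_sum integrable_sum fmeasurable_def)
  \<comment> \<open>Of any two radii one is at least the other; by the symmetry of X it is enough to
    count the pairs in which i has the larger radius, twice.\<close>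
  also have "\<dots> \<le> (\<Sum>i\<in>I. \<Sum>j\<in>I. (if R j \<le> R i then X i j else 0) + (if R i \<le> R j then X j i else 0))"
    using a by (intro sum_mono) (auto simp: X_def Int_commute mult.commute)
  also have "\<dots> = 2 * (\<Sum>i\<in>I. \<Sum>j\<in>I. if R j \<le> R i then X i j else 0)"
    unfolding sum.distrib by (subst (2) sum.swap) simp
  also have "\<dots> \<le> 2 * (\<Sum>i\<in>I. 9 * m i)"
  proof (intro mult_left_mono sum_mono)
    fix i assume i: "i \<in> I"
    define J where "J = {j\<in>I. R j \<le> R i \<and> B i \<inter> B j \<noteq> {}}"
    have J: "finite J" "J \<subseteq> I" using fin by (auto simp: J_def)
    have "(\<Sum>j\<in>I. if R j \<le> R i then X i j else 0) = (\<Sum>j\<in>J. X i j)"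
      using fin by (intro sum.mono_neutral_cong_right) (auto simp: J_def X_def)
    also have "\<dots> \<le> (\<Sum>j\<in>J. a i * m j)"
    proof (intro sum_mono)
      fix j assume j: "j \<in> J"
      have "measure \<mu> (B i \<inter> B j) \<le> measure \<mu> (B j)"
        using fmeasurable_ball unfolding B_def by (intro measure_mono_fmeasurable) (auto simp: borel_open)
      then have "a i * (a j * measure \<mu> (B i \<inter> B j)) \<le> a i * (a j * measure \<mu> (B j))"
        using a(1) i j J by (intro mult_left_mono) auto
      also have "\<dots> = a i * m j" using a(2)[of j] j J by (auto simp: B_def)
      finally show "X i j \<le> a i * m j" by (simp add: X_def mult.assoc)
    qed
    also have "\<dots> = a i * (\<Sum>j\<in>J. m j)" by (simp add: sum_distrib_left)
    also have "\<dots> \<le> a i * (9 * measure \<mu> (B i))"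
    proof (intro mult_left_mono a(1) i)
      \<comment> \<open>The masses are the integrals of weights with sum at most 1 that all live in
        the triple of ball i, so together they cannot exceed the measure of the triple.\<close>
      have "ennreal (\<Sum>j\<in>J. m j) = (\<Sum>j\<in>J. \<integral>\<^sup>+y. ennreal (w j y) \<partial>\<mu>)"
        using int J m by (subst sum_ennreal[symmetric]) (auto intro!: sum.cong)
      also have "\<dots> = (\<integral>\<^sup>+y. (\<Sum>j\<in>J. ennreal (w j y)) \<partial>\<mu>)" by (subst nn_integral_sum) auto
      also have "\<dots> = (\<integral>\<^sup>+y. ennreal (\<Sum>j\<in>J. w j y) \<partial>\<mu>)" using nonneg by simp
      also have "\<dots> \<le> (\<integral>\<^sup>+y. indicator (ball (x i) (3 * R i)) y \<partial>\<mu>)"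
      proof (intro nn_integral_mono)
        fix y
        show "ennreal (\<Sum>j\<in>J. w j y) \<le> indicator (ball (x i) (3 * R i)) y"
        proof (cases "y \<in> ball (x i) (3 * R i)")
          case True
          have "(\<Sum>j\<in>J. w j y) \<le> (\<Sum>j\<in>I. w j y)" using J fin nonneg by (intro sum_mono2) auto
          then show ?thesis using True sum_le[of y] by simp
        next
          case False
          have "w j y = 0" if j: "j \<in> J" for j
          proof (rule supp)
            show "j \<in> I" using j J by auto
            \<comment> \<open>Going from \<open>x i\<close> through the common point z and
              \<open>x j\<close> to a point of the j-th closed disc covers a distance less than
              \<open>R i\<close> + 2 \<open>R j\<close> \<le> 3 \<open>R i\<close>.\<close>
            obtain z where z: "dist (x i) z < R i" "dist (x j) z < R j" "R j \<le> R i"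
              using j by (auto simp: J_def B_def)
            show "y \<notin> cball (x j) (R j)"
            proof
              assume "y \<in> cball (x j) (R j)"
              then have "dist (x i) y < 3 * R i"
                using z dist_triangle[of "x i" y z] dist_triangle[of z y "x j"] by (simp add: dist_commute)
              then show False using False by simp
            qed
          qed
          then show ?thesis by simp
        qed
      qed
      also have "\<dots> = ennreal (measure \<mu> (ball (x i) (3 * R i)))" by (simp add: emeasure_ball_eq)
      finally have "(\<Sum>j\<in>J. m j) \<le> measure \<mu> (ball (x i) (3 * R i))" by simp
      then show "(\<Sum>j\<in>J. m j) \<le> 9 * measure \<mu> (B i)" using doubling[OF i] unfolding B_def by simp
    qed
    also have "\<dots> = 9 * m i" using a(2)[OF i] by (simp add: B_def)
    finally show "(\<Sum>j\<in>I. if R j \<le> R i then X i j else 0) \<le> 9 * m i" .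
  qed simp
  also have "\<dots> = 18 * (\<Sum>i\<in>I. m i)" by (simp add: sum_distrib_left)
  finally show ?thesis unfolding B_def .
qed

end

subsection \<open>Lebesgue spaces\<close>

lemma Lq_measurable: "f \<in> Lq \<mu> q \<Longrightarrow> f \<in> borel_measurable \<mu>"
  by (simp add: Lq_def)

lemma Lq_dominated:
  assumes "f \<in> Lq \<mu> q" "g \<in> borel_measurable \<mu>" "q \<ge> 0" "c \<ge> 0" "\<And>x. cmod (g x) \<le> c * cmod (f x)"
  shows "g \<in> Lq \<mu> q"
proof -
  have "integrable \<mu> (\<lambda>x. cmod (g x) powr q)"
  proof (rule Bochner_Integration.integrable_bound)
    show "integrable \<mu> (\<lambda>x. c powr q * cmod (f x) powr q)" using assms by (simp add: Lq_def)
    show "AE x in \<mu>. norm (cmod (g x) powr q) \<le> norm (c powr q * cmod (f x) powr q)"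
    proof (intro AE_I2)
      fix x
      have "cmod (g x) powr q \<le> (c * cmod (f x)) powr q" using assms by (intro powr_mono2) auto
      then show "norm (cmod (g x) powr q) \<le> norm (c powr q * cmod (f x) powr q)"
        using assms by (simp add: powr_mult)
    qed
  qed (use assms in measurable)
  then show ?thesis using assms by (simp add: Lq_def)
qed

lemma Lq_cmult: "f \<in> Lq \<mu> q \<Longrightarrow> q \<ge> 0 \<Longrightarrow> (\<lambda>x. c * f x) \<in> Lq \<mu> q"
  using Lq_measurable[of f \<mu> q]
  by (rule_tac Lq_dominated[where c = "cmod c" and f = f]) (auto simp: norm_mult)

lemma Lq_indicator: "f \<in> Lq \<mu> q \<Longrightarrow> q \<ge> 0 \<Longrightarrow> A \<in> sets \<mu> \<Longrightarrow> (\<lambda>x. f x * indicator A x) \<in> Lq \<mu> q"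
  using Lq_measurable[of f \<mu> q]
  by (rule_tac Lq_dominated[where c = 1 and f = f]) (auto simp: indicator_def)

lemma Lq_add:
  assumes "f \<in> Lq \<mu> q" "g \<in> Lq \<mu> q" "q \<ge> 0"
  shows "(\<lambda>x. f x + g x) \<in> Lq \<mu> q"
proof -
  have [measurable]: "f \<in> borel_measurable \<mu>" "g \<in> borel_measurable \<mu>" using assms by (auto dest: Lq_measurable)
  have "integrable \<mu> (\<lambda>x. cmod (f x + g x) powr q)"
  proof (rule Bochner_Integration.integrable_bound)
    show "integrable \<mu> (\<lambda>x. 2 powr q * (cmod (f x) powr q + cmod (g x) powr q))" using assms by (simp add: Lq_def)
    show "AE x in \<mu>. norm (cmod (f x + g x) powr q) \<le> norm (2 powr q * (cmod (f x) powr q + cmod (g x) powr q))"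
    proof (intro AE_I2)
      fix x
      have "cmod (f x + g x) \<le> 2 * max (cmod (f x)) (cmod (g x))" using norm_triangle_ineq[of "f x" "g x"] by linarith
      then have "cmod (f x + g x) powr q \<le> (2 * max (cmod (f x)) (cmod (g x))) powr q"
        using assms by (intro powr_mono2) auto
      also have "\<dots> = 2 powr q * max (cmod (f x)) (cmod (g x)) powr q" by (simp add: powr_mult)
      also have "\<dots> \<le> 2 powr q * (cmod (f x) powr q + cmod (g x) powr q)"
        by (intro mult_left_mono) (auto simp: max_def)
      finally show "norm (cmod (f x + g x) powr q) \<le> norm (2 powr q * (cmod (f x) powr q + cmod (g x) powr q))" by simp
    qed
  qed measurable
  then show ?thesis by (simp add: Lq_def)
qed

lemma Lq_diff: "f \<in> Lq \<mu> q \<Longrightarrow> g \<in> Lq \<mu> q \<Longrightarrow> q \<ge> 0 \<Longrightarrow> (\<lambda>x. f x - g x) \<in> Lq \<mu> q"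
  using Lq_add[of f \<mu> q "\<lambda>x. -1 * g x"] Lq_cmult[of g \<mu> q "-1"] by simp

lemma Lq_zero: "(\<lambda>x. 0) \<in> Lq \<mu> q"
  by (simp add: Lq_def)

lemma Lq_sum: "finite I \<Longrightarrow> (\<And>i. i \<in> I \<Longrightarrow> f i \<in> Lq \<mu> q) \<Longrightarrow> q \<ge> 0 \<Longrightarrow> (\<lambda>x. \<Sum>i\<in>I. f i x) \<in> Lq \<mu> q"
  by (induction I rule: finite_induct) (auto simp: Lq_zero intro!: Lq_add)

lemma L2_iff: "f \<in> Lq \<mu> 2 \<longleftrightarrow> f \<in> borel_measurable \<mu> \<and> integrable \<mu> (\<lambda>x. (cmod (f x))\<^sup>2)"
  by (simp add: Lq_def powr_numeral)

lemma linear_on_Lq_add: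
  "linear_on_Lq \<mu> q T \<Longrightarrow> f \<in> Lq \<mu> q \<Longrightarrow> g \<in> Lq \<mu> q \<Longrightarrow> AE x in \<mu>. T (\<lambda>y. f y + g y) x = T f x + T g x"
  by (simp add: linear_on_Lq_def)

lemma linear_on_Lq_cmult:
  "linear_on_Lq \<mu> q T \<Longrightarrow> f \<in> Lq \<mu> q \<Longrightarrow> AE x in \<mu>. T (\<lambda>y. c * f y) x = c * T f x"
  by (simp add: linear_on_Lq_def)

lemma linear_on_Lq_diff:
  assumes "linear_on_Lq \<mu> q T" "f \<in> Lq \<mu> q" "g \<in> Lq \<mu> q" "q \<ge> 0"
  shows "AE x in \<mu>. T (\<lambda>y. f y - g y) x = T f x - T g x"
  using linear_on_Lq_add[OF assms(1,2) Lq_cmult[OF assms(3,4), of "-1"]]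
    linear_on_Lq_cmult[OF assms(1,3), of "-1"]
  by eventually_elim simp

lemma linear_on_Lq_sum:
  assumes "linear_on_Lq \<mu> q T" "finite I" "\<And>i. i \<in> I \<Longrightarrow> f i \<in> Lq \<mu> q" "q \<ge> 0"
  shows "AE x in \<mu>. T (\<lambda>y. \<Sum>i\<in>I. f i y) x = (\<Sum>i\<in>I. T (f i) x)"
  using assms(2,3)
proof (induction I rule: finite_induct)
  case empty
  show ?case using linear_on_Lq_cmult[OF assms(1) Lq_zero, of 0] by simp
next
  case (insert i I)
  have "AE x in \<mu>. T (\<lambda>y. f i y + (\<Sum>i\<in>I. f i y)) x = T (f i) x + T (\<lambda>y. \<Sum>i\<in>I. f i y) x"
    using insert.prems insert.hyps assms by (intro linear_on_Lq_add Lq_sum) auto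
  moreover have "AE x in \<mu>. T (\<lambda>y. \<Sum>i\<in>I. f i y) x = (\<Sum>i\<in>I. T (f i) x)"
    using insert by auto
  ultimately show ?case by eventually_elim (use insert.hyps in simp)
qed

lemma Lq_markov:
  assumes "f \<in> Lq \<mu> q" "t > 0" "q > 0"
  shows "emeasure \<mu> {x \<in> space \<mu>. cmod (f x) > t} \<le> ennreal ((LINT x|\<mu>. cmod (f x) powr q) / t powr q)"
proof -
  have [measurable]: "f \<in> borel_measurable \<mu>" using assms by (auto dest: Lq_measurable)
  have "emeasure \<mu> {x \<in> space \<mu>. cmod (f x) > t} \<le> emeasure \<mu> {x \<in> space \<mu>. cmod (f x) powr q \<ge> t powr q}"
    using assms by (intro emeasure_mono) (auto intro: powr_mono2)
  also have "\<dots> \<le> ennreal (1 / t powr q * (LINT x|\<mu>. cmod (f x) powr q))"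
    using assms by (intro integral_Markov_inequality) (auto simp: Lq_def)
  finally show ?thesis by simp
qed

section \<open>Square integrable functions of bounded support\<close>

context linear_growth_measure
begin

lemma nn_integral_power_tail_le:
  assumes "r > 0" "\<epsilon> > 0"
  shows "(\<integral>\<^sup>+y\<in>- ball x r. ennreal (1 / cmod (x - y) powr (1 + \<epsilon>)) \<partial>\<mu>)
    \<le> ennreal (tail_const \<epsilon> * r powr - \<epsilon>)"
  using nn_integral_tail_le[of r \<epsilon> 1 "\<lambda>_. 1" x] assms averages_le_one by simp

lemma norm_indicator_square: "(\<lambda>y. (cmod (indicator A y))\<^sup>2) = indicat_real A"
  by (auto simp: indicator_def)

lemma indicator_ball_L2: "(\<lambda>y. indicator (ball x r) y) \<in> Lq \<mu> 2"
  using emeasure_bounded_finite[of "ball x r"] unfolding L2_iff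
  by (simp add: norm_indicator_square borel_open)

text \<open>On A, a set of finite measure, |f| \<le> |f|^2 + 1.\<close>

lemma L2_integrable_if_bounded_support:
  assumes "f \<in> Lq \<mu> 2" "bounded A" "A \<in> sets borel" "\<And>y. y \<notin> A \<Longrightarrow> f y = 0"
  shows "integrable \<mu> f"
proof (rule Bochner_Integration.integrable_bound)
  show "integrable \<mu> (\<lambda>y. (cmod (f y))\<^sup>2 + indicator A y)"
    using assms fmeasurable_bounded[of A] unfolding L2_iff fmeasurable_def by simp
  show "AE y in \<mu>. norm (f y) \<le> norm ((cmod (f y))\<^sup>2 + indicator A y :: real)"
  proof (intro AE_I2)
    fix y
    have "cmod (f y) \<le> (cmod (f y))\<^sup>2 + 1"
      using sum_power2_ge_zero[of "cmod (f y) - 1" 0] by (simp add: power2_diff) (use norm_ge_zero[of "f y"] in linarith)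
    then show "norm (f y) \<le> norm ((cmod (f y))\<^sup>2 + indicator A y :: real)"
      using assms(4)[of y] by (cases "y \<in> A") auto
  qed
qed (use assms in \<open>auto dest: Lq_measurable\<close>)

lemma not_in_closed_support:
  assumes "closed A" "\<And>y. y \<notin> A \<Longrightarrow> f y = 0" "z \<notin> A"
  shows "z \<notin> closed_support \<mu> f"
proof -
  obtain r where "r > 0" "ball z r \<subseteq> - A"
    using assms by (meson ComplI open_Compl open_contains_ball)
  then have empty: "{y \<in> ball z r. f y \<noteq> 0} = {}" using assms(2) by auto
  show ?thesis
  proof
    assume "z \<in> closed_support \<mu> f"
    then have "emeasure \<mu> {y \<in> ball z r. f y \<noteq> 0} > 0"
      using \<open>r > 0\<close> unfolding closed_support_def by blast
    then show False unfolding empty by simp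
  qed
qed

end

section \<open>The operator on the space of square integrable functions\<close>

locale cz_setting = linear_growth_measure +
  fixes \<epsilon> N :: real and K :: "complex \<Rightarrow> complex \<Rightarrow> complex" and T :: operator
  assumes \<epsilon>_pos: "\<epsilon> > 0" and N_nonneg: "N \<ge> 0"
    and kernel: "cz_kernel \<epsilon> K" and operator: "cz_operator \<mu> K N T"
begin

lemma kernel_size: "x \<noteq> y \<Longrightarrow> cmod (K x y) \<le> 1 / cmod (x - y)"
  using kernel by (simp add: cz_kernel_def)

lemma kernel_smooth1:
  "x \<noteq> y \<Longrightarrow> cmod (x - x') \<le> cmod (x - y) / 2 \<Longrightarrow>
    cmod (K x y - K x' y) \<le> cmod (x - x') powr \<epsilon> / cmod (x - y) powr (1 + \<epsilon>)"
  using kernel by (simp add: cz_kernel_def)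

lemma kernel_smooth2:
  "x \<noteq> y \<Longrightarrow> cmod (x - x') \<le> cmod (x - y) / 2 \<Longrightarrow>
    cmod (K y x - K y x') \<le> cmod (x - x') powr \<epsilon> / cmod (x - y) powr (1 + \<epsilon>)"
  using kernel by (simp add: cz_kernel_def)

text \<open>Smoothness in the second variable makes \<open>K z\<close> continuous off the point z;
  the arbitrary value at z is a single exception.\<close>

lemma kernel_measurable [measurable]: "K z \<in> borel_measurable borel"
proof (rule borel_measurable_continuous_countable_exceptions[of "{z}"])
  have "isCont (K z) x" if "x \<noteq> z" for x
  proof -
    have "((\<lambda>y. K z y - K z x) \<longlongrightarrow> 0) (at x)"
    proof (rule Lim_null_comparison)
      have "\<forall>\<^sub>F y in at x. dist y x < cmod (x - z) / 2"
        using that by (intro eventually_at_ball'[of "cmod (x - z) / 2" x UNIV, THEN eventually_mono]) (auto simp: dist_commute)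
      then show "\<forall>\<^sub>F y in at x. cmod (K z y - K z x) \<le> cmod (x - y) powr \<epsilon> / cmod (x - z) powr (1 + \<epsilon>)"
        by eventually_elim (use kernel_smooth2[OF that] in \<open>auto simp: dist_norm norm_minus_commute\<close>)
      have "((\<lambda>y. cmod (x - y) powr \<epsilon> / cmod (x - z) powr (1 + \<epsilon>)) \<longlongrightarrow> cmod (x - x) powr \<epsilon> / cmod (x - z) powr (1 + \<epsilon>)) (at x)"
        using that \<epsilon>_pos by (intro tendsto_intros) auto
      then show "((\<lambda>y. cmod (x - y) powr \<epsilon> / cmod (x - z) powr (1 + \<epsilon>)) \<longlongrightarrow> 0) (at x)" by simp
    qed
    then show ?thesis by (simp add: isCont_def LIM_zero_iff)
  qed
  then show "continuous_on (- {z}) (K z)" by (intro continuous_at_imp_continuous_on) auto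
qed simp

lemma T_linear: "linear_on_Lq \<mu> 2 T"
  using operator by (simp add: cz_operator_def strong_type_def)

lemma T_L2: "f \<in> Lq \<mu> 2 \<Longrightarrow> T f \<in> Lq \<mu> 2"
  using operator by (simp add: cz_operator_def strong_type_def)

lemma T_L2_bound:
  assumes "f \<in> Lq \<mu> 2"
  shows "(LINT x|\<mu>. (cmod (T f x))\<^sup>2) \<le> N\<^sup>2 * (LINT x|\<mu>. (cmod (f x))\<^sup>2)"
proof -
  have "Lq_norm \<mu> 2 (T f) \<le> N * Lq_norm \<mu> 2 f"
    using operator assms by (simp add: cz_operator_def strong_type_def)
  then have "sqrt (LINT x|\<mu>. (cmod (T f x))\<^sup>2) \<le> N * sqrt (LINT x|\<mu>. (cmod (f x))\<^sup>2)"
    by (simp add: Lq_norm_def powr_half_sqrt powr_numeral)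
  then have "(sqrt (LINT x|\<mu>. (cmod (T f x))\<^sup>2))\<^sup>2 \<le> (N * sqrt (LINT x|\<mu>. (cmod (f x))\<^sup>2))\<^sup>2"
    by (rule power_mono) simp
  then show ?thesis by (simp add: power_mult_distrib)
qed

lemma T_weak_L2:
  assumes "f \<in> Lq \<mu> 2" "t > 0"
  shows "emeasure \<mu> {x. cmod (T f x) > t} \<le> ennreal (N\<^sup>2 * (LINT x|\<mu>. (cmod (f x))\<^sup>2) / t\<^sup>2)"
proof -
  have "emeasure \<mu> {x. cmod (T f x) > t} \<le> ennreal ((LINT x|\<mu>. (cmod (T f x))\<^sup>2) / t\<^sup>2)"
    using Lq_markov[OF T_L2[OF assms(1)] assms(2)] assms(2) by (simp add: powr_numeral)
  also have "\<dots> \<le> ennreal (N\<^sup>2 * (LINT x|\<mu>. (cmod (f x))\<^sup>2) / t\<^sup>2)"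
    using T_L2_bound[OF assms(1)] by (intro ennreal_leI divide_right_mono) auto
  finally show ?thesis .
qed

lemma T_off_support:
  assumes "f \<in> Lq \<mu> 2" "closed A" "\<And>y. y \<notin> A \<Longrightarrow> f y = 0"
  shows "AE z in \<mu>. z \<notin> A \<longrightarrow> integrable \<mu> (\<lambda>y. K z y * f y) \<and> T f z = (LINT y|\<mu>. K z y * f y)"
proof -
  have "AE z in \<mu>. z \<notin> closed_support \<mu> f \<longrightarrow>
      integrable \<mu> (\<lambda>y. K z y * f y) \<and> T f z = (LINT y|\<mu>. K z y * f y)"
    using operator assms by (simp add: cz_operator_def)
  then show ?thesis using not_in_closed_support[OF assms(2,3)] by (auto elim: eventually_mono)
qed

text \<open>Subtracting a multiple of the indicator of a doubling disc gives mean zero. Outside the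
  triple disc the mean zero is played against the smoothness of K. In the shell up to the triple
  disc, T f is bounded by the size of K alone, and the first doubling radius makes the shell
  integral bounded. The image of the indicator is controlled on the triple disc by its L2 norm and
  doubling.\<close>

lemma exists_cancelling_ball:
  assumes "emeasure \<mu> UNIV \<noteq> 0" "r > 0" and f: "f \<in> Lq \<mu> 2"
    and supp: "\<And>y. y \<notin> cball x (r / 2) \<Longrightarrow> f y = 0"
  obtains R where "R \<ge> r" "measure \<mu> (ball x R) > 0"
    "measure \<mu> (ball x (3 * R)) \<le> 9 * measure \<mu> (ball x R)"
    "(\<integral>\<^sup>+z\<in>- ball x r. ennreal (cmod (T (\<lambda>y. f y - (LINT y|\<mu>. f y) / measure \<mu> (ball x R) * indicator (ball x R) y) z)) \<partial>\<mu>)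
      \<le> ennreal (cancel_const \<epsilon> N * (LINT y|\<mu>. cmod (f y)))"
proof -
  obtain R where R: "R \<ge> r" "measure \<mu> (ball x R) > 0"
    "measure \<mu> (ball x (3 * R)) \<le> 9 * measure \<mu> (ball x R)"
    and shell: "\<forall>f\<in>borel_measurable \<mu>. \<forall>A\<ge>0. averages_le f x A \<longrightarrow>
      (\<integral>\<^sup>+y\<in>ball x (3 * R) - ball x r. f y * ennreal (1 / cmod (x - y)) \<partial>\<mu>) \<le> ennreal (8 * A)"
    by (rule exists_doubling_radius[OF assms(1,2)]) (rule that)
  have "R > 0" using R assms by simp
  define \<alpha> where "\<alpha> = (LINT y|\<mu>. cmod (f y))"
  define B where "B = measure \<mu> (ball x R)"
  define c where "c = (LINT y|\<mu>. f y) / B"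
  define ib :: "complex \<Rightarrow> complex" where "ib y = indicator (ball x R) y" for y
  define b where "b y = f y - c * ib y" for y
  have B: "B > 0" using R by (simp add: B_def)
  have [measurable]: "f \<in> borel_measurable \<mu>" using f by (rule Lq_measurable)
  have f_int: "integrable \<mu> f"
    by (rule L2_integrable_if_bounded_support[OF f, of "cball x (r / 2)"]) (auto simp: supp borel_closed)
  have ib: "ib \<in> Lq \<mu> 2" unfolding ib_def[abs_def] by (rule indicator_ball_L2)
  have [measurable]: "ib \<in> borel_measurable \<mu>" using ib by (rule Lq_measurable)
  have ib_int: "integrable \<mu> ib"
    by (rule L2_integrable_if_bounded_support[OF ib, of "ball x R"]) (auto simp: ib_def borel_open)
  have ib_val: "(LINT y|\<mu>. ib y) = B"
  proof -
    have "ib = (\<lambda>y. complex_of_real (indicator (ball x R) y))" by (auto simp: ib_def indicator_def)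
    then show ?thesis by (simp add: B_def integral_complex_of_real)
  qed
  have b: "b \<in> Lq \<mu> 2" unfolding b_def[abs_def] by (intro Lq_diff Lq_cmult f ib) auto
  have [measurable]: "b \<in> borel_measurable \<mu>" using b by (rule Lq_measurable)
  have b_supp: "b y = 0" if "y \<notin> cball x R" for y
    using that supp[of y] R assms(2) by (auto simp: b_def ib_def)
  have b_int: "integrable \<mu> b" unfolding b_def[abs_def] using f_int ib_int by simp
  have b_zero: "(LINT y|\<mu>. b y) = 0"
    unfolding b_def using f_int ib_int B by (simp add: ib_val c_def)
  have \<alpha>: "\<alpha> \<ge> 0" by (simp add: \<alpha>_def)
  have c_le: "cmod c * B \<le> \<alpha>"
    using integral_norm_bound[of \<mu> f] B by (simp add: c_def norm_divide \<alpha>_def)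
  \<comment> \<open>The subtracted multiple has norm at most that of f, because |c| B is at most
    \<alpha>.\<close>
  have b_norm: "(LINT y|\<mu>. cmod (b y)) \<le> 2 * \<alpha>"
  proof -
    have "(LINT y|\<mu>. cmod (b y)) \<le> (LINT y|\<mu>. cmod (f y) + cmod c * indicator (ball x R) y)"
    proof (rule Bochner_Integration.integral_mono)
      show "integrable \<mu> (\<lambda>y. cmod (b y))" using b_int by simp
      show "integrable \<mu> (\<lambda>y. cmod (f y) + cmod c * indicator (ball x R) y)"
        using f_int emeasure_bounded_finite[of "ball x R"] by (simp add: borel_open)
      show "cmod (b y) \<le> cmod (f y) + cmod c * indicator (ball x R) y" for y
        using norm_triangle_ineq4[of "f y" "c * ib y"]
        by (auto simp: b_def ib_def norm_mult indicator_def split: if_splits)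
    qed
    also have "\<dots> = \<alpha> + cmod c * B"
      using f_int emeasure_bounded_finite[of "ball x R"] by (simp add: \<alpha>_def B_def)
    finally show ?thesis using c_le by simp
  qed
  \<comment> \<open>K(z,y) may be replaced by K(z,y) - K(z,x), since b has integral zero.\<close>
  have far: "cmod (T b z) \<le> 2 * \<alpha> * (R powr \<epsilon> / cmod (x - z) powr (1 + \<epsilon>))"
    if z: "z \<notin> ball x (3 * R)" and z_int: "integrable \<mu> (\<lambda>y. K z y * b y)"
      and z_eq: "T b z = (LINT y|\<mu>. K z y * b y)" for z
  proof -
    have xz: "x \<noteq> z" "cmod (x - z) \<ge> 3 * R" using z \<open>R > 0\<close> by (auto simp: dist_norm)
    have "T b z = (LINT y|\<mu>. K z y * b y) - K z x * (LINT y|\<mu>. b y)" by (simp add: z_eq b_zero)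
    also have "\<dots> = (LINT y|\<mu>. (K z y - K z x) * b y)"
      using z_int b_int by (simp add: left_diff_distrib)
    also have "cmod \<dots> \<le> (LINT y|\<mu>. R powr \<epsilon> / cmod (x - z) powr (1 + \<epsilon>) * cmod (b y))"
    proof (rule Bochner_Integration.integral_norm_bound_integral)
      show "integrable \<mu> (\<lambda>y. (K z y - K z x) * b y)" using z_int b_int by (simp add: left_diff_distrib)
      show "integrable \<mu> (\<lambda>y. R powr \<epsilon> / cmod (x - z) powr (1 + \<epsilon>) * cmod (b y))" using b_int by simp
      fix y
      show "cmod ((K z y - K z x) * b y) \<le> R powr \<epsilon> / cmod (x - z) powr (1 + \<epsilon>) * cmod (b y)"
      proof (cases "y \<in> cball x R")
        case True
        then have y: "cmod (x - y) \<le> R" by (simp add: dist_norm)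
        have "cmod (K z x - K z y) \<le> cmod (x - y) powr \<epsilon> / cmod (x - z) powr (1 + \<epsilon>)"
          using xz y \<open>R > 0\<close> by (intro kernel_smooth2) auto
        also have "\<dots> \<le> R powr \<epsilon> / cmod (x - z) powr (1 + \<epsilon>)"
          using y \<epsilon>_pos by (intro divide_right_mono powr_mono2) auto
        finally show ?thesis
          unfolding norm_mult by (subst norm_minus_commute) (rule mult_right_mono, auto)
      qed (simp add: b_supp)
    qed
    also have "\<dots> = R powr \<epsilon> / cmod (x - z) powr (1 + \<epsilon>) * (LINT y|\<mu>. cmod (b y))" by simp
    also have "\<dots> \<le> R powr \<epsilon> / cmod (x - z) powr (1 + \<epsilon>) * (2 * \<alpha>)"
      using b_norm by (intro mult_left_mono) auto
    finally show ?thesis by (simp add: mult_ac)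
  qed
  \<comment> \<open>f lives in the disc of half the radius, so |z - y| is at least |x - z| / 2 for
    every relevant y.\<close>
  have near: "cmod (T f z) \<le> 2 * \<alpha> * (1 / cmod (x - z))"
    if z: "z \<notin> ball x r" and z_int: "integrable \<mu> (\<lambda>y. K z y * f y)"
      and z_eq: "T f z = (LINT y|\<mu>. K z y * f y)" for z
  proof -
    have xz: "cmod (x - z) \<ge> r" using z by (auto simp: dist_norm)
    have "cmod (T f z) \<le> (LINT y|\<mu>. 2 / cmod (x - z) * cmod (f y))"
      unfolding z_eq
    proof (rule Bochner_Integration.integral_norm_bound_integral[OF z_int])
      show "integrable \<mu> (\<lambda>y. 2 / cmod (x - z) * cmod (f y))" using f_int by simp
      fix y
      show "cmod (K z y * f y) \<le> 2 / cmod (x - z) * cmod (f y)"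
      proof (cases "y \<in> cball x (r / 2)")
        case True
        have zy: "cmod (z - y) \<ge> cmod (x - z) / 2"
          using norm_triangle_ineq[of "x - y" "y - z"] True xz by (simp add: dist_norm norm_minus_commute)
        have "cmod (K z y) \<le> 1 / cmod (z - y)"
          using zy xz assms(2) by (intro kernel_size) auto
        also have "\<dots> \<le> 1 / (cmod (x - z) / 2)"
          using zy xz assms(2) by (intro frac_le) auto
        also have "\<dots> = 2 / cmod (x - z)" by simp
        finally show ?thesis unfolding norm_mult by (rule mult_right_mono) simp
      qed (simp add: supp)
    qed
    also have "\<dots> = 2 / cmod (x - z) * \<alpha>" by (simp add: \<alpha>_def)
    finally show ?thesis by simp
  qed
  have b_off: "AE z in \<mu>. z \<notin> cball x R \<longrightarrow> integrable \<mu> (\<lambda>y. K z y * b y) \<and> T b z = (LINT y|\<mu>. K z y * b y)"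
    by (rule T_off_support[OF b closed_cball]) (rule b_supp)
  have f_off: "AE z in \<mu>. z \<notin> cball x (r / 2) \<longrightarrow> integrable \<mu> (\<lambda>y. K z y * f y) \<and> T f z = (LINT y|\<mu>. K z y * f y)"
    by (rule T_off_support[OF f closed_cball]) (rule supp)
  have b_lin: "AE z in \<mu>. T (\<lambda>y. f y - c * ib y) z = T f z - T (\<lambda>y. c * ib y) z"
    by (intro linear_on_Lq_diff[OF T_linear] Lq_cmult f ib) auto
  \<comment> \<open>One summand for the far region and two for the shell, where T f and the
    indicator term are estimated separately. The factor 1 matches the form of \<open>shell\<close>
    for the constant function 1.\<close>
  have "AE z in \<mu>. ennreal (cmod (T b z)) * indicator (- ball x r) z
    \<le> ennreal (2 * \<alpha> * R powr \<epsilon>) * (ennreal (1 / cmod (x - z) powr (1 + \<epsilon>)) * indicator (- ball x (3 * R)) z)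
    + ennreal (2 * \<alpha>) * (1 * ennreal (1 / cmod (x - z)) * indicator (ball x (3 * R) - ball x r) z)
    + ennreal (cmod c / 2) * (indicator (ball x (3 * R)) z + ennreal ((cmod (T ib z))\<^sup>2))"
    using b_lin linear_on_Lq_cmult[OF T_linear ib, of c]
      b_off f_off
  proof eventually_elim
    case (elim z)
    have sum: "T b z = T f z - c * T ib z" using elim by (simp add: b_def[abs_def])
    consider "z \<in> ball x r" | "z \<notin> ball x (3 * R)" "z \<notin> ball x r" | "z \<in> ball x (3 * R)" "z \<notin> ball x r" by blast
    then show ?case
    proof cases
      case 2
      have "z \<notin> cball x R" using 2 \<open>R > 0\<close> by auto
      then have "cmod (T b z) \<le> 2 * \<alpha> * R powr \<epsilon> * (1 / cmod (x - z) powr (1 + \<epsilon>))"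
        using far[of z] 2 elim by simp
      then have "ennreal (cmod (T b z)) \<le> ennreal (2 * \<alpha> * R powr \<epsilon>) * ennreal (1 / cmod (x - z) powr (1 + \<epsilon>))"
        using \<alpha> by (subst ennreal_mult[symmetric]) (auto intro: ennreal_leI)
      then show ?thesis using 2 by (auto intro: order_trans[OF _ le_iff_add[THEN iffD2]])
    next
      case 3
      have "z \<notin> cball x (r / 2)" using 3 assms(2) by auto
      then have "cmod (T f z) \<le> 2 * \<alpha> * (1 / cmod (x - z))" using near[of z] 3 elim by simp
      \<comment> \<open>The inequality u \<le> (1 + u^2) / 2 replaces Cauchy-Schwarz: integrated
        over the triple disc it needs only the measure of the triple and the L2 bound, both
        multiples of B.\<close>
      moreover have "cmod c * cmod (T ib z) \<le> cmod c * ((1 + (cmod (T ib z))\<^sup>2) / 2)"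
        using sum_squares_bound[of "cmod (T ib z)" 1] by (intro mult_left_mono) auto
      ultimately have "cmod (T b z) \<le> 2 * \<alpha> * (1 / cmod (x - z)) + cmod c / 2 * (1 + (cmod (T ib z))\<^sup>2)"
        unfolding sum using norm_triangle_ineq4[of "T f z" "c * T ib z"] by (simp add: norm_mult)
      then have "ennreal (cmod (T b z)) \<le> ennreal (2 * \<alpha>) * ennreal (1 / cmod (x - z)) + ennreal (cmod c / 2) * (1 + ennreal ((cmod (T ib z))\<^sup>2))"
        using \<alpha> by (simp flip: ennreal_mult ennreal_plus ennreal_1)
      then show ?thesis using 3 by simp
    qed simp
  qed
  then have "(\<integral>\<^sup>+z\<in>- ball x r. ennreal (cmod (T b z)) \<partial>\<mu>) \<le> (\<integral>\<^sup>+z.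
      ennreal (2 * \<alpha> * R powr \<epsilon>) * (ennreal (1 / cmod (x - z) powr (1 + \<epsilon>)) * indicator (- ball x (3 * R)) z)
    + ennreal (2 * \<alpha>) * (1 * ennreal (1 / cmod (x - z)) * indicator (ball x (3 * R) - ball x r) z)
    + ennreal (cmod c / 2) * (indicator (ball x (3 * R)) z + ennreal ((cmod (T ib z))\<^sup>2)) \<partial>\<mu>)"
    by (rule nn_integral_mono_AE)
  also have "\<dots> = ennreal (2 * \<alpha> * R powr \<epsilon>) * (\<integral>\<^sup>+z\<in>- ball x (3 * R). ennreal (1 / cmod (x - z) powr (1 + \<epsilon>)) \<partial>\<mu>)
    + ennreal (2 * \<alpha>) * (\<integral>\<^sup>+z\<in>ball x (3 * R) - ball x r. 1 * ennreal (1 / cmod (x - z)) \<partial>\<mu>)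
    + ennreal (cmod c / 2) * ((\<integral>\<^sup>+z. indicator (ball x (3 * R)) z \<partial>\<mu>) + (\<integral>\<^sup>+z. ennreal ((cmod (T ib z))\<^sup>2) \<partial>\<mu>))"
  proof -
    have [measurable]: "T ib \<in> borel_measurable \<mu>" using T_L2[OF ib] by (rule Lq_measurable)
    show ?thesis
      by (subst nn_integral_add, measurable, subst nn_integral_add, measurable)
        (subst nn_integral_cmult, measurable, subst nn_integral_cmult, measurable,
         subst nn_integral_cmult, measurable, subst nn_integral_add, measurable)
  qed
  also have "\<dots> \<le> ennreal (2 * \<alpha> * R powr \<epsilon>) * ennreal (tail_const \<epsilon> * (3 * R) powr - \<epsilon>)
    + ennreal (2 * \<alpha>) * ennreal (8 * 1)
    + ennreal (cmod c / 2) * (ennreal (9 * B) + ennreal (N\<^sup>2 * B))"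
  proof (intro add_mono mult_left_mono)
    show "(\<integral>\<^sup>+z\<in>- ball x (3 * R). ennreal (1 / cmod (x - z) powr (1 + \<epsilon>)) \<partial>\<mu>) \<le> ennreal (tail_const \<epsilon> * (3 * R) powr - \<epsilon>)"
      using \<open>R > 0\<close> \<epsilon>_pos by (intro nn_integral_power_tail_le) auto
    show "(\<integral>\<^sup>+z\<in>ball x (3 * R) - ball x r. 1 * ennreal (1 / cmod (x - z)) \<partial>\<mu>) \<le> ennreal (8 * 1)"
      using shell[rule_format, OF _ _ averages_le_one] by simp
    show "(\<integral>\<^sup>+z. indicator (ball x (3 * R)) z \<partial>\<mu>) \<le> ennreal (9 * B)"
      using R by (simp add: emeasure_ball_eq B_def ennreal_leI)
    have "(LINT z|\<mu>. (cmod (ib z))\<^sup>2) = B"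
      by (simp add: ib_def B_def norm_indicator_square)
    then have "(LINT z|\<mu>. (cmod (T ib z))\<^sup>2) \<le> N\<^sup>2 * B" using T_L2_bound[OF ib] by simp
    moreover have "integrable \<mu> (\<lambda>z. (cmod (T ib z))\<^sup>2)" using T_L2[OF ib] by (simp add: L2_iff)
    ultimately show "(\<integral>\<^sup>+z. ennreal ((cmod (T ib z))\<^sup>2) \<partial>\<mu>) \<le> ennreal (N\<^sup>2 * B)"
      by (subst nn_integral_eq_integral) (auto intro: ennreal_leI)
  qed auto
  also have "\<dots> = ennreal (2 * \<alpha> * R powr \<epsilon> * (tail_const \<epsilon> * (3 * R) powr - \<epsilon>) + 2 * \<alpha> * 8 + cmod c / 2 * (9 * B + N\<^sup>2 * B))"
    using \<alpha> B tail_const_nonneg[OF \<epsilon>_pos] by (simp flip: ennreal_mult ennreal_plus ennreal_numeral)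
  also have "\<dots> \<le> ennreal (cancel_const \<epsilon> N * \<alpha>)"
  proof (rule ennreal_leI)
    \<comment> \<open>The gain R^\<epsilon> from smoothness cancels the decay of the tail beyond 3R,
      so no radius survives in the bound.\<close>
    have "R powr \<epsilon> * (3 * R) powr - \<epsilon> = 3 powr - \<epsilon>"
      using \<open>R > 0\<close> by (simp add: powr_mult powr_minus field_simps)
    then have "R powr \<epsilon> * (3 * R) powr - \<epsilon> \<le> 1" using \<epsilon>_pos powr_less_one[of 3 "-\<epsilon>"] by simp
    then have "2 * \<alpha> * tail_const \<epsilon> * (R powr \<epsilon> * (3 * R) powr - \<epsilon>) \<le> 2 * \<alpha> * tail_const \<epsilon> * 1"
      using \<alpha> tail_const_nonneg[OF \<epsilon>_pos] by (intro mult_left_mono) auto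
    moreover have "(9 + N\<^sup>2) / 2 * (cmod c * B) \<le> (9 + N\<^sup>2) / 2 * \<alpha>"
      using c_le by (intro mult_left_mono) auto
    moreover have "2 * \<alpha> * R powr \<epsilon> * (tail_const \<epsilon> * (3 * R) powr - \<epsilon>) + 2 * \<alpha> * 8 + cmod c / 2 * (9 * B + N\<^sup>2 * B)
      = 2 * \<alpha> * tail_const \<epsilon> * (R powr \<epsilon> * (3 * R) powr - \<epsilon>) + 16 * \<alpha> + (9 + N\<^sup>2) / 2 * (cmod c * B)"
      by (simp add: field_simps)
    moreover have "cancel_const \<epsilon> N * \<alpha> = 2 * \<alpha> * tail_const \<epsilon> * 1 + 16 * \<alpha> + (9 + N\<^sup>2) / 2 * \<alpha>"
      by (simp add: cancel_const_def field_simps)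
    ultimately show "2 * \<alpha> * R powr \<epsilon> * (tail_const \<epsilon> * (3 * R) powr - \<epsilon>) + 2 * \<alpha> * 8 + cmod c / 2 * (9 * B + N\<^sup>2 * B) \<le> cancel_const \<epsilon> N * \<alpha>"
      by linarith
  qed
  finally show thesis
    using R by (intro that[of R]) (auto simp: b_def[abs_def] c_def B_def ib_def \<alpha>_def)
qed

end

subsection \<open>The weak type estimate on bounded pieces\<close>

text \<open>The balls of a finite net of F are made disjoint by removing the earlier ones. The
  indicators are complex valued because they multiply a complex function.\<close>

lemma compact_small_partition:
  fixes F :: "complex set"
  assumes "compact F" "s > 0"
  obtains n :: nat and x Q where "\<And>i. i < n \<Longrightarrow> x i \<in> F" "\<And>i. Q i \<in> sets borel"
    "\<And>i. Q i \<subseteq> ball (x i) s" "\<And>y. y \<in> F \<Longrightarrow> (\<Sum>i<n. indicator (Q i) y) = (1::complex)"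
proof -
  obtain k where k: "finite k" "k \<subseteq> F" "F \<subseteq> (\<Union>x\<in>k. ball x s)"
    using seq_compact_imp_totally_bounded[OF compact_imp_seq_compact[OF assms(1)]] assms(2) by meson
  obtain n :: nat and x where x: "k = x ` {i. i < n}"
    using finite_imp_nat_seg_image_inj_on[OF k(1)] by blast
  define Q where "Q = disjointed (\<lambda>i. ball (x i) s)"
  show ?thesis
  proof (rule that[of n x Q])
    show "x i \<in> F" if "i < n" for i using k(2) x that by blast
    show "Q i \<in> sets borel" for i
      unfolding Q_def disjointed_def by (intro sets.Diff sets.finite_UN) (auto simp: borel_open)
    show "Q i \<subseteq> ball (x i) s" for i unfolding Q_def by (rule disjointed_subset)
    fix y assume "y \<in> F"
    then have "\<exists>i. i < n \<and> y \<in> ball (x i) s" using k(3) x by blast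
    then obtain j where j: "j < n" "y \<in> ball (x j) s" by blast
    define i where "i = (LEAST i. y \<in> ball (x i) s)"
    have i: "y \<in> ball (x i) s" unfolding i_def using j(2) by (rule LeastI)
    have i_least: "i \<le> l" if "y \<in> ball (x l) s" for l
      unfolding i_def using that by (rule Least_le)
    have "y \<in> Q l \<longleftrightarrow> l = i" for l
    proof
      assume "y \<in> Q l"
      then have a: "y \<in> ball (x l) s" "\<forall>j<l. y \<notin> ball (x j) s" by (auto simp: Q_def disjointed_def)
      show "l = i" using i_least[OF a(1)] a(2) i by (metis le_neq_implies_less)
    next
      assume "l = i"
      moreover have "y \<notin> ball (x j) s" if "j < i" for j using i_least[of j] that by auto
      ultimately show "y \<in> Q l" using i by (auto simp: Q_def disjointed_def)
    qed
    then have "indicator (Q l) y = (if l = i then 1 else 0 :: complex)" for l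
      by (simp add: indicator_def)
    then show "(\<Sum>l<n. indicator (Q l) y) = (1::complex)"
      using i_least[OF j(2)] j(1) by simp
  qed
qed

context linear_growth_measure
begin

text \<open>A compact set is the decreasing intersection of its neighbourhoods, which are bounded
  and therefore of finite measure.\<close>

lemma compact_neighbourhood_measure_le:
  assumes "compact F" "\<delta> > 0"
  obtains s where "s > 0" "emeasure \<mu> (\<Union>y\<in>F. ball y s) \<le> emeasure \<mu> F + ennreal \<delta>"
proof -
  define U where "U k = (\<Union>y\<in>F. ball y (1 / Suc k))" for k :: nat
  have U_meas: "U k \<in> sets borel" for k unfolding U_def by (intro borel_open open_UN) auto
  obtain b where b: "F \<subseteq> ball 0 b" using assms compact_imp_bounded bounded_subset_ballD by blast
  have "U k \<subseteq> ball 0 (b + 1)" for k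
  proof
    fix z assume "z \<in> U k"
    then obtain y where y: "y \<in> F" "dist y z < 1 / Suc k" by (auto simp: U_def)
    have "1 / Suc k \<le> (1::real)" by simp
    then have "dist y z < 1" using y by linarith
    then show "z \<in> ball 0 (b + 1)" using y b dist_triangle[of 0 z y] by fastforce
  qed
  then have fin: "emeasure \<mu> (U k) < \<infinity>" for k
    by (intro emeasure_bounded_finite) (meson bounded_ball bounded_subset)
  have dec: "decseq U"
    unfolding decseq_def U_def
    by (intro allI impI UN_mono order_refl subset_ball) (simp add: frac_le)
  have "(\<Inter>k. U k) = F"
  proof (intro equalityI subsetI)
    fix z assume z: "z \<in> (\<Inter>k. U k)"
    show "z \<in> F"
    proof (rule ccontr)
      assume "z \<notin> F"
      then obtain e where e: "e > 0" "ball z e \<subseteq> - F"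
        using compact_imp_closed[OF assms(1)] by (meson ComplI open_Compl open_contains_ball)
      obtain k :: nat where k: "1 / Suc k < e" using nat_approx_posE[OF e(1)] by auto
      have "z \<in> U k" using z by blast
      then obtain y where "y \<in> F" "dist y z < 1 / Suc k" by (auto simp: U_def)
      then have "y \<in> ball z e" using k by (simp add: dist_commute)
      then show False using e \<open>y \<in> F\<close> by blast
    qed
  next
    fix z assume "z \<in> F" then show "z \<in> (\<Inter>k. U k)" by (auto simp: U_def intro!: bexI[of _ z])
  qed
  then have F: "emeasure \<mu> F = (INF k. emeasure \<mu> (U k))"
    using dec fin U_meas by (subst INF_emeasure_decseq) (auto simp: less_top)
  have "emeasure \<mu> F < emeasure \<mu> F + ennreal \<delta>"
    using assms emeasure_bounded_finite[OF compact_imp_bounded[OF assms(1)]]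
    by (simp add: ennreal_add_left_cancel_less less_top)
  then obtain k where "emeasure \<mu> (U k) < emeasure \<mu> F + ennreal \<delta>"
    by (subst (asm) F) (auto simp: INF_less_iff)
  then show ?thesis by (intro that[of "1 / Suc k"]) (auto simp: U_def)
qed

text \<open>Inner regularity of the finite measure with density |f|^2 with respect to \<mu>.\<close>

lemma inner_approximation:
  assumes "f \<in> Lq \<mu> 2" "E \<in> sets borel" "\<delta> > 0"
  obtains F where "compact F" "F \<subseteq> E" "(LINT y|\<mu>. (cmod (f y * indicator (E - F) y))\<^sup>2) \<le> \<delta>"
proof -
  have [measurable]: "f \<in> borel_measurable \<mu>" using assms by (auto dest: Lq_measurable)
  define \<nu> where "\<nu> = density \<mu> (\<lambda>y. ennreal ((cmod (f y))\<^sup>2))"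
  have \<nu>_sets [simp]: "sets \<nu> = sets borel" by (simp add: \<nu>_def)
  have \<nu>: "emeasure \<nu> A = (\<integral>\<^sup>+y. ennreal ((cmod (f y))\<^sup>2) * indicator A y \<partial>\<mu>)" if "A \<in> sets borel" for A
    unfolding \<nu>_def using that by (subst emeasure_density) auto
  have int: "integrable \<mu> (\<lambda>y. (cmod (f y))\<^sup>2)" using assms by (simp add: L2_iff)
  have space: "space \<nu> = UNIV" by (simp add: \<nu>_def)
  have fin: "emeasure \<nu> UNIV < \<infinity>"
    using int by (subst \<nu>) (auto simp: nn_integral_eq_integral)
  have fin': "emeasure \<nu> A < \<infinity>" for A
    using emeasure_space[of \<nu> A] fin space by (auto intro: le_less_trans)
  have "emeasure \<nu> E = (SUP K \<in> {K. K \<subseteq> E \<and> compact K}. emeasure \<nu> K)"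
    using assms fin by (intro inner_regular) (auto simp: space)
  moreover have "emeasure \<nu> E < emeasure \<nu> E + ennreal \<delta>"
    using fin'[of E] assms by (simp add: ennreal_add_left_cancel_less less_top)
  ultimately obtain F where F: "compact F" "F \<subseteq> E" "emeasure \<nu> E \<le> emeasure \<nu> F + ennreal \<delta>"
  \<comment> \<open>For a null E, subtracting \<delta> in \<open>ennreal\<close> stays at 0, so
    nothing lies strictly below the supremum; the empty set serves instead.\<close>
  proof (cases "emeasure \<nu> E = 0")
    case True
    then show ?thesis by (intro that[of "{}"]) auto
  next
    case False
    have "emeasure \<nu> E - ennreal \<delta> < emeasure \<nu> E"
      using False fin'[of E] assms by (intro ennreal_between) (auto simp: less_top zero_less_iff_neq_zero)
    then obtain F where "F \<subseteq> E" "compact F" "emeasure \<nu> E - ennreal \<delta> < emeasure \<nu> F"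
      using \<open>emeasure \<nu> E = _\<close> by (metis (no_types, lifting) less_SUP_iff mem_Collect_eq)
    moreover from this have "emeasure \<nu> E - ennreal \<delta> \<le> emeasure \<nu> F" by simp
    then have "emeasure \<nu> E \<le> emeasure \<nu> F + ennreal \<delta>"
      by (simp add: ennreal_minus_le_iff add.commute)
    ultimately show ?thesis using that[of F] by simp
  qed
  have F_meas: "F \<in> sets borel" using F by (simp add: borel_compact)
  have "(\<integral>\<^sup>+y. ennreal ((cmod (f y * indicator (E - F) y))\<^sup>2) \<partial>\<mu>) = emeasure \<nu> (E - F)"
    using assms F_meas by (subst \<nu>) (auto intro!: nn_integral_cong simp: indicator_def)
  also have "\<dots> \<le> ennreal \<delta>"
    using F assms F_meas fin'[of F]
    by (subst emeasure_Diff) (auto simp: ennreal_minus_le_iff add.commute less_top)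
  finally have "enn2real (\<integral>\<^sup>+y. ennreal ((cmod (f y * indicator (E - F) y))\<^sup>2) \<partial>\<mu>) \<le> \<delta>"
    using assms enn2real_mono[of _ "ennreal \<delta>"] by fastforce
  moreover have "(LINT y|\<mu>. (cmod (f y * indicator (E - F) y))\<^sup>2) = enn2real (\<integral>\<^sup>+y. ennreal ((cmod (f y * indicator (E - F) y))\<^sup>2) \<partial>\<mu>)"
    using assms F_meas by (intro integral_eq_nn_integral) auto
  ultimately show ?thesis using F that by simp
qed

end

section \<open>Decomposition at a given level\<close>

context cz_setting
begin

lemma T_zero_if_integral_zero:
  assumes f: "f \<in> Lq \<mu> 2" "integrable \<mu> f" "(LINT y|\<mu>. cmod (f y)) = 0" and "t > 0"
  shows "emeasure \<mu> {z. cmod (T f z) > t} = 0"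
proof -
  have "AE y in \<mu>. cmod (f y) = 0"
    using f by (subst integral_nonneg_eq_0_iff_AE[symmetric]) auto
  then have "AE y in \<mu>. (cmod (f y))\<^sup>2 = 0" by eventually_elim simp
  then have "(LINT y|\<mu>. (cmod (f y))\<^sup>2) = 0" by (rule integral_eq_zero_AE)
  then show ?thesis using T_weak_L2[OF f(1) \<open>t > 0\<close>] by simp
qed

text \<open>Compactness allows pieces so small that they fit in a neighbourhood of F hardly larger
  than F, and |\<phi>| > t on F bounds the measure of F; that neighbourhood can therefore be
  discarded together with the set where the weights add up to 1.\<close>

lemma T_weak_1_1_compact_support:
  assumes \<phi>: "\<phi> \<in> Lq \<mu> 2" and F: "compact F" and supp: "\<And>y. y \<notin> F \<Longrightarrow> \<phi> y = 0"
    and large: "\<And>y. y \<in> F \<Longrightarrow> cmod (\<phi> y) > t" and t: "t > 0"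
  shows "emeasure \<mu> {z. cmod (T \<phi> z) > 2 * t} \<le> ennreal ((3 + 18 * N\<^sup>2 + cancel_const \<epsilon> N) * ((LINT y|\<mu>. cmod (\<phi> y)) / t))"
proof -
  define M where "M = (LINT y|\<mu>. cmod (\<phi> y))"
  have M_nonneg: "M \<ge> 0" by (simp add: M_def)
  have [measurable]: "\<phi> \<in> borel_measurable \<mu>" using \<phi> by (rule Lq_measurable)
  have F_meas [measurable]: "F \<in> sets borel" using F by (rule borel_compact)
  have \<phi>_int: "integrable \<mu> \<phi>"
    using \<phi> compact_imp_bounded[OF F] F_meas supp by (rule L2_integrable_if_bounded_support)
  \<comment> \<open>The greedy weights require more total mass than M / t; if there is less, the
    whole space satisfies the bound.\<close>
  consider (zero) "M = 0" | (small) "emeasure \<mu> UNIV \<le> ennreal (M / t)"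
    | (main) "M > 0" "ennreal (M / t) < emeasure \<mu> UNIV" using M_nonneg by force
  then show ?thesis
  proof cases
    case zero
    then show ?thesis using T_zero_if_integral_zero[OF \<phi> \<phi>_int _ , of "2 * t"] t by (simp add: M_def)
  next
    case small
    have "emeasure \<mu> {z. cmod (T \<phi> z) > 2 * t} \<le> emeasure \<mu> UNIV"
      by (rule emeasure_mono) auto
    also have "\<dots> \<le> ennreal (1 * (M / t))" using small by simp
    also have "\<dots> \<le> ennreal ((3 + 18 * N\<^sup>2 + cancel_const \<epsilon> N) * (M / t))"
      using cancel_const_nonneg[OF \<epsilon>_pos] M_nonneg t by (intro ennreal_leI mult_right_mono) auto
    finally show ?thesis by (simp add: M_def)
  next
    case main
    have "M / t > 0" using main t by simp
    obtain s where s: "s > 0" "emeasure \<mu> (\<Union>y\<in>F. ball y s) \<le> emeasure \<mu> F + ennreal (M / t)"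
      using compact_neighbourhood_measure_le[OF F \<open>M / t > 0\<close>] by blast
    obtain n :: nat and x Q where part: "\<And>i. i < n \<Longrightarrow> x i \<in> F" "\<And>i. Q i \<in> sets borel"
      "\<And>i. Q i \<subseteq> ball (x i) (s / 2)" "\<And>y. y \<in> F \<Longrightarrow> (\<Sum>i<n. indicator (Q i) y) = (1::complex)"
      using compact_small_partition[OF F, of "s / 2"] s by (metis half_gt_zero)
    note [measurable] = part(2)
    define \<phi>' where "\<phi>' i y = \<phi> y * indicator (Q i) y" for i y
    have \<phi>'_L2: "\<phi>' i \<in> Lq \<mu> 2" for i
      unfolding \<phi>'_def[abs_def] using part(2) by (intro Lq_indicator \<phi>) auto
    have \<phi>'_sum: "(\<Sum>i<n. \<phi>' i y) = \<phi> y" for y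
      using part(4)[of y] supp[of y] by (cases "y \<in> F") (auto simp: \<phi>'_def simp flip: sum_distrib_left)
    define \<alpha> where "\<alpha> i = (LINT y|\<mu>. cmod (\<phi>' i y))" for i
    have \<alpha>_nonneg: "\<alpha> i \<ge> 0" for i by (simp add: \<alpha>_def)
    have \<phi>'_int: "integrable \<mu> (\<phi>' i)" for i
      using \<phi>_int by (rule Bochner_Integration.integrable_bound) (auto simp: \<phi>'_def[abs_def] indicator_def)
    have \<alpha>_sum: "(\<Sum>i<n. \<alpha> i) = M"
    proof -
      have "(\<Sum>i<n. \<alpha> i) = (LINT y|\<mu>. (\<Sum>i<n. cmod (\<phi>' i y)))"
        unfolding \<alpha>_def using \<phi>'_int by (subst Bochner_Integration.integral_sum) auto
      also have "\<dots> = M"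
        unfolding M_def
      proof (rule Bochner_Integration.integral_cong)
        fix y
        \<comment> \<open>The partition identity is stated over the complex numbers, hence the
          embedding.\<close>
        have "complex_of_real (\<Sum>i<n. cmod (\<phi>' i y)) = cmod (\<phi> y) * (\<Sum>i<n. indicator (Q i) y)"
          unfolding sum_distrib_left of_real_sum by (intro sum.cong) (auto simp: \<phi>'_def indicator_def)
        also have "\<dots> = cmod (\<phi> y)"
          using part(4)[of y] supp[of y] by (cases "y \<in> F") (auto simp: of_real_indicator)
        finally show "(\<Sum>i<n. cmod (\<phi>' i y)) = cmod (\<phi> y)" using of_real_eq_iff by blast
      qed simp
      finally show ?thesis .
    qed
    \<comment> \<open>With these masses the weight of piece i, multiplied by t, has the same
      integral as |\<phi>| on that piece.\<close>
    define m where "m i = \<alpha> i / t" for i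
    have m_sum: "(\<Sum>i<n. m i) = M / t" by (simp add: m_def \<alpha>_sum flip: sum_divide_distrib)
    have m_nonneg: "m i \<ge> 0" for i using \<alpha>_nonneg t by (simp add: m_def)
    have "ennreal (\<Sum>i<n. m i) < emeasure \<mu> UNIV" using main m_sum by simp
    from exists_greedy_weights[of m n x, OF m_nonneg this] obtain w \<rho> where w: "\<forall>i. w i \<in> borel_measurable borel" "\<forall>i y. w i y \<ge> (0::real)"
      "\<forall>y. (\<Sum>i<n. w i y) \<le> 1"
      "\<forall>i<n. (\<integral>\<^sup>+y. ennreal (w i y) \<partial>\<mu>) = ennreal (m i) \<and>
         (\<forall>y. y \<notin> cball (x i) (\<rho> i) \<longrightarrow> w i y = 0) \<and>
         (\<forall>y\<in>ball (x i) (\<rho> i). (\<Sum>j<n. w j y) = 1)"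
      by (elim exE conjE)
    have [measurable]: "w i \<in> borel_measurable borel" for i using w(1) by blast
    \<comment> \<open>The bound s from below keeps the piece, cut at scale s/2, inside the disc of
      radius \<open>r i\<close> / 2. In either case the disc of radius \<open>r i\<close> lies in
      one of the exceptional sets \<open>H1\<close>, \<open>H2\<close>.\<close>
    define r where "r i = max (\<rho> i) s" for i
    define B where "B i R = measure \<mu> (ball (x i) R)" for i R
    define c where "c i R = (LINT y|\<mu>. \<phi>' i y) / B i R" for i R
    \<comment> \<open>All demands on the radius in one predicate, so that one radius for each piece
      can be chosen simultaneously.\<close>
    define P where "P i R \<longleftrightarrow> R \<ge> r i \<and> B i R > 0 \<and> B i (3 * R) \<le> 9 * B i R \<and>
      (\<integral>\<^sup>+z\<in>- ball (x i) (r i). ennreal (cmod (T (\<lambda>y. \<phi>' i y - c i R * indicator (ball (x i) R) y) z)) \<partial>\<mu>)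
        \<le> ennreal (cancel_const \<epsilon> N * \<alpha> i)" for i R
    have "\<exists>R. P i R" for i
    proof -
      have ne: "emeasure \<mu> UNIV \<noteq> 0" using main by auto
      have r: "r i > 0" using s by (simp add: r_def)
      have supp': "\<phi>' i y = 0" if "y \<notin> cball (x i) (r i / 2)" for y
      proof -
        have "ball (x i) (s / 2) \<subseteq> cball (x i) (r i / 2)"
          by (rule order_trans[OF ball_subset_cball]) (auto simp: r_def)
        then show ?thesis using that part(3)[of i] by (auto simp: \<phi>'_def indicator_def)
      qed
      show ?thesis
        unfolding P_def B_def c_def \<alpha>_def
        by (rule exists_cancelling_ball[OF ne r \<phi>'_L2[of i], of "x i"], rule supp', assumption)
          (intro exI conjI; assumption)
    qed
    then obtain R where "\<And>i. P i (R i)" by metis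
    then have R: "R i \<ge> r i" "B i (R i) > 0" "B i (3 * R i) \<le> 9 * B i (R i)"
      and R_int: "(\<integral>\<^sup>+z\<in>- ball (x i) (r i). ennreal (cmod (T (\<lambda>y. \<phi>' i y - c i (R i) * indicator (ball (x i) (R i)) y) z)) \<partial>\<mu>)
        \<le> ennreal (cancel_const \<epsilon> N * \<alpha> i)" for i
      unfolding P_def by blast+
    define b where "b i y = \<phi>' i y - c i (R i) * indicator (ball (x i) (R i)) y" for i y
    have b_L2: "b i \<in> Lq \<mu> 2" for i
      unfolding b_def[abs_def] by (intro Lq_diff Lq_cmult \<phi>'_L2 indicator_ball_L2) auto
    have [measurable]: "T (b i) \<in> borel_measurable \<mu>" for i using T_L2[OF b_L2] by (rule Lq_measurable)
    define g where "g y = (\<Sum>i<n. c i (R i) * indicator (ball (x i) (R i)) y)" for y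
    have g_L2: "g \<in> Lq \<mu> 2"
      unfolding g_def[abs_def] by (intro Lq_sum Lq_cmult indicator_ball_L2) auto
    \<comment> \<open>The height at which mass \<open>m i\<close> is spread evenly over the doubling
      disc; t times it dominates the coefficient of the i-th indicator in g.\<close>
    define a where "a i = m i / B i (R i)" for i
    have g_square: "(LINT y|\<mu>. (cmod (g y))\<^sup>2) \<le> 18 * t * M"
    proof -
      define h where "h y = (\<Sum>i<n. a i * indicator (ball (x i) (R i)) y)" for y
      have gh: "cmod (g y) \<le> t * h y" for y
      proof -
        have "cmod (g y) \<le> (\<Sum>i<n. cmod (c i (R i) * indicator (ball (x i) (R i)) y))"
          unfolding g_def by (rule norm_sum)
        also have "\<dots> \<le> (\<Sum>i<n. t * (a i * indicator (ball (x i) (R i)) y))"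
        proof (intro sum_mono)
          fix i
          have "cmod (c i (R i)) \<le> \<alpha> i / B i (R i)"
            using R(2)[of i] integral_norm_bound[of \<mu> "\<phi>' i"]
            by (simp add: c_def norm_divide \<alpha>_def divide_right_mono)
          also have "\<dots> = t * a i" using t by (simp add: a_def m_def)
          finally show "cmod (c i (R i) * indicator (ball (x i) (R i)) y) \<le> t * (a i * indicator (ball (x i) (R i)) y)"
            by (simp add: norm_mult indicator_def)
        qed
        also have "\<dots> = t * h y" unfolding h_def by (rule sum_distrib_left[symmetric])
        finally show ?thesis .
      qed
      have h_sq: "(LINT y|\<mu>. (h y)\<^sup>2) \<le> 18 * (\<Sum>i<n. m i)"
        unfolding h_def
      proof (rule integral_ball_sum_square_le[where w = w])
        fix i assume i: "i \<in> {..<n}"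
        have "\<rho> i \<le> R i" using R(1)[of i] by (simp add: r_def)
        then show "w i y = 0" if "y \<notin> cball (x i) (R i)" for y
          using w(4) i that by (auto simp: not_le intro: less_le_trans)
        show "(\<integral>\<^sup>+y. ennreal (w i y) \<partial>\<mu>) = ennreal (m i)" using w(4) i by auto
        show "a i \<ge> 0" using m_nonneg R(2)[of i] by (simp add: a_def)
        show "a i * measure \<mu> (ball (x i) (R i)) = m i" using R(2)[of i] by (simp add: a_def B_def)
        show "measure \<mu> (ball (x i) (3 * R i)) \<le> 9 * measure \<mu> (ball (x i) (R i))"
          using R(3)[of i] by (simp add: B_def)
      qed (use w in auto)
      have "(LINT y|\<mu>. (cmod (g y))\<^sup>2) \<le> (LINT y|\<mu>. t\<^sup>2 * (h y)\<^sup>2)"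
      proof (rule Bochner_Integration.integral_mono')
        have "(\<lambda>y. complex_of_real (h y)) \<in> Lq \<mu> 2"
        proof -
          have "(\<lambda>y. complex_of_real (h y)) = (\<lambda>y. \<Sum>i<n. complex_of_real (a i) * indicator (ball (x i) (R i)) y)"
            unfolding h_def of_real_sum of_real_mult of_real_indicator ..
          moreover have "\<dots> \<in> Lq \<mu> 2" by (intro Lq_sum Lq_cmult indicator_ball_L2) auto
          ultimately show ?thesis by simp
        qed
        then show "integrable \<mu> (\<lambda>y. t\<^sup>2 * (h y)\<^sup>2)" by (simp add: L2_iff)
        show "(cmod (g y))\<^sup>2 \<le> t\<^sup>2 * (h y)\<^sup>2" for y
          using power_mono[OF gh[of y], of 2] by (simp add: power_mult_distrib)
      qed simp
      also have "\<dots> = t\<^sup>2 * (LINT y|\<mu>. (h y)\<^sup>2)" by simp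
      also have "\<dots> \<le> t\<^sup>2 * (18 * (M / t))" using h_sq unfolding m_sum by (intro mult_left_mono) auto
      also have "\<dots> = 18 * t * M" using t by (simp add: power2_eq_square)
      finally show ?thesis .
    qed
    have decomp: "AE z in \<mu>. T \<phi> z = (\<Sum>i<n. T (b i) z) + T g z"
    proof -
      have eq: "\<phi> = (\<lambda>y. (\<Sum>i<n. b i y) + g y)"
        by (simp add: b_def g_def sum_subtractf \<phi>'_sum)
      have "AE z in \<mu>. T (\<lambda>y. (\<Sum>i<n. b i y) + g y) z = T (\<lambda>y. \<Sum>i<n. b i y) z + T g z"
        using b_L2 g_L2 by (intro linear_on_Lq_add[OF T_linear] Lq_sum) auto
      moreover have "AE z in \<mu>. T (\<lambda>y. \<Sum>i<n. b i y) z = (\<Sum>i<n. T (b i) z)"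
        using b_L2 by (intro linear_on_Lq_sum[OF T_linear]) auto
      ultimately show ?thesis unfolding eq[symmetric] by eventually_elim simp
    qed
    \<comment> \<open>On \<open>H1\<close> the weights add up to at least 1, so its measure is at
      most their total mass M / t.\<close>
    define H1 where "H1 = {z. 1 \<le> (\<Sum>i<n. w i z)}"
    define H2 where "H2 = (\<Union>y\<in>F. ball y s)"
    have H_meas [measurable]: "H1 \<in> sets borel" "H2 \<in> sets borel"
      unfolding H1_def H2_def by (measurable, intro borel_open open_UN, auto)
    have H1: "emeasure \<mu> H1 \<le> ennreal (M / t)"
    proof -
      have "emeasure \<mu> H1 = (\<integral>\<^sup>+y. indicator H1 y \<partial>\<mu>)" by simp
      also have "\<dots> \<le> (\<integral>\<^sup>+y. (\<Sum>i<n. ennreal (w i y)) \<partial>\<mu>)"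
        using w(2) by (intro nn_integral_mono) (auto simp: H1_def indicator_def)
      also have "\<dots> = (\<Sum>i<n. \<integral>\<^sup>+y. ennreal (w i y) \<partial>\<mu>)" by (rule nn_integral_sum) measurable
      also have "\<dots> = (\<Sum>i<n. ennreal (m i))" using w(4) by (intro sum.cong) auto
      also have "\<dots> = ennreal (M / t)" using m_nonneg by (simp add: m_sum)
      finally show ?thesis .
    qed
    \<comment> \<open>One M / t bounds the measure of F by Markov's inequality, the other is the
      slack allowed in the choice of s.\<close>
    have H2: "emeasure \<mu> H2 \<le> ennreal (M / t) + ennreal (M / t)"
    proof -
      have "emeasure \<mu> F \<le> emeasure \<mu> {y \<in> space \<mu>. t \<le> cmod (\<phi> y)}"
        using large by (intro emeasure_mono) (auto intro: less_imp_le)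
      also have "\<dots> \<le> ennreal (1 / t * M)"
        unfolding M_def using \<phi>_int t by (intro integral_Markov_inequality) auto
      finally have "emeasure \<mu> F \<le> ennreal (M / t)" by simp
      then show ?thesis using s(2) unfolding H2_def by (meson add_right_mono order_trans)
    qed
    have Tg: "emeasure \<mu> {z. cmod (T g z) > t} \<le> ennreal (18 * N\<^sup>2 * (M / t))"
    proof -
      have "N\<^sup>2 * (LINT y|\<mu>. (cmod (g y))\<^sup>2) / t\<^sup>2 \<le> N\<^sup>2 * (18 * t * M) / t\<^sup>2"
        using g_square by (intro divide_right_mono mult_left_mono) auto
      also have "\<dots> = 18 * N\<^sup>2 * (M / t)" using t by (simp add: power2_eq_square)
      finally show ?thesis using T_weak_L2[OF g_L2 t] by (meson ennreal_leI order_trans)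
    qed
    define A where "A = - (H1 \<union> H2)"
    have [measurable]: "A \<in> sets \<mu>" unfolding A_def by measurable
    define u where "u z = (\<Sum>i<n. ennreal (cmod (T (b i) z)))" for z
    have [measurable]: "u \<in> borel_measurable \<mu>" unfolding u_def by measurable
    \<comment> \<open>A avoids all discs of radius \<open>r i\<close>, so the cancellation estimates
      add up to a bound for the integral of u over A, and Markov's inequality applies.\<close>
    have Tb: "emeasure \<mu> {z \<in> A. 1 \<le> ennreal (1 / t) * u z} \<le> ennreal (cancel_const \<epsilon> N * (M / t))"
    proof -
      have "emeasure \<mu> {z \<in> A. 1 \<le> ennreal (1 / t) * u z} \<le> ennreal (1 / t) * (\<integral>\<^sup>+z. u z * indicator A z \<partial>\<mu>)"
        by (rule nn_integral_Markov_inequality) measurable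
      also have "(\<integral>\<^sup>+z. u z * indicator A z \<partial>\<mu>)
          = (\<Sum>i<n. \<integral>\<^sup>+z. ennreal (cmod (T (b i) z)) * indicator A z \<partial>\<mu>)"
        unfolding u_def sum_distrib_right by (rule nn_integral_sum) measurable
      also have "\<dots> \<le> (\<Sum>i<n. ennreal (cancel_const \<epsilon> N * \<alpha> i))"
      proof (intro sum_mono)
        fix i assume i: "i \<in> {..<n}"
        have "z \<notin> ball (x i) (r i)" if "z \<in> A" for z
        proof
          assume "z \<in> ball (x i) (r i)"
          then have "z \<in> ball (x i) (\<rho> i) \<or> z \<in> ball (x i) s" by (auto simp: r_def max_def split: if_splits)
          then show False
            using w(4) i part(1)[of i] that unfolding A_def H1_def H2_def by fastforce
        qed
        then have "(\<integral>\<^sup>+z. ennreal (cmod (T (b i) z)) * indicator A z \<partial>\<mu>)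
          \<le> (\<integral>\<^sup>+z. ennreal (cmod (T (b i) z)) * indicator (- ball (x i) (r i)) z \<partial>\<mu>)"
          by (intro nn_integral_mono) (auto simp: indicator_def)
        also have "\<dots> \<le> ennreal (cancel_const \<epsilon> N * \<alpha> i)" using R_int[of i] unfolding b_def[abs_def] .
        finally show "(\<integral>\<^sup>+z. ennreal (cmod (T (b i) z)) * indicator A z \<partial>\<mu>) \<le> ennreal (cancel_const \<epsilon> N * \<alpha> i)" .
      qed
      also have "(\<Sum>i<n. ennreal (cancel_const \<epsilon> N * \<alpha> i)) = ennreal (cancel_const \<epsilon> N * M)"
        using \<alpha>_nonneg cancel_const_nonneg[OF \<epsilon>_pos] by (simp add: \<alpha>_sum flip: sum_distrib_left)
      finally show ?thesis
        using t cancel_const_nonneg[OF \<epsilon>_pos] M_nonneg by (simp add: mult_left_mono flip: ennreal_mult)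
    qed
    have "emeasure \<mu> {z. cmod (T \<phi> z) > 2 * t}
      \<le> emeasure \<mu> (H1 \<union> H2 \<union> {z. cmod (T g z) > t} \<union> {z \<in> A. 1 \<le> ennreal (1 / t) * u z})"
    proof (rule emeasure_mono_AE)
      show "AE z in \<mu>. z \<in> {z. cmod (T \<phi> z) > 2 * t} \<longrightarrow>
        z \<in> H1 \<union> H2 \<union> {z. cmod (T g z) > t} \<union> {z \<in> A. 1 \<le> ennreal (1 / t) * u z}"
        using decomp
      proof eventually_elim
        case (elim z)
        \<comment> \<open>If |T \<phi>| > 2t and |T g| \<le> t, the differences between the pieces
          and their averages must contribute at least t.\<close>
        have "1 \<le> ennreal (1 / t) * u z" if "2 * t < cmod (T \<phi> z)" "\<not> t < cmod (T g z)"
        proof -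
          have "cmod (\<Sum>i<n. T (b i) z) \<ge> t"
            using that elim norm_triangle_ineq[of "\<Sum>i<n. T (b i) z" "T g z"] by simp
          then have "(\<Sum>i<n. cmod (T (b i) z)) \<ge> t" using norm_sum[of "\<lambda>i. T (b i) z" "{..<n}"] by linarith
          then have "ennreal 1 \<le> ennreal (1 / t * (\<Sum>i<n. cmod (T (b i) z)))"
            using t by (intro ennreal_leI) simp
          also have "\<dots> = ennreal (1 / t) * u z"
            unfolding u_def using t by (subst ennreal_mult) (auto intro: sum_nonneg)
          finally show ?thesis by simp
        qed
        then show ?case by (auto simp: A_def)
      qed
      have [measurable]: "T g \<in> borel_measurable \<mu>" using T_L2[OF g_L2] by (rule Lq_measurable)
      show "H1 \<union> H2 \<union> {z. cmod (T g z) > t} \<union> {z \<in> A. 1 \<le> ennreal (1 / t) * u z} \<in> sets \<mu>" by measurable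
    qed
    also have "\<dots> \<le> emeasure \<mu> H1 + emeasure \<mu> H2 + emeasure \<mu> {z. cmod (T g z) > t} + emeasure \<mu> {z \<in> A. 1 \<le> ennreal (1 / t) * u z}"
    proof -
      have [measurable]: "T g \<in> borel_measurable \<mu>" using T_L2[OF g_L2] by (rule Lq_measurable)
      have "{z. cmod (T g z) > t} \<in> sets \<mu>" "{z \<in> A. 1 \<le> ennreal (1 / t) * u z} \<in> sets \<mu>" by measurable
      then show ?thesis using H_meas
        by (intro order_trans[OF emeasure_subadditive] add_mono order_refl) auto
    qed
    also have "\<dots> \<le> ennreal (M / t) + (ennreal (M / t) + ennreal (M / t)) + ennreal (18 * N\<^sup>2 * (M / t)) + ennreal (cancel_const \<epsilon> N * (M / t))"
      by (intro add_mono H1 H2 Tg Tb)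
    also have "\<dots> = ennreal ((3 + 18 * N\<^sup>2 + cancel_const \<epsilon> N) * (M / t))"
      using M_nonneg t cancel_const_nonneg[OF \<epsilon>_pos] by (simp flip: ennreal_plus) (simp add: algebra_simps add_divide_distrib)
    finally show ?thesis by (simp add: M_def)
  qed
qed

end

lemma le_mult_if_divide_le:
  fixes a b c :: ennreal
  assumes "a / b \<le> c" "b \<noteq> 0" "b \<noteq> \<infinity>"
  shows "a \<le> c * b"
  using mult_right_mono[OF assms(1), of b] assms(2,3)
  by (simp add: ennreal_divide_times less_top)

subsection \<open>The extension to the other Lebesgue spaces\<close>

lemma emeasure_Collect_add_le:
  assumes "f \<in> borel_measurable M" "g \<in> borel_measurable M" "h \<in> borel_measurable M" "space M = UNIV"
    and "AE z in M. h z = f z + (g z :: complex)"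
  shows "emeasure M {z. cmod (h z) > s + t} \<le> emeasure M {z. cmod (f z) > s} + emeasure M {z. cmod (g z) > t}"
proof -
  note [measurable] = assms(1-3)
  have sets: "{z. cmod (f z) > s} \<in> sets M" "{z. cmod (g z) > t} \<in> sets M"
    using assms(4) measurable_sets[of "\<lambda>z. cmod (f z)" M borel "{s<..}"]
      measurable_sets[of "\<lambda>z. cmod (g z)" M borel "{t<..}"] by (auto simp: vimage_def)
  have "emeasure M {z. cmod (h z) > s + t} \<le> emeasure M ({z. cmod (f z) > s} \<union> {z. cmod (g z) > t})"
  proof (rule emeasure_mono_AE)
    show "AE z in M. z \<in> {z. cmod (h z) > s + t} \<longrightarrow> z \<in> {z. cmod (f z) > s} \<union> {z. cmod (g z) > t}"
      using assms(5)
    proof eventually_elim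
      case (elim z)
      then show ?case using norm_triangle_ineq[of "f z" "g z"] by auto
    qed
  qed (use sets in auto)
  also have "\<dots> \<le> emeasure M {z. cmod (f z) > s} + emeasure M {z. cmod (g z) > t}"
    using sets by (rule emeasure_subadditive)
  finally show ?thesis .
qed

section \<open>Approximation by bounded functions and integrability against the kernel\<close>

context linear_growth_measure
begin

text \<open>Cutting both the values and the domain makes any measurable f bounded with bounded
  support, hence square integrable; at each point the truncation is eventually exact.\<close>

definition truncate :: "(complex \<Rightarrow> complex) \<Rightarrow> nat \<Rightarrow> complex \<Rightarrow> complex" where
  "truncate f k y = f y * indicator {y. cmod (f y) \<le> real k \<and> cmod y \<le> real k} y"

lemma truncate_sets [measurable]:
  assumes [measurable]: "f \<in> borel_measurable \<mu>"
  shows "{y. cmod (f y) \<le> real k \<and> cmod y \<le> real k} \<in> sets \<mu>"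
proof -
  have "{y \<in> space \<mu>. cmod (f y) \<le> real k \<and> cmod y \<le> real k} \<in> sets \<mu>" by measurable
  then show ?thesis by simp
qed

lemma truncate_Lq: "f \<in> Lq \<mu> q \<Longrightarrow> q \<ge> 0 \<Longrightarrow> truncate f k \<in> Lq \<mu> q"
  unfolding truncate_def[abs_def] by (intro Lq_indicator truncate_sets Lq_measurable)

lemma truncate_L2:
  assumes "f \<in> borel_measurable \<mu>"
  shows "truncate f k \<in> Lq \<mu> 2"
proof (rule Lq_dominated[OF indicator_ball_L2[of 0 "real k + 1"], where c = "real k"])
  show "truncate f k \<in> borel_measurable \<mu>"
    using assms truncate_sets[OF assms, of k] unfolding truncate_def[abs_def] by measurable
  show "cmod (truncate f k y) \<le> real k * cmod (indicator (ball 0 (real k + 1)) y)" for y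
    by (auto simp: truncate_def indicator_def)
qed auto

lemma truncate_eventually: "\<forall>\<^sub>F k in sequentially. f y - truncate f k y = 0"
proof -
  obtain n :: nat where "max (cmod (f y)) (cmod y) \<le> real n" using real_arch_simple by blast
  then show ?thesis
    by (intro eventually_sequentiallyI[of n]) (auto simp: truncate_def)
qed

lemma cmod_diff_truncate: "cmod (f y - truncate f k y) \<le> cmod (f y)"
  by (auto simp: truncate_def indicator_def)

lemma truncate_tendsto:
  assumes "f \<in> Lq \<mu> q" "q > 0"
  shows "(\<lambda>k. LINT y|\<mu>. cmod (f y - truncate f k y) powr q) \<longlonglongrightarrow> 0"
proof -
  have [measurable]: "f \<in> borel_measurable \<mu>" using assms by (auto dest: Lq_measurable)
  have [measurable]: "truncate f k \<in> borel_measurable \<mu>" for k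
    using truncate_L2[of f k] by (auto dest: Lq_measurable)
  have "(\<lambda>k. LINT y|\<mu>. cmod (f y - truncate f k y) powr q) \<longlonglongrightarrow> (LINT y|\<mu>. 0 powr q)"
  proof (rule integral_dominated_convergence[where w = "\<lambda>y. cmod (f y) powr q"])
    show "AE y in \<mu>. (\<lambda>k. cmod (f y - truncate f k y) powr q) \<longlonglongrightarrow> 0 powr q"
    proof (intro AE_I2 tendsto_eventually)
      fix y show "\<forall>\<^sub>F k in sequentially. cmod (f y - truncate f k y) powr q = 0 powr q"
        using truncate_eventually[of f y] by eventually_elim simp
    qed
    show "AE y in \<mu>. norm (cmod (f y - truncate f k y) powr q) \<le> cmod (f y) powr q" for k
      using assms by (intro AE_I2) (simp add: powr_mono2 cmod_diff_truncate)
  qed (use assms in \<open>auto simp: Lq_def\<close>)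
  then show ?thesis by simp
qed

text \<open>A form of Young's inequality: the conjugate power of \<open>1 / cmod (x - y)\<close> has exponent
  \<open>1 + 1 / (q - 1)\<close>, so that it is integrable off a ball.\<close>

lemma Lq_integrable_over_distance:
  assumes f: "f \<in> Lq \<mu> q" and "q \<ge> 1" "r > 0"
  shows "integrable \<mu> (\<lambda>y. cmod (f y) / cmod (x - y) * indicator (- ball x r) y)"
proof -
  have [measurable]: "f \<in> borel_measurable \<mu>" using f by (rule Lq_measurable)
  have f_int: "(\<integral>\<^sup>+y. ennreal (cmod (f y) powr q) \<partial>\<mu>) < \<infinity>"
    using f by (simp add: Lq_def nn_integral_eq_integral)
  have "(\<integral>\<^sup>+y. ennreal (cmod (f y) / cmod (x - y) * indicator (- ball x r) y) \<partial>\<mu>) < \<infinity>"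
  proof (cases "q = 1")
    case True
    have "(\<integral>\<^sup>+y. ennreal (cmod (f y) / cmod (x - y) * indicator (- ball x r) y) \<partial>\<mu>)
      \<le> (\<integral>\<^sup>+y. ennreal (1 / r) * ennreal (cmod (f y) powr q) \<partial>\<mu>)"
    proof (intro nn_integral_mono)
      fix y
      have "cmod (f y) / cmod (x - y) * indicator (- ball x r) y \<le> 1 / r * cmod (f y) powr q"
      proof (cases "y \<in> ball x r")
        case False
        then have "cmod (f y) / cmod (x - y) \<le> cmod (f y) / r"
          using assms by (intro frac_le) (auto simp: dist_norm)
        then show ?thesis using False True by simp
      qed (use assms in simp)
      then show "ennreal (cmod (f y) / cmod (x - y) * indicator (- ball x r) y) \<le> ennreal (1 / r) * ennreal (cmod (f y) powr q)"
        using assms by (subst ennreal_mult[symmetric]) (auto intro: ennreal_leI)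
    qed
    also have "\<dots> = ennreal (1 / r) * (\<integral>\<^sup>+y. ennreal (cmod (f y) powr q) \<partial>\<mu>)"
      by (rule nn_integral_cmult) measurable
    also have "\<dots> < \<infinity>" using f_int by (simp add: ennreal_mult_less_top)
    finally show ?thesis .
  next
    case False
    \<comment> \<open>Chosen so that 1 + p is the exponent conjugate to q.\<close>
    define p where "p = 1 / (q - 1)"
    have p: "p > 0" "p * (q - 1) = 1" using False assms by (auto simp: p_def)
    have "(\<integral>\<^sup>+y. ennreal (cmod (f y) / cmod (x - y) * indicator (- ball x r) y) \<partial>\<mu>)
      \<le> (\<integral>\<^sup>+y. ennreal (cmod (f y) powr q) + ennreal (1 / cmod (x - y) powr (1 + p)) * indicator (- ball x r) y \<partial>\<mu>)"
    proof (intro nn_integral_mono)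
      fix y
      show "ennreal (cmod (f y) / cmod (x - y) * indicator (- ball x r) y)
        \<le> ennreal (cmod (f y) powr q) + ennreal (1 / cmod (x - y) powr (1 + p)) * indicator (- ball x r) y"
      proof (cases "y \<in> ball x r")
        case False
        define d where "d = cmod (x - y)"
        have "d \<ge> r" using False by (simp add: d_def dist_norm)
        then have d: "d > 0" using assms by linarith
        \<comment> \<open>The two terms of Young's inequality balance at |f| = d^(-p). Above this
          value 1/d \<le> |f|^(q-1), below it |f|/d \<le> d^(-1-p).\<close>
        have "cmod (f y) / d \<le> cmod (f y) powr q + 1 / d powr (1 + p)"
        proof (cases "cmod (f y) \<ge> d powr - p")
          case True
          have "d powr - p > 0" using d by simp
          then have f_pos: "cmod (f y) > 0" using True by linarith
          have "- p * (q - 1) = - 1" using p by simp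
          then have "1 / d = (d powr - p) powr (q - 1)"
            unfolding powr_powr using d by (simp add: powr_minus_divide)
          also have "\<dots> \<le> cmod (f y) powr (q - 1)" using True assms by (intro powr_mono2) auto
          finally have "cmod (f y) * (1 / d) \<le> cmod (f y) * cmod (f y) powr (q - 1)"
            by (intro mult_left_mono) auto
          also have "\<dots> = cmod (f y) powr q" using f_pos by (simp add: powr_mult_base)
          finally have "cmod (f y) / d \<le> cmod (f y) powr q" by simp
          then show ?thesis by (rule add_increasing2[rotated]) simp
        next
          case False
          then have "cmod (f y) / d \<le> d powr - p / d" using d by (intro divide_right_mono) auto
          also have "\<dots> = 1 / d powr (1 + p)" using d by (simp add: powr_minus_divide powr_add)
          finally show ?thesis by (rule add_increasing[rotated]) simp
        qed
        then show ?thesis using False by (simp add: d_def flip: ennreal_plus)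
      qed simp
    qed
    also have "\<dots> = (\<integral>\<^sup>+y. ennreal (cmod (f y) powr q) \<partial>\<mu>)
      + (\<integral>\<^sup>+y\<in>- ball x r. ennreal (1 / cmod (x - y) powr (1 + p)) \<partial>\<mu>)"
      by (rule nn_integral_add) measurable
    also have "\<dots> < \<infinity>"
      using f_int nn_integral_power_tail_le[OF \<open>r > 0\<close> p(1), of x] by (auto simp: le_less_trans)
    finally show ?thesis .
  qed
  then show ?thesis by (intro integrableI_bounded) auto
qed

text \<open>|f| \<le> |f|^q + 1, and the ball has finite measure.\<close>

lemma Lq_integrable_on_ball:
  assumes f: "f \<in> Lq \<mu> q" and "q \<ge> 1"
  shows "integrable \<mu> (\<lambda>y. f y * indicator (ball x r) y)"
proof (rule Bochner_Integration.integrable_bound)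
  have [measurable]: "f \<in> borel_measurable \<mu>" using f by (rule Lq_measurable)
  show "(\<lambda>y. f y * indicator (ball x r) y) \<in> borel_measurable \<mu>" by measurable
  show "integrable \<mu> (\<lambda>y. cmod (f y) powr q + indicator (ball x r) y)"
    using f emeasure_bounded_finite[of "ball x r"] by (simp add: Lq_def borel_open)
  show "AE y in \<mu>. norm (f y * indicator (ball x r) y) \<le> norm (cmod (f y) powr q + indicator (ball x r) y :: real)"
  proof (intro AE_I2)
    fix y
    have "cmod (f y) \<le> cmod (f y) powr q + 1"
    proof (cases "cmod (f y) \<ge> 1")
      case True
      then have "cmod (f y) powr 1 \<le> cmod (f y) powr q" using assms by (intro powr_mono) auto
      then show ?thesis using True by simp
    qed (simp add: add_increasing)
    then show "norm (f y * indicator (ball x r) y) \<le> norm (cmod (f y) powr q + indicator (ball x r) y :: real)"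
      by (auto simp: indicator_def)
  qed
qed

end

section \<open>The weak type estimate for integrable functions in L2\<close>

context cz_setting
begin

text \<open>\<phi> is split into its part where |\<phi>| \<le> t, its restriction to a compact
  subset of the set where |\<phi>| > t, and a remainder. The first and the last have squared L2 norm
  at most t M, so the L2 bound suffices for them. The levels t, 2t and t add up to 4t.\<close>

lemma T_weak_1_1:
  assumes \<phi>: "\<phi> \<in> Lq \<mu> 2" "integrable \<mu> \<phi>" and t: "t > 0"
  shows "emeasure \<mu> {z. cmod (T \<phi> z) > 4 * t} \<le> ennreal (weak_const \<epsilon> N * ((LINT y|\<mu>. cmod (\<phi> y)) / t))"
proof (cases "(LINT y|\<mu>. cmod (\<phi> y)) = 0")
  case True
  then show ?thesis using T_zero_if_integral_zero[OF \<phi> True, of "4 * t"] t by simp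
next
  case False
  define M where "M = (LINT y|\<mu>. cmod (\<phi> y))"
  have M: "M > 0" using False by (simp add: M_def less_le)
  have [measurable]: "\<phi> \<in> borel_measurable \<mu>" using \<phi>(1) by (rule Lq_measurable)
  define E where "E = {y. t < cmod (\<phi> y)}"
  have E_meas [measurable]: "E \<in> sets borel"
  proof -
    have "{y \<in> space \<mu>. t < cmod (\<phi> y)} \<in> sets \<mu>" by measurable
    then show ?thesis by (simp add: E_def)
  qed
  \<comment> \<open>The tolerance t M is exactly the bound that the part with |\<phi>| \<le> t
    satisfies, so one estimate, \<open>small\<close>, handles both.\<close>
  obtain F where F: "compact F" "F \<subseteq> E" "(LINT y|\<mu>. (cmod (\<phi> y * indicator (E - F) y))\<^sup>2) \<le> t * M"
    using inner_approximation[OF \<phi>(1) E_meas, of "t * M"] t M by auto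
  have F_meas [measurable]: "F \<in> sets borel" using F(1) by (rule borel_compact)
  define \<phi>1 where "\<phi>1 y = \<phi> y * indicator (- E) y" for y
  define \<phi>2 where "\<phi>2 y = \<phi> y * indicator F y" for y
  define \<phi>3 where "\<phi>3 y = \<phi> y * indicator (E - F) y" for y
  have L2: "\<phi>1 \<in> Lq \<mu> 2" "\<phi>2 \<in> Lq \<mu> 2" "\<phi>3 \<in> Lq \<mu> 2"
    unfolding \<phi>1_def[abs_def] \<phi>2_def[abs_def] \<phi>3_def[abs_def] by (intro Lq_indicator \<phi>; simp)+
  have L23: "(\<lambda>y. \<phi>2 y + \<phi>3 y) \<in> Lq \<mu> 2" using L2 by (intro Lq_add) auto
  note meas = Lq_measurable[OF T_L2[OF L2(1)]] Lq_measurable[OF T_L2[OF L2(2)]]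
    Lq_measurable[OF T_L2[OF L2(3)]] Lq_measurable[OF T_L2[OF L23]] Lq_measurable[OF T_L2[OF \<phi>(1)]]
  have eq: "\<phi> = (\<lambda>y. \<phi>1 y + (\<phi>2 y + \<phi>3 y))"
    using F(2) by (auto simp: fun_eq_iff \<phi>1_def \<phi>2_def \<phi>3_def indicator_def)
  have "emeasure \<mu> {z. cmod (T \<phi> z) > 4 * t}
    \<le> emeasure \<mu> {z. cmod (T \<phi>1 z) > t} + emeasure \<mu> {z. cmod (T (\<lambda>y. \<phi>2 y + \<phi>3 y) z) > 2 * t + t}"
    using emeasure_Collect_add_le[OF meas(1,4,5) space_eq, of t "2 * t + t"]
      linear_on_Lq_add[OF T_linear L2(1) L23] by (simp flip: eq)
  also have "\<dots> \<le> emeasure \<mu> {z. cmod (T \<phi>1 z) > t} + (emeasure \<mu> {z. cmod (T \<phi>2 z) > 2 * t} + emeasure \<mu> {z. cmod (T \<phi>3 z) > t})"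
    by (intro add_left_mono emeasure_Collect_add_le meas space_eq linear_on_Lq_add[OF T_linear] L2)
  also have "\<dots> \<le> ennreal (N\<^sup>2 * (M / t)) + (ennreal ((3 + 18 * N\<^sup>2 + cancel_const \<epsilon> N) * (M / t)) + ennreal (N\<^sup>2 * (M / t)))"
  proof (intro add_mono)
    have small: "ennreal (N\<^sup>2 * X / t\<^sup>2) \<le> ennreal (N\<^sup>2 * (M / t))" if "X \<le> t * M" for X
    proof (rule ennreal_leI)
      have "N\<^sup>2 * X / t\<^sup>2 \<le> N\<^sup>2 * (t * M) / t\<^sup>2" using that by (intro divide_right_mono mult_left_mono) auto
      then show "N\<^sup>2 * X / t\<^sup>2 \<le> N\<^sup>2 * (M / t)" using t by (simp add: power2_eq_square)
    qed
    have "(LINT y|\<mu>. (cmod (\<phi>1 y))\<^sup>2) \<le> (LINT y|\<mu>. t * cmod (\<phi> y))"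
    proof (rule Bochner_Integration.integral_mono)
      show "integrable \<mu> (\<lambda>y. (cmod (\<phi>1 y))\<^sup>2)" using L2 by (simp add: L2_iff)
      show "integrable \<mu> (\<lambda>y. t * cmod (\<phi> y))" using \<phi> by simp
      show "(cmod (\<phi>1 y))\<^sup>2 \<le> t * cmod (\<phi> y)" for y
        using t by (auto simp: \<phi>1_def E_def indicator_def power2_eq_square intro!: mult_right_mono)
    qed
    also have "\<dots> = t * M" by (simp add: M_def)
    finally have "(LINT y|\<mu>. (cmod (\<phi>1 y))\<^sup>2) \<le> t * M" .
    from order_trans[OF T_weak_L2[OF L2(1) t] small[OF this]]
    show "emeasure \<mu> {z. cmod (T \<phi>1 z) > t} \<le> ennreal (N\<^sup>2 * (M / t))" .
    show "emeasure \<mu> {z. cmod (T \<phi>3 z) > t} \<le> ennreal (N\<^sup>2 * (M / t))"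
      using T_weak_L2[OF L2(3) t] small[OF F(3)] unfolding \<phi>3_def by (rule order_trans)
    have "emeasure \<mu> {z. cmod (T \<phi>2 z) > 2 * t}
      \<le> ennreal ((3 + 18 * N\<^sup>2 + cancel_const \<epsilon> N) * ((LINT y|\<mu>. cmod (\<phi>2 y)) / t))"
      using L2(2) F(1)
    proof (rule T_weak_1_1_compact_support)
      show "cmod (\<phi>2 y) > t" if "y \<in> F" for y using that F(2) by (auto simp: \<phi>2_def E_def)
    qed (auto simp: \<phi>2_def t)
    also have "\<dots> \<le> ennreal ((3 + 18 * N\<^sup>2 + cancel_const \<epsilon> N) * (M / t))"
    proof (intro ennreal_leI mult_left_mono divide_right_mono)
      show "(LINT y|\<mu>. cmod (\<phi>2 y)) \<le> M"
        unfolding M_def using \<phi> by (intro Bochner_Integration.integral_mono') (auto simp: \<phi>2_def indicator_def)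
    qed (use t cancel_const_nonneg[OF \<epsilon>_pos] in auto)
    finally show "emeasure \<mu> {z. cmod (T \<phi>2 z) > 2 * t} \<le> ennreal ((3 + 18 * N\<^sup>2 + cancel_const \<epsilon> N) * (M / t))" .
  qed
  also have "\<dots> = ennreal (weak_const \<epsilon> N * (M / t))"
    using M t cancel_const_nonneg[OF \<epsilon>_pos, of N]
    by (simp flip: ennreal_plus) (simp add: weak_const_def algebra_simps add_divide_distrib)
  finally show ?thesis by (simp add: M_def)
qed

end

section \<open>Weak type and integral representation for the extension\<close>

locale cz_extension = cz_setting +
  fixes q :: real and S :: operator
  assumes q: "q \<ge> 1" and extension: "is_extension \<mu> T q S"
begin

lemma S_linear: "linear_on_Lq \<mu> q S"
  using extension by (auto simp: is_extension_def weak_type_1_1_def strong_type_def split: if_splits)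

lemma S_measurable: "f \<in> Lq \<mu> q \<Longrightarrow> S f \<in> borel_measurable \<mu>"
  using extension
  by (auto simp: is_extension_def weak_type_1_1_def strong_type_def split: if_splits dest: Lq_measurable)

lemma S_eq_T: "f \<in> Lq \<mu> 2 \<Longrightarrow> f \<in> Lq \<mu> q \<Longrightarrow> AE x in \<mu>. S f x = T f x"
  using extension by (simp add: is_extension_def)

text \<open>A common form of the two kinds of boundedness in \<open>is_extension\<close>. The
  constant C is only qualitative: it serves to show that the images of truncation tails tend to zero
  in measure. The absolute value of the given constant is taken because its sign is not
  prescribed.\<close>

lemma S_weak_q:
  obtains C where "C \<ge> 0"
    "\<And>f t. f \<in> Lq \<mu> q \<Longrightarrow> t > 0 \<Longrightarrow>
      emeasure \<mu> {z. cmod (S f z) > t} \<le> ennreal (C * (LINT y|\<mu>. cmod (f y) powr q) / t powr q)"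
proof (cases "q = 1")
  case True
  then obtain C where C: "weak_type_1_1 \<mu> C S" using extension by (auto simp: is_extension_def)
  show ?thesis
  proof (rule that[of "\<bar>C\<bar>"])
    fix f and t :: real assume f: "f \<in> Lq \<mu> q" and t: "t > 0"
    have "emeasure \<mu> {z. cmod (S f z) > t} \<le> ennreal (C * (LINT y|\<mu>. cmod (f y)) / t)"
      using C f t True by (simp add: weak_type_1_1_def Lq_norm_def)
    also have "\<dots> \<le> ennreal (\<bar>C\<bar> * (LINT y|\<mu>. cmod (f y)) / t)"
      using t by (intro ennreal_leI divide_right_mono mult_right_mono) auto
    finally show "emeasure \<mu> {z. cmod (S f z) > t} \<le> ennreal (\<bar>C\<bar> * (LINT y|\<mu>. cmod (f y) powr q) / t powr q)"
      using t True by simp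
  qed simp
next
  case False
  then obtain C where C: "strong_type \<mu> q C S" using extension by (auto simp: is_extension_def)
  show ?thesis
  proof (rule that[of "\<bar>C\<bar> powr q"])
    fix f and t :: real assume f: "f \<in> Lq \<mu> q" and t: "t > 0"
    have Sf: "S f \<in> Lq \<mu> q" "Lq_norm \<mu> q (S f) \<le> C * Lq_norm \<mu> q f"
      using C f by (auto simp: strong_type_def)
    have powr_norm: "Lq_norm \<mu> q g powr q = (LINT y|\<mu>. cmod (g y) powr q)" for g
      using q by (simp add: Lq_norm_def powr_powr)
    have "Lq_norm \<mu> q (S f) \<le> \<bar>C\<bar> * Lq_norm \<mu> q f"
      using Sf(2) by (rule order_trans) (auto simp: Lq_norm_def intro: mult_right_mono)
    then have "Lq_norm \<mu> q (S f) powr q \<le> (\<bar>C\<bar> * Lq_norm \<mu> q f) powr q"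
      using q by (intro powr_mono2) (auto simp: Lq_norm_def)
    also have "\<dots> = \<bar>C\<bar> powr q * Lq_norm \<mu> q f powr q" by (rule powr_mult)
    finally have le: "(LINT y|\<mu>. cmod (S f y) powr q) / t powr q \<le> \<bar>C\<bar> powr q * (LINT y|\<mu>. cmod (f y) powr q) / t powr q"
      unfolding powr_norm by (rule divide_right_mono) simp
    have "emeasure \<mu> {z. cmod (S f z) > t} \<le> ennreal ((LINT y|\<mu>. cmod (S f y) powr q) / t powr q)"
      using Lq_markov[OF Sf(1) t] q by simp
    also have "\<dots> \<le> ennreal (\<bar>C\<bar> powr q * (LINT y|\<mu>. cmod (f y) powr q) / t powr q)"
      by (rule ennreal_leI[OF le])
    finally show "emeasure \<mu> {z. cmod (S f z) > t} \<le> ennreal (\<bar>C\<bar> powr q * (LINT y|\<mu>. cmod (f y) powr q) / t powr q)" .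
  qed simp
qed

lemma S_tail_tendsto:
  assumes "f \<in> Lq \<mu> q" "t > 0"
  shows "(\<lambda>k. emeasure \<mu> {z. cmod (S (\<lambda>y. f y - truncate f k y) z) > t}) \<longlonglongrightarrow> 0"
proof -
  obtain C where C: "C \<ge> 0" "\<And>f t. f \<in> Lq \<mu> q \<Longrightarrow> t > 0 \<Longrightarrow>
      emeasure \<mu> {z. cmod (S f z) > t} \<le> ennreal (C * (LINT y|\<mu>. cmod (f y) powr q) / t powr q)"
    using S_weak_q by blast
  have "(\<lambda>k. C * (LINT y|\<mu>. cmod (f y - truncate f k y) powr q) / t powr q) \<longlonglongrightarrow> C * 0 / t powr q"
    using assms q by (intro tendsto_intros truncate_tendsto) auto
  then have "(\<lambda>k. ennreal (C * (LINT y|\<mu>. cmod (f y - truncate f k y) powr q) / t powr q)) \<longlonglongrightarrow> ennreal (C * 0 / t powr q)"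
    by (rule tendsto_ennrealI)
  then have lim: "(\<lambda>k. ennreal (C * (LINT y|\<mu>. cmod (f y - truncate f k y) powr q) / t powr q)) \<longlonglongrightarrow> 0" by simp
  show ?thesis
  proof (rule tendsto_sandwich[OF _ _ tendsto_const lim])
    show "\<forall>\<^sub>F k in sequentially. emeasure \<mu> {z. cmod (S (\<lambda>y. f y - truncate f k y) z) > t}
      \<le> ennreal (C * (LINT y|\<mu>. cmod (f y - truncate f k y) powr q) / t powr q)"
      using assms q by (intro always_eventually allI C(2) Lq_diff truncate_Lq) auto
  qed simp
qed

text \<open>The truncations lie in L2, where S agrees with T and the estimate with
  \<open>weak_const\<close> holds. The tail is allowed one extra level t, and its exceptional set
  disappears in the limit; thus the bound does not depend on the norm of the extension.\<close>

lemma S_weak_1_1: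
  assumes f: "f \<in> Lq \<mu> q" "integrable \<mu> f" and t: "t > 0"
  shows "emeasure \<mu> {z. cmod (S f z) > 5 * t} \<le> ennreal (weak_const \<epsilon> N * ((LINT y|\<mu>. cmod (f y)) / t))"
proof -
  define M where "M = (LINT y|\<mu>. cmod (f y))"
  have f_meas [measurable]: "f \<in> borel_measurable \<mu>" using f(1) by (rule Lq_measurable)
  have trunc_q: "truncate f k \<in> Lq \<mu> q" for k using f q by (intro truncate_Lq) auto
  have trunc_2: "truncate f k \<in> Lq \<mu> 2" for k by (rule truncate_L2[OF f_meas])
  have diff_q: "(\<lambda>y. f y - truncate f k y) \<in> Lq \<mu> q" for k using f trunc_q q by (intro Lq_diff) auto
  have bound: "emeasure \<mu> {z. cmod (S f z) > 5 * t}
    \<le> ennreal (weak_const \<epsilon> N * (M / t)) + emeasure \<mu> {z. cmod (S (\<lambda>y. f y - truncate f k y) z) > t}" for k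
  proof -
    have [measurable]: "truncate f k \<in> borel_measurable \<mu>" using trunc_2 by (rule Lq_measurable)
    have trunc_le: "cmod (truncate f k y) \<le> cmod (f y)" for y by (auto simp: truncate_def indicator_def)
    have trunc_int: "integrable \<mu> (truncate f k)"
      using f(2) by (rule Bochner_Integration.integrable_bound) (auto simp: trunc_le)
    have "AE z in \<mu>. S f z = S (truncate f k) z + S (\<lambda>y. f y - truncate f k y) z"
      using linear_on_Lq_add[OF S_linear trunc_q diff_q, of k k] by simp
    then have "AE z in \<mu>. S f z = T (truncate f k) z + S (\<lambda>y. f y - truncate f k y) z"
      using S_eq_T[OF trunc_2 trunc_q, of k] by eventually_elim simp
    then have "emeasure \<mu> {z. cmod (S f z) > 4 * t + t} \<le>
      emeasure \<mu> {z. cmod (T (truncate f k) z) > 4 * t} + emeasure \<mu> {z. cmod (S (\<lambda>y. f y - truncate f k y) z) > t}"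
      by (intro emeasure_Collect_add_le S_measurable Lq_measurable[OF T_L2] trunc_2 diff_q f space_eq)
    also have "emeasure \<mu> {z. cmod (T (truncate f k) z) > 4 * t} \<le> ennreal (weak_const \<epsilon> N * ((LINT y|\<mu>. cmod (truncate f k y)) / t))"
      by (rule T_weak_1_1[OF trunc_2 trunc_int t])
    also have "\<dots> \<le> ennreal (weak_const \<epsilon> N * (M / t))"
    proof (intro ennreal_leI mult_left_mono divide_right_mono)
      show "(LINT y|\<mu>. cmod (truncate f k y)) \<le> M"
        unfolding M_def using f trunc_int trunc_le by (intro Bochner_Integration.integral_mono) auto
    qed (use t weak_const_pos[OF \<epsilon>_pos, of N] in auto)
    finally show ?thesis by (simp add: add_right_mono)
  qed
  have "(\<lambda>k. ennreal (weak_const \<epsilon> N * (M / t)) + emeasure \<mu> {z. cmod (S (\<lambda>y. f y - truncate f k y) z) > t})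
    \<longlonglongrightarrow> ennreal (weak_const \<epsilon> N * (M / t)) + 0"
    by (intro tendsto_add tendsto_const S_tail_tendsto f t)
  then have "emeasure \<mu> {z. cmod (S f z) > 5 * t} \<le> ennreal (weak_const \<epsilon> N * (M / t)) + 0"
    using bound by (intro LIMSEQ_le_const) auto
  then show ?thesis by (simp add: M_def)
qed

text \<open>For z in the ball of radius R and y outside the ball of radius 3R, |z - y| is at least
  |x - y| / 2. The resulting bound is uniform in z, which \<open>S_off_ball\<close>
  exploits.\<close>

lemma kernel_integrable_off_ball:
  assumes f: "f \<in> Lq \<mu> q" and supp: "\<And>y. y \<in> ball x (3 * R) \<Longrightarrow> f y = 0" and R: "R > 0"
    and z: "z \<in> ball x R"
  shows "integrable \<mu> (\<lambda>y. K z y * f y)"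
    "cmod (LINT y|\<mu>. K z y * f y) \<le> 2 * (LINT y|\<mu>. cmod (f y) / cmod (x - y) * indicator (- ball x (3 * R)) y)"
proof -
  have [measurable]: "f \<in> borel_measurable \<mu>" using f by (rule Lq_measurable)
  have int: "integrable \<mu> (\<lambda>y. cmod (f y) / cmod (x - y) * indicator (- ball x (3 * R)) y)"
    using R by (intro Lq_integrable_over_distance[OF f q]) auto
  have le: "cmod (K z y * f y) \<le> 2 * (cmod (f y) / cmod (x - y) * indicator (- ball x (3 * R)) y)" for y
  proof (cases "y \<in> ball x (3 * R)")
    case False
    have zx: "cmod (x - z) < R" "cmod (x - y) \<ge> 3 * R" using z False by (auto simp: dist_norm)
    then have zy: "cmod (z - y) \<ge> cmod (x - y) / 2"
      using norm_triangle_ineq[of "x - z" "z - y"] R by simp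
    have "cmod (K z y) \<le> 1 / cmod (z - y)" using zy zx R by (intro kernel_size) auto
    also have "\<dots> \<le> 1 / (cmod (x - y) / 2)" using zy zx R by (intro frac_le) auto
    finally have "cmod (K z y) * cmod (f y) \<le> 1 / (cmod (x - y) / 2) * cmod (f y)"
      by (rule mult_right_mono) simp
    then show ?thesis using False by (simp add: norm_mult)
  qed (simp add: supp)
  show K_int: "integrable \<mu> (\<lambda>y. K z y * f y)"
    using int le by (intro Bochner_Integration.integrable_bound[OF integrable_mult_right[OF int, of 2]]) (auto intro: order_trans)
  have "cmod (LINT y|\<mu>. K z y * f y) \<le> (LINT y|\<mu>. 2 * (cmod (f y) / cmod (x - y) * indicator (- ball x (3 * R)) y))"
    by (intro Bochner_Integration.integral_norm_bound_integral K_int integrable_mult_right[OF int] le)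
  also have "\<dots> = 2 * (LINT y|\<mu>. cmod (f y) / cmod (x - y) * indicator (- ball x (3 * R)) y)"
    by (rule integral_mult_right_zero)
  finally show "cmod (LINT y|\<mu>. K z y * f y) \<le> 2 * (LINT y|\<mu>. cmod (f y) / cmod (x - y) * indicator (- ball x (3 * R)) y)" .
qed

text \<open>The integral formula is given only for T on L2. It holds for the truncations of f, and
  the error consists of S on the tail, which tends to zero in measure, and the kernel integral of
  the tail, which tends to zero uniformly on the ball of radius R.\<close>

lemma S_off_ball:
  assumes f: "f \<in> Lq \<mu> q" and supp: "\<And>y. y \<in> ball x (3 * R) \<Longrightarrow> f y = 0" and R: "R > 0"
  shows "AE z in \<mu>. z \<in> ball x R \<longrightarrow> S f z = (LINT y|\<mu>. K z y * f y)"
proof -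
  have f_meas [measurable]: "f \<in> borel_measurable \<mu>" using f(1) by (rule Lq_measurable)
  have trunc_q: "truncate f k \<in> Lq \<mu> q" for k using f q by (intro truncate_Lq) auto
  have trunc_2: "truncate f k \<in> Lq \<mu> 2" for k by (rule truncate_L2[OF f_meas])
  have [measurable]: "truncate f k \<in> borel_measurable \<mu>" for k using trunc_2 by (rule Lq_measurable)
  define h where "h k y = f y - truncate f k y" for k y
  have h_q: "h k \<in> Lq \<mu> q" for k unfolding h_def[abs_def] using f trunc_q q by (intro Lq_diff) auto
  define e where "e k = 2 * (LINT y|\<mu>. cmod (h k y) / cmod (x - y) * indicator (- ball x (3 * R)) y)" for k
  have e_lim: "e \<longlonglongrightarrow> 0"
  proof -
    have "(\<lambda>k. LINT y|\<mu>. cmod (h k y) / cmod (x - y) * indicator (- ball x (3 * R)) y) \<longlonglongrightarrow> (LINT y|\<mu>. 0)"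
    proof (rule integral_dominated_convergence[where w = "\<lambda>y. cmod (f y) / cmod (x - y) * indicator (- ball x (3 * R)) y"])
      show "integrable \<mu> (\<lambda>y. cmod (f y) / cmod (x - y) * indicator (- ball x (3 * R)) y)"
        using R by (intro Lq_integrable_over_distance[OF f q]) auto
      show "AE y in \<mu>. (\<lambda>k. cmod (h k y) / cmod (x - y) * indicator (- ball x (3 * R)) y) \<longlonglongrightarrow> 0"
      proof (intro AE_I2 tendsto_eventually)
        fix y show "\<forall>\<^sub>F k in sequentially. cmod (h k y) / cmod (x - y) * indicator (- ball x (3 * R)) y = 0"
          using truncate_eventually[of f y] by eventually_elim (simp add: h_def)
      qed
      show "AE y in \<mu>. norm (cmod (h k y) / cmod (x - y) * indicator (- ball x (3 * R)) y)
        \<le> cmod (f y) / cmod (x - y) * indicator (- ball x (3 * R)) y" for k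
        by (intro AE_I2) (auto simp: h_def indicator_def intro!: divide_right_mono cmod_diff_truncate)
    qed (auto simp: h_def)
    then show ?thesis unfolding e_def[abs_def] by (auto intro: tendsto_mult_right_zero)
  qed
  have trunc_off: "AE z in \<mu>. z \<in> ball x R \<longrightarrow> T (truncate f k) z = (LINT y|\<mu>. K z y * truncate f k y)" for k
  proof -
    \<comment> \<open>The complement of the open ball is a closed set outside which the truncations
      vanish.\<close>
    have "AE z in \<mu>. z \<notin> - ball x (3 * R) \<longrightarrow> integrable \<mu> (\<lambda>y. K z y * truncate f k y) \<and>
      T (truncate f k) z = (LINT y|\<mu>. K z y * truncate f k y)"
      by (rule T_off_support[OF trunc_2]) (auto simp: truncate_def supp)
    then show ?thesis by eventually_elim (use R in auto)
  qed
  have near: "AE z in \<mu>. z \<in> ball x R \<longrightarrow> cmod (S f z - (LINT y|\<mu>. K z y * f y)) \<le> cmod (S (h k) z) + e k" for k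
    using linear_on_Lq_add[OF S_linear trunc_q[of k] h_q[of k]] S_eq_T[OF trunc_2 trunc_q, of k] trunc_off[of k]
  proof eventually_elim
    case (elim z)
    show ?case
    proof
      assume z: "z \<in> ball x R"
      have Sf: "S f z = (LINT y|\<mu>. K z y * truncate f k y) + S (h k) z"
        using elim z by (simp add: h_def)
      have trunc_supp: "truncate f k y = 0" "h k y = 0" if "y \<in> ball x (3 * R)" for y
        using supp[OF that] by (auto simp: truncate_def h_def)
      have "(LINT y|\<mu>. K z y * f y) - (LINT y|\<mu>. K z y * truncate f k y) = (LINT y|\<mu>. K z y * h k y)"
        using kernel_integrable_off_ball(1)[OF f supp R z]
          kernel_integrable_off_ball(1)[OF trunc_q trunc_supp(1) R z]
        by (simp add: h_def right_diff_distrib)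
      moreover have "cmod (LINT y|\<mu>. K z y * h k y) \<le> e k"
        unfolding e_def by (rule kernel_integrable_off_ball(2)[OF h_q trunc_supp(2) R z])
      moreover have "S f z - (LINT y|\<mu>. K z y * f y)
        = S (h k) z - ((LINT y|\<mu>. K z y * f y) - (LINT y|\<mu>. K z y * truncate f k y))"
        unfolding Sf by simp
      ultimately show "cmod (S f z - (LINT y|\<mu>. K z y * f y)) \<le> cmod (S (h k) z) + e k"
        using norm_triangle_ineq4[of "S (h k) z" "LINT y|\<mu>. K z y * h k y"] by simp
    qed
  qed
  have small: "AE z in \<mu>. z \<in> ball x R \<longrightarrow> cmod (S f z - (LINT y|\<mu>. K z y * f y)) \<le> 2 * t" if t: "t > 0" for t
  proof -
    define G where "G k = {z. cmod (S (h k) z) > t}" for k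
    have G_meas: "G k \<in> sets \<mu>" for k
      using measurable_sets[of "\<lambda>z. cmod (S (h k) z)" \<mu> borel "{t<..}"] S_measurable[OF h_q, of k]
      by (auto simp: G_def vimage_def)
    have "\<forall>\<^sub>F k in sequentially. e k < t" using order_tendstoD(2)[OF e_lim t] .
    then obtain k0 where k0: "\<And>k. k \<ge> k0 \<Longrightarrow> e k < t" by (auto simp: eventually_sequentially)
    \<comment> \<open>Points at which every late tail is large; D is null because the measures of
      the \<open>G k\<close> tend to zero. Any other point of the ball admits one k with both errors
      at most t.\<close>
    define D where "D = (\<Inter>k\<in>{k0..}. G k)"
    have D_meas: "D \<in> sets \<mu>" unfolding D_def by (intro sets.countable_INT'') (use G_meas in auto)
    have "emeasure \<mu> D \<le> 0"
    proof (rule LIMSEQ_le_const)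
      show "(\<lambda>k. emeasure \<mu> (G k)) \<longlonglongrightarrow> 0"
        using S_tail_tendsto[OF f t] unfolding G_def h_def[abs_def] .
      show "\<exists>k0. \<forall>k\<ge>k0. emeasure \<mu> D \<le> emeasure \<mu> (G k)"
        using G_meas by (intro exI[of _ k0] allI impI emeasure_mono) (auto simp: D_def)
    qed
    then have "AE z in \<mu>. z \<notin> D" using D_meas by (intro AE_not_in) (auto intro: null_setsI)
    moreover have "AE z in \<mu>. \<forall>k. z \<in> ball x R \<longrightarrow> cmod (S f z - (LINT y|\<mu>. K z y * f y)) \<le> cmod (S (h k) z) + e k"
      using near by (subst AE_all_countable) blast
    ultimately show ?thesis
    proof eventually_elim
      case (elim z)
      then obtain k where "k \<ge> k0" "cmod (S (h k) z) \<le> t" by (auto simp: D_def G_def not_less)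
      then show ?case using elim(2) k0[of k] by (smt (verit))
    qed
  qed
  have "AE z in \<mu>. \<forall>j::nat. z \<in> ball x R \<longrightarrow> cmod (S f z - (LINT y|\<mu>. K z y * f y)) \<le> 2 * (1 / Suc j)"
    by (subst AE_all_countable) (intro allI small, simp)
  then show ?thesis
  proof eventually_elim
    case (elim z)
    show ?case
    proof
      assume z: "z \<in> ball x R"
      have "cmod (S f z - (LINT y|\<mu>. K z y * f y)) \<le> 0"
      proof (rule ccontr)
        assume "\<not> ?thesis"
        then obtain j :: nat where "1 / Suc j < cmod (S f z - (LINT y|\<mu>. K z y * f y)) / 2"
          using nat_approx_posE[of "cmod (S f z - (LINT y|\<mu>. K z y * f y)) / 2"] by auto
        then show False using elim z by (auto dest!: spec[of _ j])
      qed
      then show "S f z = (LINT y|\<mu>. K z y * f y)" by simp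
    qed
  qed
qed

subsection \<open>The Cotlar inequality\<close>

lemma truncated_integrable:
  assumes f: "f \<in> Lq \<mu> q" and "r > 0"
  shows "integrable \<mu> (\<lambda>y. indicator (- ball x r) y *\<^sub>R (K x y * f y))"
proof (rule Bochner_Integration.integrable_bound[OF Lq_integrable_over_distance[OF f q \<open>r > 0\<close>]])
  have [measurable]: "f \<in> borel_measurable \<mu>" using f by (rule Lq_measurable)
  show "(\<lambda>y. indicator (- ball x r) y *\<^sub>R (K x y * f y)) \<in> borel_measurable \<mu>" by measurable
  show "AE y in \<mu>. cmod (indicator (- ball x r) y *\<^sub>R (K x y * f y))
    \<le> norm (cmod (f y) / cmod (x - y) * indicator (- ball x r) y)"
  proof (intro AE_I2)
    fix y
    show "cmod (indicator (- ball x r) y *\<^sub>R (K x y * f y)) \<le> norm (cmod (f y) / cmod (x - y) * indicator (- ball x r) y)"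
    proof (cases "y \<in> ball x r")
      case False
      then have "x \<noteq> y" using assms by auto
      from mult_right_mono[OF kernel_size[OF this], of "cmod (f y)"]
      show ?thesis using False by (simp add: norm_mult)
    qed simp
  qed
qed

text \<open>Only the shell between the two radii contributes, and there |K| \<le> 1 / |x - y|; the
  hypothesis \<open>shell\<close> has the form supplied by
  \<open>exists_doubling_radius\<close>.\<close>

lemma truncated_diff_le:
  assumes f: "f \<in> Lq \<mu> q" and "r > 0" "r \<le> R" "A \<ge> 0"
    and shell: "(\<integral>\<^sup>+y\<in>ball x R - ball x r. ennreal (cmod (f y)) * ennreal (1 / cmod (x - y)) \<partial>\<mu>) \<le> ennreal A"
  shows "cmod (truncated \<mu> K r f x - truncated \<mu> K R f x) \<le> A"
proof -
  have int: "integrable \<mu> (\<lambda>y. indicator (- ball x r) y *\<^sub>R (K x y * f y) - indicator (- ball x R) y *\<^sub>R (K x y * f y))"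
    using assms by (intro Bochner_Integration.integrable_diff truncated_integrable) auto
  have "truncated \<mu> K r f x - truncated \<mu> K R f x
    = (LINT y|\<mu>. indicator (- ball x r) y *\<^sub>R (K x y * f y) - indicator (- ball x R) y *\<^sub>R (K x y * f y))"
    unfolding truncated_def set_lebesgue_integral_def using assms
    by (intro Bochner_Integration.integral_diff[symmetric] truncated_integrable) auto
  then have "ennreal (cmod (truncated \<mu> K r f x - truncated \<mu> K R f x))
    \<le> (\<integral>\<^sup>+y. ennreal (cmod (indicator (- ball x r) y *\<^sub>R (K x y * f y) - indicator (- ball x R) y *\<^sub>R (K x y * f y))) \<partial>\<mu>)"
    using integral_norm_bound_ennreal[OF int] by simp
  also have "\<dots> \<le> (\<integral>\<^sup>+y\<in>ball x R - ball x r. ennreal (cmod (f y)) * ennreal (1 / cmod (x - y)) \<partial>\<mu>)"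
  proof (intro nn_integral_mono)
    fix y
    consider "y \<in> ball x r" "y \<in> ball x R" | "y \<notin> ball x R" "y \<notin> ball x r" | "y \<in> ball x R" "y \<notin> ball x r"
      using assms by (meson subsetD subset_ball)
    then show "ennreal (cmod (indicator (- ball x r) y *\<^sub>R (K x y * f y) - indicator (- ball x R) y *\<^sub>R (K x y * f y)))
      \<le> ennreal (cmod (f y)) * ennreal (1 / cmod (x - y)) * indicator (ball x R - ball x r) y"
    proof cases
      case 3
      then have "x \<noteq> y" using assms by auto
      have "cmod (K x y * f y) \<le> cmod (f y) * (1 / cmod (x - y))"
        unfolding norm_mult by (subst mult.commute) (intro mult_left_mono kernel_size[OF \<open>x \<noteq> y\<close>], simp)
      then have "ennreal (cmod (K x y * f y)) \<le> ennreal (cmod (f y)) * ennreal (1 / cmod (x - y))"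
        by (subst ennreal_mult[symmetric]) (auto intro: ennreal_leI)
      then show ?thesis using 3 by simp
    qed simp_all
  qed
  also have "\<dots> \<le> ennreal A" by (rule shell)
  finally show ?thesis using assms by simp
qed

text \<open>Smoothness in the first variable gains R^\<epsilon> / |x - y|^(1 + \<epsilon>), and the
  tail estimate beyond 3R gives back R^(-\<epsilon>).\<close>

lemma kernel_oscillation_le:
  assumes f: "f \<in> Lq \<mu> q" and supp: "\<And>y. y \<in> ball x (3 * R) \<Longrightarrow> f y = 0" and R: "R > 0"
    and avg: "averages_le (\<lambda>y. ennreal (cmod (f y))) x A" and A: "A \<ge> 0" and z: "z \<in> ball x R"
  shows "cmod ((LINT y|\<mu>. K x y * f y) - (LINT y|\<mu>. K z y * f y)) \<le> tail_const \<epsilon> * A"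
proof -
  have f_meas [measurable]: "f \<in> borel_measurable \<mu>" using f by (rule Lq_measurable)
  have int: "integrable \<mu> (\<lambda>y. K x y * f y)" "integrable \<mu> (\<lambda>y. K z y * f y)"
    using kernel_integrable_off_ball(1)[OF f supp R] z R by auto
  then have "(LINT y|\<mu>. K x y * f y) - (LINT y|\<mu>. K z y * f y) = (LINT y|\<mu>. (K x y - K z y) * f y)"
    by (simp add: left_diff_distrib)
  moreover have "integrable \<mu> (\<lambda>y. (K x y - K z y) * f y)" using int by (simp add: left_diff_distrib)
  ultimately have "ennreal (cmod ((LINT y|\<mu>. K x y * f y) - (LINT y|\<mu>. K z y * f y)))
    \<le> (\<integral>\<^sup>+y. ennreal (cmod ((K x y - K z y) * f y)) \<partial>\<mu>)"
    using integral_norm_bound_ennreal by metis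
  also have "\<dots> \<le> (\<integral>\<^sup>+y. ennreal (R powr \<epsilon>) * (ennreal (cmod (f y)) * ennreal (1 / cmod (x - y) powr (1 + \<epsilon>)) * indicator (- ball x (3 * R)) y) \<partial>\<mu>)"
  proof (intro nn_integral_mono)
    fix y
    show "ennreal (cmod ((K x y - K z y) * f y))
      \<le> ennreal (R powr \<epsilon>) * (ennreal (cmod (f y)) * ennreal (1 / cmod (x - y) powr (1 + \<epsilon>)) * indicator (- ball x (3 * R)) y)"
    proof (cases "y \<in> ball x (3 * R)")
      case False
      then have xy: "cmod (x - y) \<ge> 3 * R" by (simp add: dist_norm)
      have xz: "cmod (x - z) < R" using z by (simp add: dist_norm)
      have "x \<noteq> y" using xy R by auto
      then have "cmod (K x y - K z y) \<le> cmod (x - z) powr \<epsilon> / cmod (x - y) powr (1 + \<epsilon>)"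
        using xy xz R by (intro kernel_smooth1) auto
      also have "\<dots> \<le> R powr \<epsilon> / cmod (x - y) powr (1 + \<epsilon>)"
        using xz \<epsilon>_pos by (intro divide_right_mono powr_mono2) auto
      finally have "cmod (K x y - K z y) * cmod (f y) \<le> R powr \<epsilon> / cmod (x - y) powr (1 + \<epsilon>) * cmod (f y)"
        by (rule mult_right_mono) simp
      also have "\<dots> = R powr \<epsilon> * (cmod (f y) * (1 / cmod (x - y) powr (1 + \<epsilon>)))" by simp
      finally have "ennreal (cmod ((K x y - K z y) * f y)) \<le> ennreal (R powr \<epsilon> * (cmod (f y) * (1 / cmod (x - y) powr (1 + \<epsilon>))))"
        unfolding norm_mult by (rule ennreal_leI)
      also have "\<dots> = ennreal (R powr \<epsilon>) * (ennreal (cmod (f y)) * ennreal (1 / cmod (x - y) powr (1 + \<epsilon>)))"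
        by (subst ennreal_mult, simp, simp, subst ennreal_mult) auto
      finally show ?thesis using False by simp
    qed (simp add: supp)
  qed
  also have "\<dots> = ennreal (R powr \<epsilon>) * (\<integral>\<^sup>+y\<in>- ball x (3 * R). ennreal (cmod (f y)) * ennreal (1 / cmod (x - y) powr (1 + \<epsilon>)) \<partial>\<mu>)"
    by (rule nn_integral_cmult) measurable
  also have "\<dots> \<le> ennreal (R powr \<epsilon>) * ennreal (A * tail_const \<epsilon> * (3 * R) powr - \<epsilon>)"
    using R A \<epsilon>_pos avg by (intro mult_left_mono nn_integral_tail_le) auto
  also have "\<dots> = ennreal (R powr \<epsilon> * (A * tail_const \<epsilon> * (3 * R) powr - \<epsilon>))"
    using A tail_const_nonneg[OF \<epsilon>_pos] by (subst ennreal_mult) auto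
  also have "\<dots> \<le> ennreal (tail_const \<epsilon> * A)"
  proof (rule ennreal_leI)
    have "R powr \<epsilon> * (3 * R) powr - \<epsilon> = 3 powr - \<epsilon>"
      using R by (simp add: powr_mult powr_minus field_simps)
    then have "R powr \<epsilon> * (3 * R) powr - \<epsilon> \<le> 1" using \<epsilon>_pos powr_less_one[of 3 "-\<epsilon>"] by simp
    then have "A * tail_const \<epsilon> * (R powr \<epsilon> * (3 * R) powr - \<epsilon>) \<le> A * tail_const \<epsilon> * 1"
      using A tail_const_nonneg[OF \<epsilon>_pos] by (intro mult_left_mono) auto
    then show "R powr \<epsilon> * (A * tail_const \<epsilon> * (3 * R) powr - \<epsilon>) \<le> tail_const \<epsilon> * A" by (simp add: mult_ac)
  qed
  finally show ?thesis using A tail_const_nonneg[OF \<epsilon>_pos] by (simp add: ennreal_le_iff)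
qed

lemma exists_half_ball:
  assumes \<phi>: "\<phi> \<in> Lq \<mu> q" and A: "A > 0" and avg: "averages_le (\<lambda>y. ennreal (cmod (\<phi> y))) x A"
    and "emeasure \<mu> UNIV \<noteq> 0" "r > 0"
  obtains R G where "R > 0" "measure \<mu> (ball x R) > 0" "G \<in> sets borel" "G \<subseteq> ball x R"
    "emeasure \<mu> (ball x R) \<le> 2 * emeasure \<mu> G"
    "\<forall>z\<in>G. cmod (truncated \<mu> K r \<phi> x) \<le> cmod (S \<phi> z) + cotlar_const \<epsilon> N * A"
proof -
  obtain R where R: "R \<ge> r" "measure \<mu> (ball x R) > 0"
    "measure \<mu> (ball x (3 * R)) \<le> 9 * measure \<mu> (ball x R)"
    and shell: "\<forall>f\<in>borel_measurable \<mu>. \<forall>A\<ge>0. averages_le f x A \<longrightarrow>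
      (\<integral>\<^sup>+y\<in>ball x (3 * R) - ball x r. f y * ennreal (1 / cmod (x - y)) \<partial>\<mu>) \<le> ennreal (8 * A)"
    by (rule exists_doubling_radius[OF assms(4,5)]) (rule that)
  have R_pos: "R > 0" using R assms by simp
  have [measurable]: "\<phi> \<in> borel_measurable \<mu>" using \<phi> by (rule Lq_measurable)
  have q0: "q \<ge> 0" using q by simp
  define B where "B = measure \<mu> (ball x R)"
  define w where "w = weak_const \<epsilon> N"
  have w: "w > 0" unfolding w_def by (rule weak_const_pos[OF \<epsilon>_pos])
  \<comment> \<open>The local part is handled by the weak type estimate, the distant part by its
    integral formula and the smoothness of the kernel.\<close>
  define f1 where "f1 y = \<phi> y * indicator (ball x (3 * R)) y" for y
  define f2 where "f2 y = \<phi> y * indicator (- ball x (3 * R)) y" for y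
  have f1: "f1 \<in> Lq \<mu> q" unfolding f1_def[abs_def] by (intro Lq_indicator \<phi> q0) auto
  have f2: "f2 \<in> Lq \<mu> q" unfolding f2_def[abs_def] by (intro Lq_indicator \<phi> q0) auto
  have f2_supp: "f2 y = 0" if "y \<in> ball x (3 * R)" for y using that by (simp add: f2_def)
  have sum: "\<phi> = (\<lambda>y. f1 y + f2 y)" by (auto simp: fun_eq_iff f1_def f2_def indicator_def)
  have f2_avg: "averages_le (\<lambda>y. ennreal (cmod (f2 y))) x A"
    unfolding averages_le_def
  proof (intro allI impI)
    fix s :: real assume "s > 0"
    have "(\<integral>\<^sup>+y\<in>ball x s. ennreal (cmod (f2 y)) \<partial>\<mu>) \<le> (\<integral>\<^sup>+y\<in>ball x s. ennreal (cmod (\<phi> y)) \<partial>\<mu>)"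
      by (intro nn_integral_mono) (auto simp: f2_def indicator_def)
    also have "\<dots> \<le> ennreal (A * measure \<mu> (ball x s))" using averages_leD[OF avg \<open>s > 0\<close>] .
    finally show "(\<integral>\<^sup>+y\<in>ball x s. ennreal (cmod (f2 y)) \<partial>\<mu>) \<le> ennreal (A * measure \<mu> (ball x s))" .
  qed
  have f1_int: "integrable \<mu> f1" unfolding f1_def[abs_def] by (rule Lq_integrable_on_ball[OF \<phi> q])
  have f1_le: "(LINT y|\<mu>. cmod (f1 y)) \<le> 9 * A * B"
  proof -
    have "ennreal (LINT y|\<mu>. cmod (f1 y)) = (\<integral>\<^sup>+y. ennreal (cmod (f1 y)) \<partial>\<mu>)"
      using f1_int by (subst nn_integral_eq_integral) auto
    also have "\<dots> = (\<integral>\<^sup>+y\<in>ball x (3 * R). ennreal (cmod (\<phi> y)) \<partial>\<mu>)"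
      by (intro nn_integral_cong) (auto simp: f1_def indicator_def)
    also have "\<dots> \<le> ennreal (A * measure \<mu> (ball x (3 * R)))"
      using R_pos by (intro averages_leD[OF avg]) auto
    finally have "(LINT y|\<mu>. cmod (f1 y)) \<le> A * measure \<mu> (ball x (3 * R))"
      using A by (simp add: ennreal_le_iff)
    also have "\<dots> \<le> A * (9 * B)" using R(3) A unfolding B_def by (intro mult_left_mono) auto
    finally show ?thesis by simp
  qed
  \<comment> \<open>The level 5t with t = 18 w A is set so that the weak type bound, with the norm
    of \<open>f1\<close> at most 9 A B by doubling, is exactly half of B.\<close>
  define W where "W = {z. cmod (S f1 z) > 5 * (18 * w * A)}"
  have W_meas: "W \<in> sets \<mu>"
    using measurable_sets[of "\<lambda>z. cmod (S f1 z)" \<mu> borel "{5 * (18 * w * A)<..}"] S_measurable[OF f1]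
    by (auto simp: W_def vimage_def)
  have W_le: "emeasure \<mu> W \<le> ennreal (B / 2)"
  proof -
    have "emeasure \<mu> W \<le> ennreal (w * ((LINT y|\<mu>. cmod (f1 y)) / (18 * w * A)))"
      unfolding W_def w_def using w A by (intro S_weak_1_1 f1 f1_int) (auto simp: w_def)
    also have "\<dots> \<le> ennreal (w * (9 * A * B / (18 * w * A)))"
      using w A f1_le by (intro ennreal_leI mult_left_mono divide_right_mono) auto
    also have "w * (9 * A * B / (18 * w * A)) = B / 2" using w A by simp
    finally show ?thesis .
  qed
  have f2_off: "AE z in \<mu>. z \<in> ball x R \<longrightarrow> S f2 z = (LINT y|\<mu>. K z y * f2 y)"
    by (rule S_off_ball[OF f2 _ R_pos]) (rule f2_supp)
  have "AE z in \<mu>. z \<in> ball x R \<longrightarrow> S \<phi> z = S f1 z + (LINT y|\<mu>. K z y * f2 y)"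
    using linear_on_Lq_add[OF S_linear f1 f2] f2_off
    unfolding sum[symmetric] by eventually_elim simp
  \<comment> \<open>Removing the null set Z makes the final inequality valid at every point of G and
    costs no measure.\<close>
  then obtain Z where Z: "\<And>z. z \<notin> Z \<Longrightarrow> z \<in> ball x R \<Longrightarrow> S \<phi> z = S f1 z + (LINT y|\<mu>. K z y * f2 y)"
    "Z \<in> null_sets \<mu>"
    by (elim AE_E3) auto
  define G where "G = ball x R - W - Z"
  have G_meas: "G \<in> sets \<mu>" unfolding G_def using W_meas Z(2) by (intro sets.Diff ball_in_sets) auto
  show thesis
  proof (rule that[of R G])
    show "R > 0" by (rule R_pos)
    show "measure \<mu> (ball x R) > 0" by (rule R(2))
    show "G \<in> sets borel" using G_meas by simp
    show "G \<subseteq> ball x R" by (auto simp: G_def)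
    have "emeasure \<mu> (ball x R) \<le> emeasure \<mu> (G \<union> W \<union> Z)"
      using G_meas W_meas Z(2) by (intro emeasure_mono) (auto simp: G_def)
    also have "\<dots> = emeasure \<mu> (G \<union> W)"
      using G_meas W_meas Z(2) by (intro emeasure_Un_null_set) auto
    also have "\<dots> \<le> emeasure \<mu> G + emeasure \<mu> W" using G_meas W_meas by (rule emeasure_subadditive)
    also have "\<dots> \<le> emeasure \<mu> G + ennreal (B / 2)" using W_le by (rule add_left_mono)
    finally have half: "emeasure \<mu> (ball x R) \<le> emeasure \<mu> G + ennreal (B / 2)" .
    have "emeasure \<mu> G < \<infinity>"
      by (rule emeasure_bounded_finite) (auto simp: G_def intro: bounded_subset[OF bounded_ball[of x R]])
    then have G: "emeasure \<mu> G = ennreal (measure \<mu> G)"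
      by (simp add: emeasure_eq_ennreal_measure less_top)
    have "B \<le> measure \<mu> G + B / 2"
      using half unfolding emeasure_ball_eq G B_def by (simp flip: ennreal_plus)
    then have "B \<le> 2 * measure \<mu> G" by simp
    then show "emeasure \<mu> (ball x R) \<le> 2 * emeasure \<mu> G"
      unfolding emeasure_ball_eq G B_def[symmetric]
      by (simp flip: ennreal_numeral ennreal_mult add: ennreal_leI)
    show "\<forall>z\<in>G. cmod (truncated \<mu> K r \<phi> x) \<le> cmod (S \<phi> z) + cotlar_const \<epsilon> N * A"
    proof
      fix z assume "z \<in> G"
      then have z: "z \<in> ball x R" "cmod (S f1 z) \<le> 90 * w * A" "z \<notin> Z" by (auto simp: G_def W_def)
      have d1: "cmod (truncated \<mu> K r \<phi> x - truncated \<mu> K (3 * R) \<phi> x) \<le> 8 * A"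
        using shell[rule_format, of "\<lambda>y. ennreal (cmod (\<phi> y))" A] avg A R assms
        by (intro truncated_diff_le \<phi>) auto
      have "truncated \<mu> K (3 * R) \<phi> x = (LINT y|\<mu>. K x y * f2 y)"
        unfolding truncated_def set_lebesgue_integral_def
        by (intro Bochner_Integration.integral_cong) (auto simp: f2_def indicator_def)
      moreover have "cmod ((LINT y|\<mu>. K x y * f2 y) - (LINT y|\<mu>. K z y * f2 y)) \<le> tail_const \<epsilon> * A"
        using A z by (intro kernel_oscillation_le[OF f2 f2_supp R_pos f2_avg]) auto
      moreover have "(LINT y|\<mu>. K z y * f2 y) = S \<phi> z - S f1 z" using Z(1)[OF z(3,1)] by simp
      ultimately have d2: "cmod (truncated \<mu> K (3 * R) \<phi> x - (S \<phi> z - S f1 z)) \<le> tail_const \<epsilon> * A" by simp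
      have "cmod (truncated \<mu> K r \<phi> x) \<le> cmod (truncated \<mu> K r \<phi> x - truncated \<mu> K (3 * R) \<phi> x)
          + cmod (truncated \<mu> K (3 * R) \<phi> x - (S \<phi> z - S f1 z)) + (cmod (S \<phi> z) + cmod (S f1 z))"
        by norm
      also have "\<dots> \<le> 8 * A + tail_const \<epsilon> * A + (cmod (S \<phi> z) + 90 * w * A)"
        using d1 d2 z(2) by (intro add_mono) auto
      also have "\<dots> = cmod (S \<phi> z) + cotlar_const \<epsilon> N * A"
        by (simp add: cotlar_const_def w_def algebra_simps)
      finally show "cmod (truncated \<mu> K r \<phi> x) \<le> cmod (S \<phi> z) + cotlar_const \<epsilon> N * A" .
    qed
  qed
qed

text \<open>The excess L of the truncated integral over the error term is a lower bound for |S
  \<phi>| on at least half of the ball. So L^p is at most twice the average of |S \<phi>|^p, and the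
  root turns 2 into 2^(1/p).\<close>

lemma truncated_le_power_average:
  assumes \<phi>: "\<phi> \<in> Lq \<mu> q" and A: "A > 0" and avg: "averages_le (\<lambda>y. ennreal (cmod (\<phi> y))) x A"
    and ne: "emeasure \<mu> UNIV \<noteq> 0" and r: "r > 0" and p: "p > 0"
  shows "ennreal (cmod (truncated \<mu> K r \<phi> x))
    \<le> ennreal (2 powr (1 / p)) * epowr (maximal_function \<mu> (\<lambda>y. cmod (S \<phi> y) powr p) x) (1 / p)
      + ennreal (cotlar_const \<epsilon> N * A)"
proof -
  define X where "X = maximal_function \<mu> (\<lambda>y. cmod (S \<phi> y) powr p) x"
  define L where "L = cmod (truncated \<mu> K r \<phi> x) - cotlar_const \<epsilon> N * A"
  have c: "cotlar_const \<epsilon> N * A \<ge> 0" using cotlar_const_pos[OF \<epsilon>_pos, of N] A by simp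
  have "ennreal L \<le> ennreal (2 powr (1 / p)) * epowr X (1 / p)"
  \<comment> \<open>In these cases the left side is 0 or the right side is infinite; otherwise the
    powers can be compared as real numbers.\<close>
  proof (cases "L \<le> 0 \<or> X = \<infinity>")
    case True
    then show ?thesis by (auto simp: epowr_def ennreal_neg ennreal_mult_eq_top_iff)
  next
    case False
    then have L: "L > 0" and "X \<noteq> \<infinity>" by auto
    define m where "m = enn2real X"
    have X: "X = ennreal m" "m \<ge> 0" using \<open>X \<noteq> \<infinity>\<close> by (auto simp: m_def less_top)
    obtain R G where R: "R > 0" "measure \<mu> (ball x R) > 0"
      and G: "G \<in> sets borel" "G \<subseteq> ball x R" "emeasure \<mu> (ball x R) \<le> 2 * emeasure \<mu> G"
        "\<forall>z\<in>G. cmod (truncated \<mu> K r \<phi> x) \<le> cmod (S \<phi> z) + cotlar_const \<epsilon> N * A"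
      by (rule exists_half_ball[OF \<phi> A avg ne r]) (rule that)
    define B where "B = measure \<mu> (ball x R)"
    have B: "B > 0" "emeasure \<mu> (ball x R) = ennreal B" using R by (auto simp: B_def emeasure_ball_eq)
    have "ennreal (L powr p) * ennreal B \<le> ennreal (L powr p) * (2 * emeasure \<mu> G)"
      using G(3) B by (intro mult_left_mono) auto
    also have "\<dots> = 2 * (\<integral>\<^sup>+z. ennreal (L powr p) * indicator G z \<partial>\<mu>)"
      using G(1) by (subst nn_integral_cmult_indicator) (auto simp: mult_ac)
    also have "\<dots> \<le> 2 * (\<integral>\<^sup>+z\<in>ball x R. ennreal (norm (cmod (S \<phi> z) powr p)) \<partial>\<mu>)"
    proof (intro mult_left_mono nn_integral_mono)
      fix z
      show "ennreal (L powr p) * indicator G z \<le> ennreal (norm (cmod (S \<phi> z) powr p)) * indicator (ball x R) z"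
      proof (cases "z \<in> G")
        case True
        then have "L \<le> cmod (S \<phi> z)" using G(4) by (auto simp: L_def)
        then have "L powr p \<le> cmod (S \<phi> z) powr p" using L p by (intro powr_mono2) auto
        then show ?thesis using True G(2) by (auto intro: ennreal_leI)
      qed simp
    qed simp
    also have "(\<integral>\<^sup>+z\<in>ball x R. ennreal (norm (cmod (S \<phi> z) powr p)) \<partial>\<mu>) \<le> X * emeasure \<mu> (ball x R)"
    proof -
      have "(\<integral>\<^sup>+z\<in>ball x R. ennreal (norm (cmod (S \<phi> z) powr p)) \<partial>\<mu>) / emeasure \<mu> (ball x R) \<le> X"
        unfolding X_def maximal_function_def using R B by (intro SUP_upper) auto
      then show ?thesis by (rule le_mult_if_divide_le) (use B in auto)
    qed
    finally have "ennreal (L powr p) * ennreal B \<le> 2 * (ennreal m * ennreal B)"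
      unfolding B(2) X(1) by (simp add: mult_left_mono)
    then have "ennreal (L powr p * B) \<le> ennreal (2 * (m * B))"
      using B X(2) by (simp add: ennreal_mult)
    then have "L powr p * B \<le> (2 * m) * B" using B X(2) by (simp add: ennreal_le_iff mult.assoc)
    then have "L powr p \<le> 2 * m" using B by simp
    then have "(L powr p) powr (1 / p) \<le> (2 * m) powr (1 / p)" using p by (intro powr_mono2) auto
    then have "L \<le> 2 powr (1 / p) * m powr (1 / p)" using L p by (simp add: powr_powr powr_mult)
    then have "ennreal L \<le> ennreal (2 powr (1 / p) * m powr (1 / p))" by (rule ennreal_leI)
    also have "\<dots> = ennreal (2 powr (1 / p)) * epowr X (1 / p)"
      using X by (simp add: epowr_def ennreal_mult)
    finally show ?thesis .
  qed
  then have "ennreal L + ennreal (cotlar_const \<epsilon> N * A)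
    \<le> ennreal (2 powr (1 / p)) * epowr X (1 / p) + ennreal (cotlar_const \<epsilon> N * A)" by (rule add_right_mono)
  moreover have "ennreal (cmod (truncated \<mu> K r \<phi> x)) \<le> ennreal L + ennreal (cotlar_const \<epsilon> N * A)"
  proof (cases "L \<ge> 0")
    case True
    then show ?thesis using c by (simp add: L_def flip: ennreal_plus)
  next
    case False
    then have "ennreal (cmod (truncated \<mu> K r \<phi> x)) \<le> ennreal (cotlar_const \<epsilon> N * A)"
      by (intro ennreal_leI) (simp add: L_def)
    then show ?thesis by (rule add_increasing[rotated]) simp
  qed
  ultimately show ?thesis unfolding X_def by (rule order_trans[rotated])
qed

text \<open>The maximal function disregards null balls, on which the required inequality is
  trivial.\<close>

lemma averages_le_maximal_function:
  assumes "maximal_function \<mu> \<phi> x \<le> ennreal A" "A \<ge> 0"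
  shows "averages_le (\<lambda>y. ennreal (cmod (\<phi> y))) x A"
  unfolding averages_le_def
proof (intro allI impI)
  fix s :: real assume s: "s > 0"
  show "(\<integral>\<^sup>+y\<in>ball x s. ennreal (cmod (\<phi> y)) \<partial>\<mu>) \<le> ennreal (A * measure \<mu> (ball x s))"
  proof (cases "measure \<mu> (ball x s) > 0")
    case True
    then have "(\<integral>\<^sup>+y\<in>ball x s. ennreal (cmod (\<phi> y)) \<partial>\<mu>) / emeasure \<mu> (ball x s) \<le> maximal_function \<mu> \<phi> x"
      unfolding maximal_function_def using s by (intro SUP_upper) (auto simp: emeasure_ball_eq)
    also have "\<dots> \<le> ennreal A" by (rule assms)
    finally have "(\<integral>\<^sup>+y\<in>ball x s. ennreal (cmod (\<phi> y)) \<partial>\<mu>) \<le> ennreal A * emeasure \<mu> (ball x s)"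
      by (rule le_mult_if_divide_le) (use True in \<open>auto simp: emeasure_ball_eq\<close>)
    then show ?thesis using assms by (simp add: emeasure_ball_eq ennreal_mult)
  next
    case False
    then have "ball x s \<in> null_sets \<mu>"
      by (intro null_setsI) (auto simp: emeasure_ball_eq ennreal_neg not_less)
    then have "(\<integral>\<^sup>+y\<in>ball x s. ennreal (cmod (\<phi> y)) \<partial>\<mu>) = 0"
      by (rule nn_integral_null_set)
    then show ?thesis by simp
  qed
qed

lemma cotlar_inequality:
  assumes \<phi>: "\<phi> \<in> Lq \<mu> q" and p: "p > 0"
  shows "maximal_singular \<mu> K \<phi> x
    \<le> ennreal (2 powr (1 / p)) * epowr (maximal_function \<mu> (\<lambda>y. cmod (S \<phi> y) powr p) x) (1 / p)
      + ennreal (cotlar_const \<epsilon> N) * maximal_function \<mu> \<phi> x"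
proof -
  define c where "c = cotlar_const \<epsilon> N"
  have c: "c > 0" unfolding c_def by (rule cotlar_const_pos[OF \<epsilon>_pos])
  define Y where "Y = ennreal (2 powr (1 / p)) * epowr (maximal_function \<mu> (\<lambda>y. cmod (S \<phi> y) powr p) x) (1 / p)"
  have "ennreal (cmod (truncated \<mu> K r \<phi> x)) \<le> Y + ennreal c * maximal_function \<mu> \<phi> x" if r: "r > 0" for r
  \<comment> \<open>On a null space there is no doubling ball, but every truncated integral is zero;
    if the maximal function is infinite, so is the right side, as c > 0.\<close>
  proof (cases "emeasure \<mu> UNIV = 0 \<or> maximal_function \<mu> \<phi> x = \<infinity>")
    case True
    then show ?thesis
    proof
      assume "emeasure \<mu> UNIV = 0"
      then have "UNIV \<in> null_sets \<mu>" by (intro null_setsI) auto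
      then have "AE y in \<mu>. indicator (- ball x r) y *\<^sub>R (K x y * \<phi> y) = 0"
        by (rule AE_I') simp
      then have "truncated \<mu> K r \<phi> x = 0"
        unfolding truncated_def set_lebesgue_integral_def by (rule integral_eq_zero_AE)
      then show ?thesis by simp
    next
      assume "maximal_function \<mu> \<phi> x = \<infinity>"
      then have "ennreal c * maximal_function \<mu> \<phi> x = \<infinity>" using c by (simp add: ennreal_mult_eq_top_iff)
      then show ?thesis by simp
    qed
  next
    case False
    define m where "m = enn2real (maximal_function \<mu> \<phi> x)"
    have m: "maximal_function \<mu> \<phi> x = ennreal m" "m \<ge> 0" using False by (auto simp: m_def less_top)
    show ?thesis
    proof (rule ennreal_le_epsilon)
      fix e :: real assume e: "e > 0"
      \<comment> \<open>The bound A has to be positive because it fixes the level of the weak type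
        estimate, while m may be 0; the enlargement by e / c costs e in the end.\<close>
      have "m + e / c > 0" using m e c by (simp add: add_nonneg_pos)
      moreover have "maximal_function \<mu> \<phi> x \<le> ennreal (m + e / c)"
        unfolding m using e c by (intro ennreal_leI) auto
      ultimately have "ennreal (cmod (truncated \<mu> K r \<phi> x)) \<le> Y + ennreal (c * (m + e / c))"
        unfolding Y_def c_def using False r p c unfolding c_def
        by (intro truncated_le_power_average \<phi> averages_le_maximal_function) auto
      also have "c * (m + e / c) = c * m + e" using c by (simp add: field_simps)
      also have "Y + ennreal (c * m + e) = Y + ennreal c * maximal_function \<mu> \<phi> x + ennreal e"
        using m c e by (simp add: ennreal_mult add.assoc)
      finally show "ennreal (cmod (truncated \<mu> K r \<phi> x)) \<le> Y + ennreal c * maximal_function \<mu> \<phi> x + ennreal e" .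
    qed
  qed
  then show ?thesis unfolding maximal_singular_def Y_def c_def by (intro SUP_least) auto
qed

end

theorem theorem4:
  fixes \<epsilon> N :: real
  assumes "\<epsilon> > 0" and "N \<ge> 0"
  shows "\<exists>(A::real) (B::real) (Ap :: real \<Rightarrow> real) (Bp :: real \<Rightarrow> real).
    0 \<le> A \<and> 0 \<le> B \<and> (\<forall>p \<in> {0<..<1}. 0 \<le> Ap p \<and> 0 \<le> Bp p) \<and>
    (\<forall>(\<mu> :: complex measure) (K :: complex \<Rightarrow> complex \<Rightarrow> complex) (T :: operator).
       sets \<mu> = sets borel \<and> linear_growth \<mu> \<and> cz_kernel \<epsilon> K \<and> cz_operator \<mu> K N T \<longrightarrow>
       (\<forall>(q::real) (S :: operator). 1 \<le> q \<and> is_extension \<mu> T q S \<longrightarrow>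
         (\<forall>\<phi> \<in> Lq \<mu> q. \<forall>x.
            (\<forall>p \<in> {0<..<1}. maximal_singular \<mu> K \<phi> x \<le>
               ennreal (Ap p) * epowr (maximal_function \<mu> (\<lambda>y. cmod (S \<phi> y) powr p) x) (1 / p)
               + ennreal (Bp p) * maximal_function \<mu> \<phi> x) \<and>
            maximal_singular \<mu> K \<phi> x \<le>
               ennreal A * maximal_function \<mu> (S \<phi>) x + ennreal B * maximal_function \<mu> \<phi> x)))"
proof (rule exI[of _ 2], rule exI[of _ "cotlar_const \<epsilon> N"], rule exI[of _ "\<lambda>p. 2 powr (1 / p)"],
    rule exI[of _ "\<lambda>_. cotlar_const \<epsilon> N"], intro conjI ballI allI impI)
  show "0 \<le> cotlar_const \<epsilon> N" "0 \<le> cotlar_const \<epsilon> N" using cotlar_const_pos[OF assms(1), of N] by simp_all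
  fix \<mu> :: "complex measure" and K :: "complex \<Rightarrow> complex \<Rightarrow> complex" and T :: operator
    and q :: real and S :: operator and \<phi> x
  assume "sets \<mu> = sets borel \<and> linear_growth \<mu> \<and> cz_kernel \<epsilon> K \<and> cz_operator \<mu> K N T"
    and "1 \<le> q \<and> is_extension \<mu> T q S" and \<phi>: "\<phi> \<in> Lq \<mu> q"
  then interpret cz_extension \<mu> \<epsilon> N K T q S
    using assms by unfold_locales auto
  show "maximal_singular \<mu> K \<phi> x \<le>
      ennreal (2 powr (1 / p)) * epowr (maximal_function \<mu> (\<lambda>y. cmod (S \<phi> y) powr p) x) (1 / p)
      + ennreal (cotlar_const \<epsilon> N) * maximal_function \<mu> \<phi> x" if "p \<in> {0<..<1}" for p
    using that by (intro cotlar_inequality[OF \<phi>]) simp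
  \<comment> \<open>The second assertion is the case p = 1, which explains the constant 2 =
    2^(1/1).\<close>
  have "maximal_function \<mu> (\<lambda>y. cmod (S \<phi> y) powr 1) x = maximal_function \<mu> (S \<phi>) x"
    by (simp add: maximal_function_def)
  moreover have "epowr t (1 / 1) = t" for t
    by (simp add: epowr_def less_top)
  ultimately show "maximal_singular \<mu> K \<phi> x \<le>
      ennreal 2 * maximal_function \<mu> (S \<phi>) x + ennreal (cotlar_const \<epsilon> N) * maximal_function \<mu> \<phi> x"
    using cotlar_inequality[OF \<phi>, of 1 x] by simp
qed auto

end
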